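(* Suppose that the complex-valued function $V$ belongs to $L^\infty(0,1)$ and $$\|V\|_{L^\infty(0,1)}\leqslant c_0\sqrt{\alpha},$$ where $\alpha\in(0,1)$ and $c_0>0$ is some constant independent of $\alpha$ ($V$ may depend on $\alpha$). Then the following holds. (i) The operator $\mathcal{H}(\alpha)$ is $m$-sectorial, and the associated sectorial closed form in the space $L^2(0,1)$ is defined by the identity $$\mathfrak{h}^\alpha(u,v)=(u^{(k)},v^{(k)})_{L^2(0,1)}+(V\mathcal{L}(\alpha)u,v)_{L^2(0,1)}$$ on the domain $\mathfrak{D}(\mathfrak{h}^\alpha)=\{u\in W_2^k(0,1)\}$. (ii) There exists a number $\Lambda$ independent of $\alpha$ such that the half-plane $\mathrm{Re}\,\lambda\leqslant\Lambda$ is in the resolvent set of the operator $\mathcal{H}(\alpha)$ for each $\alpha\in(0,1)$. (iii) The operator $\mathcal{H}(\alpha)$ has a compact resolvent, and its spectrum consists of countably many eigenvalues with the only accumulation point at infinity.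
   Context: Let $k\geqslant1$ be an integer. $W_2^m(0,1)$ is the Sobolev space of functions in $L^2(0,1)$ with weak derivatives up to order $m$ in $L^2(0,1)$, and $(\cdot,\cdot)_{L^2(0,1)}$ is the inner product, linear in the first argument. Two types of boundary conditions are considered, and the result is stated for either one: Dirichlet type: $y^{(2j)}(0)=y^{(2j)}(1)=0$ for $0\leqslant j\leqslant k-1$; Neumann type: $y^{(2j+1)}(0)=y^{(2j+1)}(1)=0$ for $0\leqslant j\leqslant k-1$. $\mathcal{A}$ is the self-adjoint operator in $L^2(0,1)$ given by $\mathcal{A}y=(-1)^ky^{(2k)}$ on the domain $\mathfrak{D}(\mathcal{A})$ of functions $y\in W_2^{2k}(0,1)$ satisfying the chosen boundary conditions. For $\alpha\in(0,1)$, the contraction operator in $L^2(0,1)$ is $(\mathcal{L}(\alpha)y)(x)=y(\alpha x)$, $x\in(0,1)$. The operator $\mathcal{H}(\alpha)$ is defined on $\mathfrak{D}(\mathcal{H}(\alpha))=\mathfrak{D}(\mathcal{A})$ by $$(\mathcal{H}(\alpha)y)(x)=(-1)^ky^{(2k)}(x)+V(x)\,y(\alpha x).$$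
   Formalization: The form domain is W_2^k(0,1) with those chosen boundary conditions of order less than k; on all of W_2^k the claim fails (for k=1, Dirichlet, V=0 the form would give the Neumann operator). For k=1, Neumann, it is all of W_2^1. *)

theory Defs
  imports "HOL-Analysis.Analysis" "HOL-Probability.Essential_Supremum"
begin

section \<open>Complex inner product spaces\<close>

text \<open>The inner product is linear in its first argument. Its real part is the real inner product
  of the underlying \<^class>\<open>real_inner\<close> structure, so norm, metric, and topology are the usual ones.\<close>

class complex_inner = real_inner +
  fixes scaleC :: "complex \<Rightarrow> 'a \<Rightarrow> 'a" (infixr "*\<^sub>C" 75)
    and cinner :: "'a \<Rightarrow> 'a \<Rightarrow> complex"
  assumes scaleC_add_right: "c *\<^sub>C (x + y) = c *\<^sub>C x + c *\<^sub>C y"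
    and scaleC_add_left: "(c + d) *\<^sub>C x = c *\<^sub>C x + d *\<^sub>C x"
    and scaleC_scaleC: "c *\<^sub>C (d *\<^sub>C x) = (c * d) *\<^sub>C x"
    and scaleR_scaleC: "r *\<^sub>R x = complex_of_real r *\<^sub>C x"
    and cinner_add_left: "cinner (x + y) z = cinner x z + cinner y z"
    and cinner_scaleC_left: "cinner (c *\<^sub>C x) y = c * cinner x y"
    and cinner_commute: "cinner x y = cnj (cinner y x)"
    and inner_eq_Re_cinner: "inner x y = Re (cinner x y)"


section \<open>Unbounded operators and sesquilinear forms\<close>

text \<open>An unbounded operator is given by its domain \<open>D\<close> and a function \<open>T\<close> whose values outside
  \<open>D\<close> are irrelevant; likewise for forms. The terminology is that of Kato's
  ``Perturbation Theory for Linear Operators'', Sections III.6, V.3.10 and VI.1--2.\<close>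

definition csubspace :: "'a::complex_inner set \<Rightarrow> bool" where
  "csubspace D \<longleftrightarrow> 0 \<in> D \<and> (\<forall>x\<in>D. \<forall>y\<in>D. x + y \<in> D) \<and> (\<forall>c. \<forall>x\<in>D. c *\<^sub>C x \<in> D)"

definition clinear_on :: "'a::complex_inner set \<Rightarrow> ('a \<Rightarrow> 'a) \<Rightarrow> bool" where
  "clinear_on D T \<longleftrightarrow> csubspace D \<and> (\<forall>x\<in>D. \<forall>y\<in>D. T (x + y) = T x + T y) \<and>
     (\<forall>c. \<forall>x\<in>D. T (c *\<^sub>C x) = c *\<^sub>C T x)"

definition resolvent :: "'a::complex_inner set \<Rightarrow> ('a \<Rightarrow> 'a) \<Rightarrow> complex \<Rightarrow> 'a \<Rightarrow> 'a" where
  "resolvent D T z = inv_into D (\<lambda>u. T u - z *\<^sub>C u)"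

definition resolvent_set :: "'a::complex_inner set \<Rightarrow> ('a \<Rightarrow> 'a) \<Rightarrow> complex set" where
  "resolvent_set D T =
     {z. bij_betw (\<lambda>u. T u - z *\<^sub>C u) D UNIV \<and> bounded_linear (resolvent D T z)}"

definition spectrum :: "'a::complex_inner set \<Rightarrow> ('a \<Rightarrow> 'a) \<Rightarrow> complex set" where
  "spectrum D T = - resolvent_set D T"

definition eigenvalues :: "'a::complex_inner set \<Rightarrow> ('a \<Rightarrow> 'a) \<Rightarrow> complex set" where
  "eigenvalues D T = {z. \<exists>u\<in>D. u \<noteq> 0 \<and> T u = z *\<^sub>C u}"

definition compact_operator :: "('a::complex_inner \<Rightarrow> 'a) \<Rightarrow> bool" where
  "compact_operator K \<longleftrightarrow>
     bounded_linear K \<and> (\<forall>S. bounded S \<longrightarrow> compact (closure (K ` S)))"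

definition has_compact_resolvent :: "'a::complex_inner set \<Rightarrow> ('a \<Rightarrow> 'a) \<Rightarrow> bool" where
  "has_compact_resolvent D T \<longleftrightarrow> resolvent_set D T \<noteq> {} \<and>
     (\<forall>z\<in>resolvent_set D T. compact_operator (resolvent D T z))"

text \<open>The closed sector with real vertex \<open>\<gamma>\<close> and semi-angle \<open>\<theta>\<close>. It contains \<open>\<gamma>\<close> for
  \<open>\<theta> \<ge> 0\<close>, because \<open>Arg 0 = 0\<close>.\<close>

definition sector :: "real \<Rightarrow> real \<Rightarrow> complex set" where
  "sector \<gamma> \<theta> = {z. \<bar>Arg (z - complex_of_real \<gamma>)\<bar> \<le> \<theta>}"

definition sectorial_operator :: "'a::complex_inner set \<Rightarrow> ('a \<Rightarrow> 'a) \<Rightarrow> bool" where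
  "sectorial_operator D T \<longleftrightarrow> clinear_on D T \<and>
     (\<exists>\<gamma> \<theta>. 0 \<le> \<theta> \<and> \<theta> < pi / 2 \<and> {cinner (T u) u | u. u \<in> D \<and> norm u = 1} \<subseteq> sector \<gamma> \<theta>)"

definition m_accretive :: "'a::complex_inner set \<Rightarrow> ('a \<Rightarrow> 'a) \<Rightarrow> bool" where
  "m_accretive D T \<longleftrightarrow> clinear_on D T \<and> (\<forall>u\<in>D. 0 \<le> Re (cinner (T u) u)) \<and>
     (\<forall>z. 0 < Re z \<longrightarrow>
        - z \<in> resolvent_set D T \<and> onorm (resolvent D T (- z)) \<le> 1 / Re z)"

definition quasi_m_accretive :: "'a::complex_inner set \<Rightarrow> ('a \<Rightarrow> 'a) \<Rightarrow> bool" where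
  "quasi_m_accretive D T \<longleftrightarrow> (\<exists>c::real. m_accretive D (\<lambda>u. T u + c *\<^sub>R u))"

definition m_sectorial :: "'a::complex_inner set \<Rightarrow> ('a \<Rightarrow> 'a) \<Rightarrow> bool" where
  "m_sectorial D T \<longleftrightarrow> sectorial_operator D T \<and> quasi_m_accretive D T"

definition sesquilinear_on :: "'a::complex_inner set \<Rightarrow> ('a \<Rightarrow> 'a \<Rightarrow> complex) \<Rightarrow> bool" where
  "sesquilinear_on D t \<longleftrightarrow> csubspace D \<and>
     (\<forall>u\<in>D. \<forall>v\<in>D. \<forall>w\<in>D. t (u + v) w = t u w + t v w \<and> t w (u + v) = t w u + t w v) \<and>
     (\<forall>c. \<forall>u\<in>D. \<forall>v\<in>D. t (c *\<^sub>C u) v = c * t u v \<and> t u (c *\<^sub>C v) = cnj c * t u v)"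

definition sectorial_form :: "'a::complex_inner set \<Rightarrow> ('a \<Rightarrow> 'a \<Rightarrow> complex) \<Rightarrow> bool" where
  "sectorial_form D t \<longleftrightarrow> sesquilinear_on D t \<and>
     (\<exists>\<gamma> \<theta>. 0 \<le> \<theta> \<and> \<theta> < pi / 2 \<and> {t u u | u. u \<in> D \<and> norm u = 1} \<subseteq> sector \<gamma> \<theta>)"

definition closed_form :: "'a::complex_inner set \<Rightarrow> ('a \<Rightarrow> 'a \<Rightarrow> complex) \<Rightarrow> bool" where
  "closed_form D t \<longleftrightarrow>
     (\<forall>u x. (\<forall>n. u n \<in> D) \<longrightarrow> u \<longlonglongrightarrow> x \<longrightarrow>
        (\<forall>e>0. \<exists>N. \<forall>m\<ge>N. \<forall>n\<ge>N. norm (t (u m - u n) (u m - u n)) < e) \<longrightarrow>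
        x \<in> D \<and> (\<lambda>n. t (u n - x) (u n - x)) \<longlonglongrightarrow> 0)"

text \<open>The operator that the first representation theorem attaches to a densely defined closed
  sectorial form \<open>t\<close>: \<open>T u = w\<close> iff \<open>u\<close> is in the form domain \<open>Dt\<close> and \<open>t u v = cinner w v\<close>
  for all \<open>v \<in> Dt\<close>.\<close>

definition associated_operator ::
    "'a::complex_inner set \<Rightarrow> ('a \<Rightarrow> 'a \<Rightarrow> complex) \<Rightarrow> 'a set \<Rightarrow> ('a \<Rightarrow> 'a) \<Rightarrow> bool" where
  "associated_operator Dt t D T \<longleftrightarrow> closure Dt = UNIV \<and>
     (\<forall>u w. u \<in> D \<and> T u = w \<longleftrightarrow> u \<in> Dt \<and> (\<forall>v\<in>Dt. t u v = cinner w v))"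


section \<open>The Hilbert space \<open>L2(0,1)\<close>\<close>

abbreviation unit_leb :: "real measure" where
  "unit_leb \<equiv> lebesgue_on {0<..<1}"

definition square_integrable :: "(real \<Rightarrow> complex) \<Rightarrow> bool" where
  "square_integrable f \<longleftrightarrow>
     f \<in> borel_measurable unit_leb \<and> integrable unit_leb (\<lambda>x. (norm (f x))\<^sup>2)"

definition L2_rel :: "(real \<Rightarrow> complex) \<Rightarrow> (real \<Rightarrow> complex) \<Rightarrow> bool" where
  "L2_rel f g \<longleftrightarrow> square_integrable f \<and> square_integrable g \<and> (AE x in unit_leb. f x = g x)"

lemma square_integrable_mult:
  assumes "square_integrable f" "square_integrable g"
  shows "integrable unit_leb (\<lambda>x. f x * cnj (g x))"
proof (rule Bochner_Integration.integrable_bound)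
  show "integrable unit_leb (\<lambda>x. (norm (f x))\<^sup>2 + (norm (g x))\<^sup>2)"
    using assms by (auto simp: square_integrable_def)
  show "(\<lambda>x. f x * cnj (g x)) \<in> borel_measurable unit_leb"
    using assms by (auto simp: square_integrable_def intro!: borel_measurable_times
        borel_measurable_continuous_on[where f=cnj] continuous_intros)
  have "a * b \<le> a\<^sup>2 + b\<^sup>2" if "a \<ge> 0" "b \<ge> 0" for a b :: real
    using sum_squares_bound[of a b] that mult_nonneg_nonneg[OF that] by linarith
  then show "AE x in unit_leb. norm (f x * cnj (g x)) \<le> norm ((norm (f x))\<^sup>2 + (norm (g x))\<^sup>2)"
    by (auto simp: norm_mult)
qed

lemma square_integrable_add:
  assumes "square_integrable f" "square_integrable g"
  shows "square_integrable (\<lambda>x. f x + g x)"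
  unfolding square_integrable_def
proof
  show m: "(\<lambda>x. f x + g x) \<in> borel_measurable unit_leb"
    using assms by (auto simp: square_integrable_def)
  show "integrable unit_leb (\<lambda>x. (norm (f x + g x))\<^sup>2)"
  proof (rule Bochner_Integration.integrable_bound)
    show "integrable unit_leb (\<lambda>x. 2 * (norm (f x))\<^sup>2 + 2 * (norm (g x))\<^sup>2)"
      using assms by (auto simp: square_integrable_def)
    show "(\<lambda>x. (norm (f x + g x))\<^sup>2) \<in> borel_measurable unit_leb"
      using m by measurable
    have "(norm (a + b))\<^sup>2 \<le> 2 * (norm a)\<^sup>2 + 2 * (norm b)\<^sup>2" for a b :: complex
    proof -
      have "(norm (a + b))\<^sup>2 \<le> (norm a + norm b)\<^sup>2"
        by (intro power_mono norm_triangle_ineq) auto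
      also have "\<dots> \<le> 2 * (norm a)\<^sup>2 + 2 * (norm b)\<^sup>2"
        using sum_squares_bound[of "norm a" "norm b"] by (simp add: power2_sum)
      finally show ?thesis .
    qed
    then show "AE x in unit_leb.
        norm ((norm (f x + g x))\<^sup>2) \<le> norm (2 * (norm (f x))\<^sup>2 + 2 * (norm (g x))\<^sup>2)"
      by auto
  qed
qed

lemma square_integrable_scale:
  "square_integrable f \<Longrightarrow> square_integrable (\<lambda>x. c * f x)"
  by (auto simp: square_integrable_def norm_mult power_mult_distrib)

lemma square_integrable_zero: "square_integrable (\<lambda>x. 0)"
  by (auto simp: square_integrable_def)

quotient_type L2 = "real \<Rightarrow> complex" / partial: L2_rel
  morphisms fun_of L2_of
proof (rule part_equivpI)
  show "\<exists>x. L2_rel x x"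
    using square_integrable_zero by (auto simp: L2_rel_def)
  show "symp L2_rel"
    by (rule sympI) (auto simp: L2_rel_def elim: eventually_mono)
  show "transp L2_rel"
    by (rule transpI) (auto simp: L2_rel_def elim: eventually_elim2)
qed

instantiation L2 :: complex_inner
begin

lift_definition zero_L2 :: L2 is "\<lambda>x. 0"
  by (auto simp: L2_rel_def square_integrable_zero)

lift_definition plus_L2 :: "L2 \<Rightarrow> L2 \<Rightarrow> L2" is "\<lambda>f g x. f x + g x"
  by (auto simp: L2_rel_def square_integrable_add elim: eventually_elim2)

lift_definition scaleC_L2 :: "complex \<Rightarrow> L2 \<Rightarrow> L2" is "\<lambda>c f x. c * f x"
  by (auto simp: L2_rel_def square_integrable_scale elim: eventually_mono)

lift_definition cinner_L2 :: "L2 \<Rightarrow> L2 \<Rightarrow> complex" is "\<lambda>f g. LINT x|unit_leb. f x * cnj (g x)"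
proof -
  fix f f' g g' assume "L2_rel f f'" "L2_rel g g'"
  then show "(LINT x|unit_leb. f x * cnj (g x)) = (LINT x|unit_leb. f' x * cnj (g' x))"
    by (intro integral_cong_AE borel_measurable_integrable[OF square_integrable_mult])
      (auto simp: L2_rel_def elim: eventually_elim2)
qed

definition "uminus_L2 (u::L2) = (-1) *\<^sub>C u"
definition "minus_L2 (u::L2) v = u + (-1) *\<^sub>C v"
definition "scaleR_L2 r (u::L2) = complex_of_real r *\<^sub>C u"
definition "inner_L2 (u::L2) v = Re (cinner u v)"
definition "norm_L2 (u::L2) = sqrt (inner u u)"
definition "dist_L2 (u::L2) v = norm (u - v)"
definition "sgn_L2 (u::L2) = inverse (norm u) *\<^sub>R u"
definition "uniformity_L2 = (INF e\<in>{0<..}. principal {(x::L2, y). dist x y < e})"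
definition "open_L2 (U::L2 set) =
  (\<forall>x\<in>U. eventually (\<lambda>(x', y). x' = x \<longrightarrow> y \<in> U) uniformity)"

instance
proof
  fix x y z :: L2 and a b :: real and c d :: complex
  show "x + y + z = x + (y + z)" "x + y = y + x" "0 + x = x"
    by (transfer, auto simp: L2_rel_def algebra_simps intro!: square_integrable_add)+
  show "- x + x = 0"
    unfolding uminus_L2_def
    by transfer (auto simp: L2_rel_def square_integrable_zero)
  show "x - y = x + - y"
    by (simp add: uminus_L2_def minus_L2_def)
  show sC: "c *\<^sub>C (x + y) = c *\<^sub>C x + c *\<^sub>C y" "(c + d) *\<^sub>C x = c *\<^sub>C x + d *\<^sub>C x"
    "c *\<^sub>C (d *\<^sub>C x) = (c * d) *\<^sub>C x" for x y :: L2 and c d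
    by (transfer, auto simp: L2_rel_def algebra_simps
        intro!: square_integrable_add square_integrable_scale)+
  have "1 *\<^sub>C x = x"
    by transfer (auto simp: L2_rel_def)
  then show "a *\<^sub>R (x + y) = a *\<^sub>R x + a *\<^sub>R y" "(a + b) *\<^sub>R x = a *\<^sub>R x + b *\<^sub>R x"
    "a *\<^sub>R (b *\<^sub>R x) = (a * b) *\<^sub>R x" "1 *\<^sub>R x = x"
    by (simp_all add: scaleR_L2_def sC)
  show "a *\<^sub>R x = complex_of_real a *\<^sub>C x"
    by (simp add: scaleR_L2_def)
  show ia: "cinner (x + y) z = cinner x z + cinner y z"
    by transfer (simp add: L2_rel_def square_integrable_mult distrib_right)
  show isc: "cinner (c *\<^sub>C x) y = c * cinner x y" for c
    by transfer (simp add: mult.assoc)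
  show ic: "cinner x y = cnj (cinner y x)" for x y :: L2
    by transfer (simp add: mult.commute flip: Bochner_Integration.integral_cnj)
  show "inner x y = inner y x"
    unfolding inner_L2_def by (subst ic) simp
  show "inner (x + y) z = inner x z + inner y z" "inner (a *\<^sub>R x) y = a * inner x y"
    by (simp_all add: inner_L2_def ia isc scaleR_L2_def)
  have re: "Re (LINT x|unit_leb. f x * cnj (f x)) = (LINT x|unit_leb. (norm (f x))\<^sup>2)" for f
    by (simp only: complex_norm_square[symmetric] integral_complex_of_real Re_complex_of_real)
  show "0 \<le> inner x x"
    unfolding inner_L2_def by transfer (simp only: re, simp)
  show "inner x x = 0 \<longleftrightarrow> x = 0"
    unfolding inner_L2_def
  proof transfer
    fix f assume "L2_rel f f"
    then have f: "square_integrable f" by (simp add: L2_rel_def)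
    have "Re (LINT x|unit_leb. f x * cnj (f x)) = 0 \<longleftrightarrow> (AE x in unit_leb. (norm (f x))\<^sup>2 = 0)"
      unfolding re using f
      by (intro integral_nonneg_eq_0_iff_AE) (auto simp: square_integrable_def)
    then show "(Re (LINT x|unit_leb. f x * cnj (f x)) = 0) = L2_rel f (\<lambda>x. 0)"
      using f by (auto simp: L2_rel_def square_integrable_zero)
  qed
  show "norm x = sqrt (inner x x)" "dist x y = norm (x - y)" "sgn x = inverse (norm x) *\<^sub>R x"
    "inner x y = Re (cinner x y)"
    by (simp_all add: norm_L2_def dist_L2_def sgn_L2_def inner_L2_def)
qed (simp_all add: uniformity_L2_def open_L2_def)

end


section \<open>Sobolev spaces and boundary values\<close>

definition test_function :: "(real \<Rightarrow> real) \<Rightarrow> bool" where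
  "test_function \<phi> \<longleftrightarrow> (\<forall>n. (deriv ^^ n) \<phi> differentiable_on UNIV) \<and>
     (\<exists>a b. 0 < a \<and> b < 1 \<and> (\<forall>x. x \<notin> {a..b} \<longrightarrow> \<phi> x = 0))"

definition is_weak_deriv :: "nat \<Rightarrow> L2 \<Rightarrow> L2 \<Rightarrow> bool" where
  "is_weak_deriv j u w \<longleftrightarrow> (\<forall>\<phi>. test_function \<phi> \<longrightarrow>
     (LINT x|unit_leb. fun_of u x * complex_of_real ((deriv ^^ j) \<phi> x)) =
     (-1) ^ j * (LINT x|unit_leb. fun_of w x * complex_of_real (\<phi> x)))"

definition wderiv :: "nat \<Rightarrow> L2 \<Rightarrow> L2" where
  "wderiv j u = (THE w. is_weak_deriv j u w)"

definition sobolev :: "nat \<Rightarrow> L2 set" where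
  "sobolev m = {u. \<forall>j\<le>m. \<exists>w. is_weak_deriv j u w}"

text \<open>The value at a point \<open>t\<close> of \<open>[0,1]\<close> of the representative that is continuous on the closed
  interval. It is only used for weak derivatives of order less than \<open>m\<close> of functions in
  \<open>sobolev m\<close>, for which this representative exists.\<close>

definition point_value :: "L2 \<Rightarrow> real \<Rightarrow> complex" where
  "point_value u t =
     (THE c. \<exists>f. continuous_on {0..1} f \<and> (AE x in unit_leb. fun_of u x = f x) \<and> f t = c)"

datatype boundary_type = Dirichlet | Neumann

fun bc_order :: "boundary_type \<Rightarrow> nat \<Rightarrow> nat" where
  "bc_order Dirichlet j = 2 * j"
| "bc_order Neumann j = 2 * j + 1"

definition vanishes_at_ends :: "L2 \<Rightarrow> bool" where
  "vanishes_at_ends u \<longleftrightarrow> point_value u 0 = 0 \<and> point_value u 1 = 0"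

definition operator_domain :: "nat \<Rightarrow> boundary_type \<Rightarrow> L2 set" where
  "operator_domain k bc =
     {y \<in> sobolev (2 * k). \<forall>j<k. vanishes_at_ends (wderiv (bc_order bc j) y)}"

text \<open>The form domain keeps those boundary conditions that have a meaning in \<open>sobolev k\<close>, that is,
  those of order less than \<open>k\<close>; the remaining ones are natural boundary conditions.\<close>

definition form_domain :: "nat \<Rightarrow> boundary_type \<Rightarrow> L2 set" where
  "form_domain k bc =
     {u \<in> sobolev k. \<forall>j. bc_order bc j < k \<longrightarrow> vanishes_at_ends (wderiv (bc_order bc j) u)}"


section \<open>The operator with contraction and its form\<close>

definition Linf_norm :: "(real \<Rightarrow> complex) \<Rightarrow> ereal" where
  "Linf_norm V = esssup unit_leb (\<lambda>x. ereal (norm (V x)))"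

definition Linf :: "(real \<Rightarrow> complex) set" where
  "Linf = {V \<in> borel_measurable unit_leb. Linf_norm V < \<infinity>}"

definition mult_op :: "(real \<Rightarrow> complex) \<Rightarrow> L2 \<Rightarrow> L2" where
  "mult_op V y = L2_of (\<lambda>x. V x * fun_of y x)"

definition contraction :: "real \<Rightarrow> L2 \<Rightarrow> L2" where
  "contraction \<alpha> y = L2_of (\<lambda>x. fun_of y (\<alpha> * x))"

definition H_op :: "nat \<Rightarrow> real \<Rightarrow> (real \<Rightarrow> complex) \<Rightarrow> L2 \<Rightarrow> L2" where
  "H_op k \<alpha> V y = (-1) ^ k *\<^sub>C wderiv (2 * k) y + mult_op V (contraction \<alpha> y)"

definition h_form :: "nat \<Rightarrow> real \<Rightarrow> (real \<Rightarrow> complex) \<Rightarrow> L2 \<Rightarrow> L2 \<Rightarrow> complex" where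
  "h_form k \<alpha> V u v =
     cinner (wderiv k u) (wderiv k v) + cinner (mult_op V (contraction \<alpha> u)) v"

text \<open>Multiplication and contraction stay in \<open>L2(0,1)\<close> and do not depend on the chosen representative.\<close>

lemma mult_op_L2_of:
  assumes V: "V \<in> Linf" and f: "square_integrable f"
  shows "square_integrable (\<lambda>x. V x * f x)" "mult_op V (L2_of f) = L2_of (\<lambda>x. V x * f x)"
proof -
  have Vm: "V \<in> borel_measurable unit_leb" using V by (simp add: Linf_def)
  obtain C where C: "Linf_norm V \<le> ereal C"
    using V by (cases "Linf_norm V") (auto simp: Linf_def)
  have bd: "AE x in unit_leb. norm (V x) \<le> C"
    using esssup_AE[of "\<lambda>x. ereal (norm (V x))" unit_leb] C
    unfolding Linf_norm_def by (auto elim!: eventually_mono dest: order_trans)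
  have sq: "square_integrable (\<lambda>x. V x * g x)" if g: "square_integrable g" for g
    unfolding square_integrable_def
  proof
    show m: "(\<lambda>x. V x * g x) \<in> borel_measurable unit_leb"
      using Vm g by (auto simp: square_integrable_def)
    show "integrable unit_leb (\<lambda>x. (norm (V x * g x))\<^sup>2)"
    proof (rule Bochner_Integration.integrable_bound)
      show "integrable unit_leb (\<lambda>x. C\<^sup>2 * (norm (g x))\<^sup>2)"
        using g by (auto simp: square_integrable_def)
      show "(\<lambda>x. (norm (V x * g x))\<^sup>2) \<in> borel_measurable unit_leb"
        using m by measurable
      show "AE x in unit_leb. norm ((norm (V x * g x))\<^sup>2) \<le> norm (C\<^sup>2 * (norm (g x))\<^sup>2)"
        using bd by eventually_elim
          (auto simp: norm_mult power_mult_distrib intro!: mult_right_mono power_mono)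
    qed
  qed
  show "square_integrable (\<lambda>x. V x * f x)" by (rule sq[OF f])
  have "L2_rel (fun_of (L2_of f)) f"
    using f by (intro rep_abs_rsp_left[OF Quotient3_L2]) (simp add: L2_rel_def)
  then have "L2_rel (\<lambda>x. V x * fun_of (L2_of f) x) (\<lambda>x. V x * f x)"
    by (auto simp: L2_rel_def sq elim: eventually_mono)
  then show "mult_op V (L2_of f) = L2_of (\<lambda>x. V x * f x)"
    unfolding mult_op_def by (rule Quotient3_rel_abs[OF Quotient3_L2])
qed

lemma contraction_L2_of:
  assumes \<alpha>: "\<alpha> \<in> {0<..<1}" and f: "square_integrable f"
  shows "square_integrable (\<lambda>x. f (\<alpha> * x))" "contraction \<alpha> (L2_of f) = L2_of (\<lambda>x. f (\<alpha> * x))"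
proof -
  have S: "\<alpha> * x \<in> {0<..<1}" if "x \<in> {0<..<1}" for x
    using \<alpha> that mult_strict_mono[of \<alpha> 1 x 1] by auto
  have sc: "(\<lambda>x. \<alpha> * x) \<in> lebesgue \<rightarrow>\<^sub>M lebesgue"
    using lebesgue_affine_measurable[where c="\<lambda>x::real. \<alpha>" and t=0] \<alpha> by simp
  have m: "(\<lambda>x. \<alpha> * x) \<in> unit_leb \<rightarrow>\<^sub>M unit_leb"
    using S by (intro measurable_restrict_space3[OF sc]) auto
  have sq: "square_integrable (\<lambda>x. g (\<alpha> * x))" if g: "square_integrable g" for g
    unfolding square_integrable_def
  proof
    show "(\<lambda>x. g (\<alpha> * x)) \<in> borel_measurable unit_leb"
      using measurable_compose[OF m] g by (auto simp: square_integrable_def)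
    have "integrable lebesgue (\<lambda>x. indicator {0<..<1} x *\<^sub>R (norm (g x))\<^sup>2)"
      using g by (simp add: square_integrable_def integrable_restrict_space)
    from lebesgue_integrable_real_affine[OF this, of \<alpha> 0]
    have "integrable lebesgue (\<lambda>x. indicator {0<..<1} (\<alpha> * x) *\<^sub>R (norm (g (\<alpha> * x)))\<^sup>2)"
      using \<alpha> by simp
    then have "integrable lebesgue (\<lambda>x. indicator {0<..<1} x *\<^sub>R
        (indicator {0<..<1} (\<alpha> * x) *\<^sub>R (norm (g (\<alpha> * x)))\<^sup>2))"
      by (intro integrable_mult_indicator) auto
    also have "(\<lambda>x. indicator {0<..<1} x *\<^sub>R
        (indicator {0<..<1} (\<alpha> * x) *\<^sub>R (norm (g (\<alpha> * x)))\<^sup>2)) =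
        (\<lambda>x. indicator {0<..<1} x *\<^sub>R (norm (g (\<alpha> * x)))\<^sup>2)"
      using S by (auto simp: indicator_def fun_eq_iff)
    finally show "integrable unit_leb (\<lambda>x. (norm (g (\<alpha> * x)))\<^sup>2)"
      by (simp add: integrable_restrict_space)
  qed
  show "square_integrable (\<lambda>x. f (\<alpha> * x))" by (rule sq[OF f])
  have ae: "AE x in unit_leb. P (\<alpha> * x)" if "AE x in unit_leb. P x" for P
  proof -
    have "AE x in lebesgue. x \<in> {0<..<1} \<longrightarrow> P x"
      using that by (simp add: AE_restrict_space_iff)
    then have "AE x in density (distr lebesgue lebesgue (\<lambda>x. \<alpha> * x)) (\<lambda>_. ennreal \<bar>\<alpha>\<bar>).
        x \<in> {0<..<1} \<longrightarrow> P x"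
      by (subst lebesgue_real_affine[of \<alpha> 0, symmetric, simplified add_0]) (use \<alpha> in auto)
    then have "AE x in distr lebesgue lebesgue (\<lambda>x. \<alpha> * x). x \<in> {0<..<1} \<longrightarrow> P x"
      using \<alpha> by (subst (asm) AE_density) auto
    from AE_distrD[OF sc this] have "AE x in lebesgue. \<alpha> * x \<in> {0<..<1} \<longrightarrow> P (\<alpha> * x)" .
    then have "AE x in lebesgue. x \<in> {0<..<1} \<longrightarrow> P (\<alpha> * x)"
      by eventually_elim (use S in auto)
    then show ?thesis
      by (simp add: AE_restrict_space_iff)
  qed
  have "L2_rel (fun_of (L2_of f)) f"
    using f by (intro rep_abs_rsp_left[OF Quotient3_L2]) (simp add: L2_rel_def)
  then have "L2_rel (\<lambda>x. fun_of (L2_of f) (\<alpha> * x)) (\<lambda>x. f (\<alpha> * x))"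
    using ae[of "\<lambda>x. fun_of (L2_of f) x = f x"] by (auto simp: L2_rel_def sq)
  then show "contraction \<alpha> (L2_of f) = L2_of (\<lambda>x. f (\<alpha> * x))"
    unfolding contraction_def by (rule Quotient3_rel_abs[OF Quotient3_L2])
qed

end

theory Submission
  imports Defs
begin

text \<open>The sine basis (Dirichlet) or cosine basis (Neumann) diagonalises the unperturbed operator: a function
  belongs to the operator domain iff its coefficients \<open>u\<^sub>n\<close> satisfy \<open>\<Sum> (\<pi> n)\<^bsup>4k\<^esup> \<bar>u\<^sub>n\<bar>\<^sup>2 < \<infinity>\<close>, and to the form
  domain iff \<open>\<Sum> (\<pi> n)\<^bsup>2k\<^esup> \<bar>u\<^sub>n\<bar>\<^sup>2 < \<infinity>\<close>. The bound on \<open>V\<close> exactly compensates the norm \<open>\<alpha>\<^bsup>-1/2\<^esup>\<close> of the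
  contraction, so the perturbation \<open>B\<close> has norm at most \<open>c\<^sub>0\<close>, uniformly in \<open>\<alpha>\<close>. Everything then follows for
  bounded perturbations of a diagonal operator with entries \<open>\<lambda>\<^sub>n \<rightarrow> \<infinity>\<close>: resolvents come from Banach's fixed
  point theorem, compactness from \<open>\<lambda>\<^sub>n \<rightarrow> \<infinity>\<close>, and a Schur flag argument bounds the number of eigenvalues in
  each half-plane \<open>Re z \<le> R\<close>. The spectrum is unbounded because the gaps between the \<open>\<lambda>\<^sub>n\<close> grow, which traps
  an eigenvalue within \<open>2 c\<^sub>0\<close> of each large \<open>\<lambda>\<^sub>n\<close>.\<close>

section \<open>Complex Hilbert spaces\<close>

text \<open>Test functions vanish near the ends, so weak derivatives do not see boundary conditions.
  The passage to coefficients therefore uses continuous representatives that satisfy integration by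
  parts with boundary terms (\<open>by_parts\<close>), and does so only for first order. Higher
  orders follow by induction: each derivative exchanges sines and cosines, and the conditions that
  define a domain sit exactly at the orders where the current system is the sine system; at the
  other orders the boundary terms vanish because the function tested with is a sine. In general the
  perturbation is neither symmetric nor compact, so neither the spectral theorem nor compact
  perturbation theory applies directly. The diagonal part enters through its square root, with
  entries \<open>\<kappa> n = (pi n)^k\<close>, so that form and operator come from the same family
  of multipliers. The diagonal is nonnegative, hence any z with real part below
  \<open>- c\<^sub>0\<close> is farther than \<open>c\<^sub>0\<close> from it;
  \<open>- c\<^sub>0 - 1\<close> is one admissible \<Lambda>. The gaps grow because the exponent 2k
  is at least 2.\<close>

lemma scaleC_one [simp]: "1 *\<^sub>C x = (x::'a::complex_inner)"
  using scaleR_scaleC[of 1 x] by simp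

lemma scaleC_zero_left [simp]: "0 *\<^sub>C x = (0::'a::complex_inner)"
  using scaleR_scaleC[of 0 x] by simp

lemma scaleC_zero_right [simp]: "c *\<^sub>C 0 = (0::'a::complex_inner)"
  using scaleC_scaleC[of c 0 "0::'a"] by simp

lemma scaleC_minus_left: "(- c) *\<^sub>C x = - (c *\<^sub>C (x::'a::complex_inner))"
  using scaleC_add_left[of "- c" c x] by (simp add: eq_neg_iff_add_eq_0)

lemma scaleC_minus_right: "c *\<^sub>C (- x) = - (c *\<^sub>C (x::'a::complex_inner))"
  using scaleC_add_right[of c "- x" x] by (simp add: eq_neg_iff_add_eq_0)

lemma scaleC_diff_left: "(c - d) *\<^sub>C x = c *\<^sub>C x - d *\<^sub>C (x::'a::complex_inner)"
  using scaleC_add_left[of c "- d" x] by (simp add: scaleC_minus_left)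

lemma scaleC_diff_right: "c *\<^sub>C (x - y) = c *\<^sub>C x - c *\<^sub>C (y::'a::complex_inner)"
  using scaleC_add_right[of c x "- y"] by (simp add: scaleC_minus_right)

lemma scaleC_sum_right: "c *\<^sub>C (\<Sum>i\<in>S. f i) = (\<Sum>i\<in>S. c *\<^sub>C (f i::'a::complex_inner))"
  by (induction S rule: infinite_finite_induct) (auto simp: scaleC_add_right)

lemma cinner_add_right: "cinner z (x + y) = cinner z x + cinner z (y::'a::complex_inner)"
  by (metis cinner_add_left cinner_commute complex_cnj_add)

lemma cinner_scaleC_right: "cinner x (c *\<^sub>C y) = cnj c * cinner x (y::'a::complex_inner)"
  by (metis cinner_commute cinner_scaleC_left complex_cnj_mult)

lemma cinner_self: "cinner x x = complex_of_real ((norm (x::'a::complex_inner))\<^sup>2)"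
proof -
  have "Im (cinner x x) = 0"
    using arg_cong[OF cinner_commute[of x x], of Im] by simp
  moreover have "Re (cinner x x) = (norm x)\<^sup>2"
    by (simp add: power2_norm_eq_inner inner_eq_Re_cinner)
  ultimately show ?thesis
    by (simp add: complex_eq_iff)
qed

lemma norm_scaleC: "norm (c *\<^sub>C x) = norm c * norm (x::'a::complex_inner)"
proof -
  have "complex_of_real ((norm (c *\<^sub>C x))\<^sup>2) = complex_of_real ((norm c * norm x)\<^sup>2)"
    by (simp add: cinner_self[symmetric] cinner_scaleC_left cinner_scaleC_right
        power_mult_distrib complex_norm_square del: of_real_power)
  then show ?thesis
    by (simp only: of_real_eq_iff power2_eq_iff_nonneg norm_ge_zero mult_nonneg_nonneg)
qed

lemma norm_cinner_le: "norm (cinner x y) \<le> norm x * norm (y::'a::complex_inner)"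
proof -
  \<comment> \<open>This phase turns \<open>cinner x y\<close> into its modulus, so the real
    Cauchy-Schwarz inequality suffices. If the inner product is 0, so is \<open>c\<close>; hence
    only an upper bound on its modulus is used.\<close>
  define c where "c = cnj (sgn (cinner x y))"
  have "c * cinner x y = complex_of_real (norm (cinner x y))"
    by (simp add: c_def sgn_eq complex_norm_square[symmetric] power2_eq_square mult.commute)
  then have "norm (cinner x y) = inner (c *\<^sub>C x) y"
    by (simp add: inner_eq_Re_cinner cinner_scaleC_left)
  also have "\<dots> \<le> norm (c *\<^sub>C x) * norm y"
    by (rule norm_cauchy_schwarz)
  also have "\<dots> \<le> norm x * norm y"
    by (intro mult_right_mono) (auto simp: c_def norm_scaleC norm_sgn)
  finally show ?thesis .
qed

lemma bounded_bilinear_cinner: "bounded_bilinear (cinner :: 'a::complex_inner \<Rightarrow> 'a \<Rightarrow> complex)"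
proof
  show "\<exists>K. \<forall>a b::'a. norm (cinner a b) \<le> norm a * norm b * K"
    by (intro exI[of _ 1]) (simp add: norm_cinner_le)
qed (auto simp: cinner_add_left cinner_add_right scaleR_scaleC cinner_scaleC_left
    cinner_scaleC_right scaleR_conv_of_real)

interpretation cinner: bounded_bilinear "cinner :: 'a::complex_inner \<Rightarrow> 'a \<Rightarrow> complex"
  by (rule bounded_bilinear_cinner)

lemma bounded_bilinear_scaleC: "bounded_bilinear (scaleC :: complex \<Rightarrow> 'a::complex_inner \<Rightarrow> 'a)"
proof
  show "\<exists>K. \<forall>a (b::'a). norm (a *\<^sub>C b) \<le> norm a * norm b * K"
    by (intro exI[of _ 1]) (simp add: norm_scaleC)
qed (auto simp: scaleC_add_left scaleC_add_right scaleR_scaleC scaleC_scaleC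
    scaleR_conv_of_real mult.commute)

declare cinner.zero_left [simp] cinner.zero_right [simp]

interpretation scaleC: bounded_bilinear "scaleC :: complex \<Rightarrow> 'a::complex_inner \<Rightarrow> 'a"
  by (rule bounded_bilinear_scaleC)

lemma norm_add_ortho:
  assumes "cinner x y = 0"
  shows "(norm (x + y))\<^sup>2 = (norm x)\<^sup>2 + (norm (y::'a::complex_inner))\<^sup>2"
proof -
  have "cinner y x = 0"
    using assms cinner_commute[of y x] by simp
  then have "complex_of_real ((norm (x + y))\<^sup>2) = complex_of_real ((norm x)\<^sup>2 + (norm y)\<^sup>2)"
    using assms by (simp add: cinner_self[symmetric] cinner.add_left cinner.add_right del: of_real_power)
  then show ?thesis
    by (simp only: of_real_eq_iff)
qed

text \<open>Zero vectors are allowed in the family; this lets the sine system start at index \<open>0\<close>,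
  and finite orthonormal systems are families that vanish from some index on.\<close>

locale orthonormal_system =
  fixes e :: "nat \<Rightarrow> 'a::complex_inner"
  assumes ortho: "m \<noteq> n \<Longrightarrow> cinner (e m) (e n) = 0"
    and unit: "e n \<noteq> 0 \<Longrightarrow> norm (e n) = 1"
begin

abbreviation coef :: "'a \<Rightarrow> nat \<Rightarrow> complex" where
  "coef u n \<equiv> cinner u (e n)"

lemma coef_basis: "coef (e m) n = (if m = n \<and> e n \<noteq> 0 then 1 else 0)"
  using ortho[of m n] unit[of n] by (auto simp: cinner_self)

lemma coef_partial_sum:
  assumes "finite S" "\<And>i. e i = 0 \<Longrightarrow> a i = 0"
  shows "coef (\<Sum>i\<in>S. a i *\<^sub>C e i) n = (if n \<in> S then a n else 0)"
proof -
  have "coef (\<Sum>i\<in>S. a i *\<^sub>C e i) n = (\<Sum>i\<in>S. if i = n then a n else 0)"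
    using assms(2) by (auto simp: cinner.sum_left cinner_scaleC_left coef_basis intro!: sum.cong)
  then show ?thesis
    using assms(1) by simp
qed

lemma norm_partial_sum:
  assumes "finite S" "\<And>i. e i = 0 \<Longrightarrow> a i = 0"
  shows "(norm (\<Sum>i\<in>S. a i *\<^sub>C e i))\<^sup>2 = (\<Sum>i\<in>S. (norm (a i))\<^sup>2)"
  using assms(1)
proof (induction S rule: finite_induct)
  case (insert j S)
  have "cinner (a j *\<^sub>C e j) (\<Sum>i\<in>S. a i *\<^sub>C e i) = 0"
  proof -
    have "cinner (e j) (e i) = 0" if "i \<in> S" for i
      using insert(2) that by (intro ortho) auto
    then show ?thesis
      by (simp add: cinner.sum_right cinner_scaleC_left cinner_scaleC_right)
  qed
  moreover have "norm (a j *\<^sub>C e j) = norm (a j)"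
    using assms(2)[of j] unit[of j] by (cases "e j = 0") (auto simp: norm_scaleC)
  ultimately show ?case
    using insert by (simp add: norm_add_ortho)
qed simp

text \<open>Pythagoras for the projection onto the vectors indexed by S. The equality is needed
  later, where a bound on the residual has to give a lower bound on the coefficients.\<close>

lemma bessel_eq:
  assumes "finite S"
  shows "(norm (u - (\<Sum>i\<in>S. coef u i *\<^sub>C e i)))\<^sup>2 + (\<Sum>i\<in>S. (norm (coef u i))\<^sup>2) = (norm u)\<^sup>2"
proof -
  define v where "v = (\<Sum>i\<in>S. coef u i *\<^sub>C e i)"
  have c: "coef v n = (if n \<in> S then coef u n else 0)" for n
    unfolding v_def using assms by (rule coef_partial_sum) simp
  have "cinner (u - v) v = (\<Sum>i\<in>S. cnj (coef u i) * cinner (u - v) (e i))"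
    by (subst (2) v_def) (simp add: cinner.sum_right cinner_scaleC_right)
  also have "\<dots> = 0"
    by (auto simp: cinner.diff_left c intro!: sum.neutral)
  finally have "(norm ((u - v) + v))\<^sup>2 = (norm (u - v))\<^sup>2 + (norm v)\<^sup>2"
    by (rule norm_add_ortho)
  then show ?thesis
    using norm_partial_sum[OF assms, of "coef u"] by (simp add: v_def)
qed

lemma bessel: "finite S \<Longrightarrow> (\<Sum>i\<in>S. (norm (coef u i))\<^sup>2) \<le> (norm u)\<^sup>2"
  using bessel_eq[of S u] by (metis le_add_same_cancel2 zero_le_power2)

lemma summable_coef: "summable (\<lambda>n. (norm (coef u n))\<^sup>2)"
  by (rule summableI_nonneg_bounded[where x = "(norm u)\<^sup>2"]) (auto intro: bessel)

end

text \<open>Totality is phrased as a trivial orthogonal complement, the form in which vanishing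
  trigonometric integrals deliver it; density of finite combinations then follows from
  completeness.\<close>

locale cbasis = orthonormal_system e for e :: "nat \<Rightarrow> 'a::{complex_inner, banach}" +
  assumes total: "(\<And>n. cinner u (e n) = 0) \<Longrightarrow> u = 0"
begin

lemma coef_ext: "(\<And>n. coef u n = coef v n) \<Longrightarrow> u = v"
  using total[of "u - v"] by (simp add: cinner.diff_left)

text \<open>Squared norms of blocks of the series are blocks of the summable series of squares, so
  the partial sums are Cauchy. A zero vector cannot carry a coefficient, which is why
  \<open>z\<close> is imposed.\<close>

lemma riesz_fischer:
  assumes s: "summable (\<lambda>n. (norm (a n))\<^sup>2)" and z: "\<And>i. e i = 0 \<Longrightarrow> a i = 0"
  shows "\<exists>u. (\<lambda>n. a n *\<^sub>C e n) sums u \<and> (\<forall>n. coef u n = a n)"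
proof -
  have "summable (\<lambda>n. a n *\<^sub>C e n)"
    unfolding summable_Cauchy
  proof (intro allI impI)
    fix r :: real assume "r > 0"
    then obtain N where N: "norm (\<Sum>i\<in>{m..<n}. (norm (a i))\<^sup>2) < r\<^sup>2" if "m \<ge> N" for m n
      using s unfolding summable_Cauchy by (metis zero_less_power)
    have "norm (\<Sum>i\<in>{m..<n}. a i *\<^sub>C e i) < r" if "m \<ge> N" for m n
      using N[OF that, of n] norm_partial_sum[of "{m..<n}" a] z \<open>r > 0\<close>
      by (auto simp: power2_less_imp_less intro: power2_less_imp_less)
    then show "\<exists>N. \<forall>m\<ge>N. \<forall>n. norm (\<Sum>i\<in>{m..<n}. a i *\<^sub>C e i) < r"
      by blast
  qed
  then obtain u where u: "(\<lambda>n. a n *\<^sub>C e n) sums u"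
    by (auto simp: summable_def)
  have "coef u n = a n" for n
  proof -
    have "(\<lambda>i. coef (a i *\<^sub>C e i) n) sums coef u n"
      using bounded_linear.sums[OF cinner.bounded_linear_left u] .
    moreover have "(\<lambda>i. coef (a i *\<^sub>C e i) n) = (\<lambda>i. if i = n then a i else 0)"
      using z by (auto simp: cinner_scaleC_left coef_basis)
    ultimately show ?thesis
      using sums_single[of n a] sums_unique2 by fastforce
  qed
  with u show ?thesis by blast
qed

text \<open>Riesz-Fischer produces a vector with the coefficients of u, and totality identifies it
  with u.\<close>

lemma expansion: "(\<lambda>n. coef u n *\<^sub>C e n) sums u"
proof -
  obtain v where v: "(\<lambda>n. coef u n *\<^sub>C e n) sums v" "\<forall>n. coef v n = coef u n"
    using riesz_fischer[OF summable_coef[of u]] by (metis cinner.zero_right)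
  then have "v = u" by (intro coef_ext) simp
  with v show ?thesis by simp
qed

lemma parseval: "(\<lambda>n. coef u n * cnj (coef v n)) sums cinner u v"
proof -
  have "(\<lambda>n. cinner (coef u n *\<^sub>C e n) v) sums cinner u v"
    using bounded_linear.sums[OF cinner.bounded_linear_left expansion] .
  then show ?thesis
    by (simp add: cinner_scaleC_left) (metis (no_types, lifting) cinner_commute sums_cong)
qed

lemma parseval_norm: "(\<lambda>n. (norm (coef u n))\<^sup>2) sums (norm u)\<^sup>2"
  using bounded_linear.sums[OF bounded_linear_Re parseval[of u u]]
  by (simp add: cinner_self complex_norm_square[symmetric] del: of_real_power)

lemma norm_le_coef:
  assumes "\<And>n. norm (coef u n) \<le> C * norm (coef v n)" "C \<ge> 0"
  shows "norm u \<le> C * norm v"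
proof -
  have "(norm u)\<^sup>2 \<le> C\<^sup>2 * (norm v)\<^sup>2"
    by (rule sums_le[OF _ parseval_norm sums_mult[OF parseval_norm]])
      (metis assms(1) power_mult_distrib power_mono norm_ge_zero)
  then show ?thesis
    using assms(2) by (simp add: power_mult_distrib[symmetric] power2_le_iff_abs_le abs_mult)
qed

section \<open>Diagonal operators on their maximal domains\<close>

definition mdom :: "(nat \<Rightarrow> complex) \<Rightarrow> 'a set" where
  "mdom \<mu> = {u. summable (\<lambda>n. (norm (\<mu> n * coef u n))\<^sup>2)}"

text \<open>The value is described by its coefficients, which determine a vector by
  \<open>coef_ext\<close>. Outside \<open>mdom\<close> no such vector exists and the value is
  arbitrary.\<close>

definition mop :: "(nat \<Rightarrow> complex) \<Rightarrow> 'a \<Rightarrow> 'a" where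
  "mop \<mu> u = (THE w. \<forall>n. coef w n = \<mu> n * coef u n)"

lemma mdomI: "(\<And>n. coef w n = \<mu> n * coef u n) \<Longrightarrow> u \<in> mdom \<mu>"
  using summable_coef[of w] by (simp add: mdom_def)

lemma mop_eqI: "(\<And>n. coef w n = \<mu> n * coef u n) \<Longrightarrow> mop \<mu> u = w"
  unfolding mop_def by (rule the_equality) (auto intro: coef_ext)

lemma mop_coef: "u \<in> mdom \<mu> \<Longrightarrow> coef (mop \<mu> u) n = \<mu> n * coef u n"
proof -
  assume "u \<in> mdom \<mu>"
  then obtain w where w: "\<And>n. coef w n = \<mu> n * coef u n"
    using riesz_fischer[of "\<lambda>n. \<mu> n * coef u n"] by (auto simp: mdom_def)
  then show ?thesis
    using mop_eqI[of w \<mu> u] by simp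
qed

text \<open>Comparison with a vector already at hand, such as \<open>u + A u\<close> or
  \<open>f - B u\<close>, is the standard way to show membership in a domain.\<close>

lemma mdomI_le:
  assumes "\<And>n. norm (\<mu> n * coef u n) \<le> C * norm (coef w n)"
  shows "u \<in> mdom \<mu>"
  unfolding mdom_def mem_Collect_eq
proof (rule summable_comparison_test')
  show "summable (\<lambda>n. C\<^sup>2 * (norm (coef w n))\<^sup>2)"
    by (intro summable_mult summable_coef)
  show "norm ((norm (\<mu> n * coef u n))\<^sup>2) \<le> C\<^sup>2 * (norm (coef w n))\<^sup>2" if "n \<ge> 0" for n
    using power_mono[OF assms[of n] norm_ge_zero, of 2] by (simp add: power_mult_distrib)
qed

lemma csubspace_mdom: "csubspace (mdom \<mu>)"
  unfolding csubspace_def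
proof (intro conjI ballI allI)
  show "0 \<in> mdom \<mu>"
    by (rule mdomI[of 0]) simp
  fix x y c assume x: "x \<in> mdom \<mu>"
  show "c *\<^sub>C x \<in> mdom \<mu>"
    by (rule mdomI[of "c *\<^sub>C mop \<mu> x"]) (simp add: cinner_scaleC_left mop_coef x)
  assume y: "y \<in> mdom \<mu>"
  show "x + y \<in> mdom \<mu>"
    by (rule mdomI[of "mop \<mu> x + mop \<mu> y"])
      (simp add: cinner_add_left mop_coef x y distrib_left)
qed

lemma mdom_add: "x \<in> mdom \<mu> \<Longrightarrow> y \<in> mdom \<mu> \<Longrightarrow> x + y \<in> mdom \<mu>"
  and mdom_scaleC: "x \<in> mdom \<mu> \<Longrightarrow> c *\<^sub>C x \<in> mdom \<mu>"
  using csubspace_mdom by (auto simp: csubspace_def)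

lemma mdom_diff: "x \<in> mdom \<mu> \<Longrightarrow> y \<in> mdom \<mu> \<Longrightarrow> x - y \<in> mdom \<mu>"
  using mdom_add[of x \<mu> "(-1) *\<^sub>C y"] mdom_scaleC[of y \<mu> "-1"]
  by (simp add: scaleC_minus_left)

lemma mop_add: "x \<in> mdom \<mu> \<Longrightarrow> y \<in> mdom \<mu> \<Longrightarrow> mop \<mu> (x + y) = mop \<mu> x + mop \<mu> y"
  by (rule mop_eqI) (simp add: cinner_add_left mop_coef distrib_left)

lemma mop_scaleC: "x \<in> mdom \<mu> \<Longrightarrow> mop \<mu> (c *\<^sub>C x) = c *\<^sub>C mop \<mu> x"
  by (rule mop_eqI) (simp add: cinner_scaleC_left mop_coef)

lemma mop_diff: "x \<in> mdom \<mu> \<Longrightarrow> y \<in> mdom \<mu> \<Longrightarrow> mop \<mu> (x - y) = mop \<mu> x - mop \<mu> y"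
  by (rule mop_eqI) (simp add: cinner.diff_left mop_coef right_diff_distrib)

lemma basis_mdom: "e n \<in> mdom \<mu>"
  by (rule mdomI[of "\<mu> n *\<^sub>C e n"]) (auto simp: cinner_scaleC_left coef_basis)

lemma mop_basis: "mop \<mu> (e n) = \<mu> n *\<^sub>C e n"
  by (rule mop_eqI) (auto simp: cinner_scaleC_left coef_basis)

lemma mop_bounded:
  assumes "\<And>n. norm (\<mu> n) \<le> c" "c \<ge> 0"
  shows "x \<in> mdom \<mu>" "norm (mop \<mu> x) \<le> c * norm x"
proof -
  have le: "norm (\<mu> n * coef x n) \<le> c * norm (coef x n)" for n
    using assms by (simp add: norm_mult mult_right_mono)
  then show x: "x \<in> mdom \<mu>"
    by (rule mdomI_le)
  show "norm (mop \<mu> x) \<le> c * norm x"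
    by (rule norm_le_coef) (use le mop_coef[OF x] assms(2) in auto)
qed

lemma closure_mdom: "closure (mdom \<mu>) = UNIV"
proof -
  have "u \<in> closure (mdom \<mu>)" for u
    unfolding closure_sequential
  proof (intro exI conjI allI)
    show "(\<lambda>N. \<Sum>n<N. coef u n *\<^sub>C e n) \<longlonglongrightarrow> u"
      using expansion by (simp add: sums_def)
    show "(\<Sum>n<N. coef u n *\<^sub>C e n) \<in> mdom \<mu>" for N
      by (induction N) (auto intro: mdom_add mdom_scaleC basis_mdom simp: csubspace_mdom[unfolded csubspace_def])
  qed
  then show ?thesis by blast
qed

end

section \<open>Bounded perturbations of multiplication operators\<close>

text \<open>The a priori bound works twice: it forces injectivity, and read for the inverse it
  bounds the resolvent with the same constant.\<close>

lemma resolvent_setI: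
  fixes T :: "'a::complex_inner \<Rightarrow> 'a"
  assumes lin: "clinear_on D T"
    and surj: "\<And>f. \<exists>u\<in>D. T u - z *\<^sub>C u = f"
    and bound: "\<And>u. u \<in> D \<Longrightarrow> norm u \<le> C * norm (T u - z *\<^sub>C u)"
  shows "z \<in> resolvent_set D T" and "norm (resolvent D T z f) \<le> C * norm f"
proof -
  define S where "S u = T u - z *\<^sub>C u" for u
  have D: "x + y \<in> D" "c *\<^sub>C x \<in> D" if "x \<in> D" "y \<in> D" for x y c
    using lin that by (auto simp: clinear_on_def csubspace_def)
  have S_add: "S (x + y) = S x + S y" if "x \<in> D" "y \<in> D" for x y
    using lin that by (auto simp: clinear_on_def S_def scaleC_add_right)
  have S_scale: "S (c *\<^sub>C x) = c *\<^sub>C S x" if "x \<in> D" for x c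
    using lin that by (auto simp: clinear_on_def S_def scaleC_diff_right
        scaleC_scaleC mult.commute)
  have inj: "inj_on S D"
  proof
    fix x y assume xy: "x \<in> D" "y \<in> D" "S x = S y"
    have "S (x + (-1) *\<^sub>C y) = 0"
      using xy S_add[of x "(-1) *\<^sub>C y"] S_scale[of y "-1"] D(2)[of y y "-1"]
      by (simp add: scaleC_minus_left)
    moreover have "x + (-1) *\<^sub>C y \<in> D"
      using xy by (simp add: D)
    ultimately have "norm (x + (-1) *\<^sub>C y) \<le> 0"
      using bound[of "x + (-1) *\<^sub>C y"] by (simp add: S_def)
    then show "x = y"
      by (simp add: scaleC_minus_left)
  qed
  have surj': "S ` D = UNIV"
  proof -
    have "f \<in> S ` D" for f
      using surj[of f] by (auto simp: S_def)
    then show ?thesis by blast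
  qed
  have R: "resolvent D T z f \<in> D" "S (resolvent D T z f) = f" for f
    using surj' inv_into_into[of f S D] f_inv_into_f[of f S D]
    by (auto simp: resolvent_def S_def[abs_def])
  have eq: "resolvent D T z f = u" if "u \<in> D" "S u = f" for u f
    using inj R that by (metis inj_onD)
  show nb: "norm (resolvent D T z f) \<le> C * norm f" for f
    using bound[OF R(1)[of f]] R(2)[of f] by (simp add: S_def)
  have "bounded_linear (resolvent D T z)"
  proof (rule bounded_linear_intro)
    show "resolvent D T z (x + y) = resolvent D T z x + resolvent D T z y" for x y
      by (rule eq) (simp_all add: R D S_add)
    show "resolvent D T z (r *\<^sub>R x) = r *\<^sub>R resolvent D T z x" for r x
      by (rule eq) (simp_all add: R D(2)[OF R(1) R(1)] S_scale scaleR_scaleC)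
    show "norm (resolvent D T z x) \<le> norm x * C" for x
      using nb[of x] by (simp add: mult.commute)
  qed
  then show "z \<in> resolvent_set D T"
    using inj surj' by (simp add: resolvent_set_def bij_betw_def S_def[abs_def])
qed

lemma resolvent_works:
  assumes "z \<in> resolvent_set D T"
  shows "resolvent D T z f \<in> D" "T (resolvent D T z f) - z *\<^sub>C resolvent D T z f = f"
  using assms inv_into_into[of f "\<lambda>u. T u - z *\<^sub>C u" D] f_inv_into_f[of f "\<lambda>u. T u - z *\<^sub>C u" D]
  by (auto simp: resolvent_set_def resolvent_def bij_betw_def)

lemma eigenvalues_subset_spectrum:
  assumes "0 \<in> D" "T 0 = 0"
  shows "eigenvalues D T \<subseteq> spectrum D T"
proof
  fix z assume "z \<in> eigenvalues D T"
  then obtain u where u: "u \<in> D" "u \<noteq> 0" "T u = z *\<^sub>C u"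
    by (auto simp: eigenvalues_def)
  then have "\<not> inj_on (\<lambda>u. T u - z *\<^sub>C u) D"
    using assms inj_onD[of "\<lambda>u. T u - z *\<^sub>C u" D u 0] by auto
  then show "z \<in> spectrum D T"
    by (auto simp: spectrum_def resolvent_set_def bij_betw_def)
qed

text \<open>Moving the vertex to \<open>- 2 * b\<close> leaves a real part of at least b, which
  dominates the imaginary part; hence the semi-angle pi / 4.\<close>

lemma in_sector_quarter_pi:
  assumes "- b \<le> Re z" "\<bar>Im z\<bar> \<le> b" "b > 0"
  shows "z \<in> sector (- 2 * b) (pi / 4)"
proof -
  define w where "w = z - complex_of_real (- 2 * b)"
  have w: "0 < Re w" "\<bar>Im w\<bar> \<le> Re w"
    using assms by (auto simp: w_def)
  then have "Arg w = arctan (Im w / Re w)"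
    by (intro arg_conv_arctan)
  moreover have "\<bar>Im w / Re w\<bar> \<le> 1"
    using w by (simp add: abs_divide)
  then have "arctan (- 1) \<le> arctan (Im w / Re w)" "arctan (Im w / Re w) \<le> arctan 1"
    by (auto simp only: arctan_le_iff abs_le_iff)
  ultimately have "\<bar>Arg w\<bar> \<le> pi / 4"
    by (simp add: arctan_minus arctan_one)
  then show ?thesis
    by (simp add: sector_def w_def)
qed

lemma sector_subsetI:
  assumes "\<And>u. u \<in> D \<Longrightarrow> norm u = 1 \<Longrightarrow> - b \<le> Re (q u) \<and> \<bar>Im (q u)\<bar> \<le> b" "b > 0"
  shows "\<exists>\<gamma> \<theta>. 0 \<le> \<theta> \<and> \<theta> < pi / 2 \<and> {q u | u. u \<in> D \<and> norm u = 1} \<subseteq> sector \<gamma> \<theta>"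
  using assms in_sector_quarter_pi pi_gt_zero
  by (intro exI[of _ "- 2 * b"] exI[of _ "pi / 4"]) auto

text \<open>The parameter \<open>\<kappa>\<close> is the diagonal of the square root:
  \<open>K\<close> carries the form, and its squared entries give the operator
  \<open>A\<close>.\<close>

locale perturbed_multiplication = cbasis e for e :: "nat \<Rightarrow> 'a::{complex_inner, banach}" +
  fixes \<kappa> :: "nat \<Rightarrow> real" and B :: "'a \<Rightarrow> 'a" and b :: real
  assumes \<kappa>_nonneg: "\<kappa> n \<ge> 0"
    and \<kappa>_lim: "filterlim \<kappa> at_top sequentially"
    and B_add: "B (u + v) = B u + B v"
    and B_scaleC: "B (c *\<^sub>C u) = c *\<^sub>C B u"
    and B_bound: "norm (B u) \<le> b * norm u"
    and b_pos: "b > 0"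
begin

abbreviation "K \<equiv> mop (\<lambda>n. complex_of_real (\<kappa> n))"
abbreviation "Q \<equiv> mdom (\<lambda>n. complex_of_real (\<kappa> n))"
abbreviation "A \<equiv> mop (\<lambda>n. (complex_of_real (\<kappa> n))\<^sup>2)"
abbreviation "D \<equiv> mdom (\<lambda>n. (complex_of_real (\<kappa> n))\<^sup>2)"

definition "T u = A u + B u"
definition "t u v = cinner (K u) (K v) + cinner (B u) v"

lemma B_diff: "B (u - v) = B u - B v"
  using B_add[of "u - v" v] by (simp add: algebra_simps)

text \<open>Since \<kappa> is at most 1 + \<kappa>^2, the coefficients of \<open>u + A u\<close>
  dominate those of \<open>K u\<close>.\<close>

lemma D_subset_Q: "D \<subseteq> Q"
proof
  fix u assume u: "u \<in> D"
  have "norm (complex_of_real (\<kappa> n) * coef u n) \<le> 1 * norm (coef (u + A u) n)" for n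
  proof -
    have "coef (u + A u) n = complex_of_real (1 + (\<kappa> n)\<^sup>2) * coef u n"
      using u by (simp add: cinner_add_left mop_coef distrib_right)
    moreover have "\<kappa> n \<le> 1 + (\<kappa> n)\<^sup>2"
      using sum_power2_ge_zero[of "\<kappa> n - 1" 0] \<kappa>_nonneg[of n] by (simp add: power2_diff)
    ultimately show ?thesis
      using \<kappa>_nonneg[of n] by (simp add: norm_mult mult_right_mono del: of_real_add of_real_power)
  qed
  then show "u \<in> Q" by (rule mdomI_le)
qed

lemma cinner_A: "u \<in> D \<Longrightarrow> v \<in> Q \<Longrightarrow> cinner (A u) v = cinner (K u) (K v)"
  using D_subset_Q parseval[of "A u" v] parseval[of "K u" "K v"]
  by (auto simp: mop_coef power2_eq_square mult_ac subset_iff intro: sums_unique2)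

lemma clinear_T: "clinear_on D T"
  by (simp add: clinear_on_def csubspace_mdom T_def mop_add mop_scaleC B_add B_scaleC scaleC_add_right)

lemma T_coef: "u \<in> D \<Longrightarrow> coef (T u) n = (complex_of_real (\<kappa> n))\<^sup>2 * coef u n + coef (B u) n"
  by (simp add: T_def cinner_add_left mop_coef)

lemma B_form: "norm (cinner (B u) u) \<le> b * (norm u)\<^sup>2"
  using norm_cinner_le[of "B u" u] mult_right_mono[OF B_bound[of u] norm_ge_zero[of u]]
  by (simp add: power2_eq_square)

lemma t_self: "Re (t u u) = (norm (K u))\<^sup>2 + Re (cinner (B u) u)" "Im (t u u) = Im (cinner (B u) u)"
  by (simp_all add: t_def cinner_self)

lemma t_bounds: "(norm (K u))\<^sup>2 - b * (norm u)\<^sup>2 \<le> Re (t u u)" "\<bar>Im (t u u)\<bar> \<le> b * (norm u)\<^sup>2"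
  using abs_Re_le_cmod[of "cinner (B u) u"] abs_Im_le_cmod[of "cinner (B u) u"] B_form[of u]
  by (auto simp: t_self)

lemma T_eq_t: "u \<in> D \<Longrightarrow> v \<in> Q \<Longrightarrow> cinner (T u) v = t u v"
  by (simp only: T_def t_def cinner_add_left cinner_A)

lemma sectorial_T: "sectorial_operator D T"
  unfolding sectorial_operator_def
proof (intro conjI clinear_T sector_subsetI[where b = b] b_pos)
  fix u assume u: "u \<in> D" "norm u = 1"
  then have eq: "cinner (T u) u = t u u"
    using D_subset_Q by (intro T_eq_t) auto
  have "b * (norm u)\<^sup>2 = b"
    using u by simp
  then show "- b \<le> Re (cinner (T u) u)" "\<bar>Im (cinner (T u) u)\<bar> \<le> b"
    unfolding eq using t_bounds[of u] zero_le_power2[of "norm (K u)"] by linarith+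
qed

lemma sectorial_t: "sectorial_form Q t"
  unfolding sectorial_form_def sesquilinear_on_def
proof (intro conjI csubspace_mdom sector_subsetI[where b = b] b_pos)
  show "\<forall>u\<in>Q. \<forall>v\<in>Q. \<forall>w\<in>Q. t (u + v) w = t u w + t v w \<and> t w (u + v) = t w u + t w v"
    by (auto simp: t_def mop_add B_add cinner_add_left cinner_add_right)
  show "\<forall>c. \<forall>u\<in>Q. \<forall>v\<in>Q. t (c *\<^sub>C u) v = c * t u v \<and> t u (c *\<^sub>C v) = cnj c * t u v"
    by (auto simp: t_def mop_scaleC B_scaleC cinner_scaleC_left cinner_scaleC_right distrib_left)
  fix u assume "u \<in> Q" "norm u = 1"
  then have "b * (norm u)\<^sup>2 = b"
    by simp
  then show "- b \<le> Re (t u u)" "\<bar>Im (t u u)\<bar> \<le> b"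
    using t_bounds[of u] zero_le_power2[of "norm (K u)"] by linarith+
qed

text \<open>\<open>B\<close> is bounded, so smallness in the form together with convergence in norm
  makes \<open>K (u m - u n)\<close> small. Letting n tend to infinity in finite sums of
  coefficients passes this bound to \<open>u m - x\<close>, without knowing beforehand that
  \<open>K x\<close> makes sense.\<close>

lemma closed_t: "closed_form Q t"
  unfolding closed_form_def
proof (intro allI impI)
  fix u x
  assume uQ: "\<forall>n. u n \<in> Q" and ux: "u \<longlonglongrightarrow> x"
    and cau: "\<forall>r>0. \<exists>N. \<forall>m\<ge>N. \<forall>n\<ge>N. norm (t (u m - u n) (u m - u n)) < r"
  have tail: "\<exists>N. \<forall>m\<ge>N. u m - x \<in> Q \<and> (norm (K (u m - x)))\<^sup>2 \<le> r" if "r > 0" for r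
  proof -
    obtain N1 where N1: "norm (t (u m - u n) (u m - u n)) < r / 2" if "m \<ge> N1" "n \<ge> N1" for m n
      using cau \<open>r > 0\<close> by (meson half_gt_zero)
    have "Cauchy u" using ux by (rule LIMSEQ_imp_Cauchy)
    \<comment> \<open>The budget r is halved: r / 2 for the form, and through this threshold r / 2
      for \<open>b\<close> times the squared norm.\<close>
    then obtain N2 where N2: "norm (u m - u n) < sqrt (r / (2 * b))" if "m \<ge> N2" "n \<ge> N2" for m n
      using b_pos \<open>r > 0\<close> unfolding Cauchy_def dist_norm
      by (metis divide_pos_pos mult_pos_pos real_sqrt_gt_zero zero_less_numeral)
    have small: "(norm (K (u m - u n)))\<^sup>2 \<le> r" if "m \<ge> max N1 N2" "n \<ge> max N1 N2" for m n
    proof -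
      have "(norm (u m - u n))\<^sup>2 \<le> (sqrt (r / (2 * b)))\<^sup>2"
        using N2[of m n] that by (intro power_mono) auto
      then have "b * (norm (u m - u n))\<^sup>2 \<le> r / 2"
        using b_pos \<open>r > 0\<close> by (simp add: field_simps)
      moreover have "Re (t (u m - u n) (u m - u n)) < r / 2"
        using N1[of m n] that complex_Re_le_cmod by (meson le_less_trans max.boundedE)
      ultimately show ?thesis
        using t_bounds(1)[of "u m - u n"] by linarith
    qed
    have part: "(\<Sum>i<M. (norm (complex_of_real (\<kappa> i) * coef (u m - x) i))\<^sup>2) \<le> r"
      if "m \<ge> max N1 N2" for m M
    proof (rule LIMSEQ_le_const2)
      show "(\<lambda>n. \<Sum>i<M. (norm (complex_of_real (\<kappa> i) * coef (u m - u n) i))\<^sup>2)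
          \<longlonglongrightarrow> (\<Sum>i<M. (norm (complex_of_real (\<kappa> i) * coef (u m - x) i))\<^sup>2)"
        by (intro tendsto_intros cinner.tendsto ux)
      have "(\<Sum>i<M. (norm (complex_of_real (\<kappa> i) * coef (u m - u n) i))\<^sup>2) \<le> r"
        if "n \<ge> max N1 N2" for n
        using small[OF \<open>m \<ge> max N1 N2\<close> that] bessel[of "{..<M}" "K (u m - u n)"] uQ
        by (simp add: mop_coef mdom_diff del: max.bounded_iff)
      then show "\<exists>N. \<forall>n\<ge>N. (\<Sum>i<M. (norm (complex_of_real (\<kappa> i) * coef (u m - u n) i))\<^sup>2) \<le> r"
        by blast
    qed
    have "u m - x \<in> Q \<and> (norm (K (u m - x)))\<^sup>2 \<le> r" if m: "m \<ge> max N1 N2" for m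
    proof
      show *: "u m - x \<in> Q"
        unfolding mdom_def mem_Collect_eq
        by (rule summableI_nonneg_bounded[where x = r]) (auto intro: part[OF m])
      have "(\<lambda>M. \<Sum>i<M. (norm (coef (K (u m - x)) i))\<^sup>2) \<longlonglongrightarrow> (norm (K (u m - x)))\<^sup>2"
        using parseval_norm[of "K (u m - x)"] by (simp only: sums_def)
      then show "(norm (K (u m - x)))\<^sup>2 \<le> r"
        by (rule LIMSEQ_le_const2) (use part[OF m] mop_coef[OF *] in auto)
    qed
    then show ?thesis by blast
  qed
  have "x \<in> Q"
  proof -
    obtain m where "u m - x \<in> Q"
      using tail[of 1] by auto
    then have "u m - (u m - x) \<in> Q"
      using uQ by (blast intro: mdom_diff)
    then show ?thesis by simp
  qed
  moreover have "(\<lambda>n. t (u n - x) (u n - x)) \<longlonglongrightarrow> 0"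
  proof (rule Lim_null_comparison)
    have K0: "(\<lambda>n. (norm (K (u n - x)))\<^sup>2) \<longlonglongrightarrow> 0"
    proof (rule LIMSEQ_I)
      fix r :: real assume "r > 0"
      then show "\<exists>N. \<forall>n\<ge>N. norm ((norm (K (u n - x)))\<^sup>2 - 0) < r"
        using tail[of "r / 2"] by fastforce
    qed
    have "(\<lambda>n. norm (u n - x)) \<longlonglongrightarrow> 0"
      using ux by (simp add: LIM_zero_iff tendsto_norm_zero)
    from tendsto_add[OF K0 tendsto_mult[OF tendsto_const[of b] tendsto_power[OF this, of 2]]]
    show "(\<lambda>n. (norm (K (u n - x)))\<^sup>2 + b * (norm (u n - x))\<^sup>2) \<longlonglongrightarrow> 0"
      by simp
    show "\<forall>\<^sub>F n in sequentially. norm (t (u n - x) (u n - x))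
        \<le> (norm (K (u n - x)))\<^sup>2 + b * (norm (u n - x))\<^sup>2"
    proof (rule always_eventually, rule allI)
      fix n
      have "norm (t (u n - x) (u n - x)) \<le> norm (cinner (K (u n - x)) (K (u n - x)))
          + norm (cinner (B (u n - x)) (u n - x))"
        unfolding t_def by (rule norm_triangle_ineq)
      then show "norm (t (u n - x) (u n - x)) \<le> (norm (K (u n - x)))\<^sup>2 + b * (norm (u n - x))\<^sup>2"
        using B_form[of "u n - x"] by (simp add: cinner_self norm_power)
    qed
  qed
  ultimately show "x \<in> Q \<and> (\<lambda>n. t (u n - x) (u n - x)) \<longlonglongrightarrow> 0"
    by blast
qed

text \<open>For the converse, testing with basis vectors is enough: the coefficients of
  \<open>w - B u\<close> turn out to be \<kappa>^2 times those of u, which is at once the domain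
  condition and the value of \<open>A u\<close>.\<close>

lemma associated_T: "associated_operator Q t D T"
  unfolding associated_operator_def
proof (intro conjI allI iffI closure_mdom)
  fix u w assume "u \<in> D \<and> T u = w"
  then show "u \<in> Q" "\<forall>v\<in>Q. t u v = cinner w v"
    using D_subset_Q T_eq_t by auto
next
  fix u w assume "u \<in> Q \<and> (\<forall>v\<in>Q. t u v = cinner w v)"
  then have uQ: "u \<in> Q" and eq: "t u (e n) = coef w n" for n
    by (auto simp: basis_mdom)
  have c: "coef (w - B u) n = (complex_of_real (\<kappa> n))\<^sup>2 * coef u n" for n
    using eq[of n, symmetric] uQ by (simp add: t_def mop_basis cinner_scaleC_right mop_coef
        power2_eq_square cinner.diff_left)
  show "u \<in> D"
    by (rule mdomI[OF c])
  show "T u = w"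
    by (simp add: T_def mop_eqI[OF c])
qed

lemma norm_mop_inverse_le:
  assumes "\<And>n. norm (\<delta> n) \<ge> d" "d > 0"
  shows "x \<in> mdom (\<lambda>n. 1 / \<delta> n)" "norm (mop (\<lambda>n. 1 / \<delta> n) x) \<le> norm x / d"
proof -
  have "norm (1 / \<delta> n) \<le> 1 / d" for n
    using assms(1)[of n] assms(2) by (simp add: norm_divide frac_le)
  from mop_bounded[OF this] show "x \<in> mdom (\<lambda>n. 1 / \<delta> n)" "norm (mop (\<lambda>n. 1 / \<delta> n) x) \<le> norm x / d"
    using assms(2) by auto
qed

text \<open>Written as \<open>u = (f - B u) / \<delta>\<close>, the equation is a fixed point
  problem with contraction factor b / d. The diagonal \<open>\<delta>\<close> is left general
  because the solver is applied to \<kappa>^2 - z and also to a modified diagonal.\<close>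

lemma solve:
  assumes \<delta>: "\<And>n. norm (\<delta> n) \<ge> d" and d: "d > b"
  shows "\<exists>u. \<forall>n. \<delta> n * coef u n + coef (B u) n = coef f n"
proof -
  have d0: "d > 0" using d b_pos by simp
  define \<Phi> where "\<Phi> u = mop (\<lambda>n. 1 / \<delta> n) (f - B u)" for u
  have dist: "dist (\<Phi> u) (\<Phi> v) \<le> (b / d) * dist u v" for u v
  proof -
    have "\<Phi> u - \<Phi> v = mop (\<lambda>n. 1 / \<delta> n) ((f - B u) - (f - B v))"
      unfolding \<Phi>_def by (intro mop_diff[symmetric] norm_mop_inverse_le[OF \<delta> d0])
    also have "(f - B u) - (f - B v) = - B (u - v)"
      by (simp add: B_diff)
    finally have "norm (\<Phi> u - \<Phi> v) \<le> norm (B (u - v)) / d"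
      using norm_mop_inverse_le(2)[of d \<delta> "- B (u - v)", OF \<delta> d0] by simp
    also have "\<dots> \<le> b * norm (u - v) / d"
      using d0 by (intro divide_right_mono B_bound) simp
    finally show ?thesis by (simp add: dist_norm)
  qed
  have "\<exists>!u. \<Phi> u = u"
    by (rule banach_fix_type[of "b / d"]) (use dist d d0 b_pos in auto)
  then obtain u where u: "\<Phi> u = u" by blast
  have "\<delta> n * coef u n + coef (B u) n = coef f n" for n
  proof -
    have "\<delta> n \<noteq> 0" using \<delta>[of n] d0 by auto
    have "coef u n = coef (f - B u) n / \<delta> n"
      using mop_coef[OF norm_mop_inverse_le(1)[of d \<delta> "f - B u", OF \<delta> d0], of n] u by (simp add: \<Phi>_def)
    then show ?thesis
      using \<open>\<delta> n \<noteq> 0\<close> by (simp add: cinner.diff_left)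
  qed
  then show ?thesis by blast
qed

text \<open>\<open>d * norm u\<close> is at most \<open>norm f + b * norm u\<close>, and the last
  term is absorbed because d > b.\<close>

lemma solve_bound:
  assumes \<delta>: "\<And>n. norm (\<delta> n) \<ge> d" and d: "d > b"
    and u: "\<And>n. \<delta> n * coef u n + coef (B u) n = coef f n"
  shows "norm u \<le> 1 / (d - b) * norm f"
proof -
  have d0: "d > 0" using d b_pos by simp
  have "norm (coef u n) \<le> (1 / d) * norm (coef (f - B u) n)" for n
  proof -
    have "norm (\<delta> n) * norm (coef u n) = norm (coef (f - B u) n)"
      using u[of n] by (simp add: cinner.diff_left flip: norm_mult) (metis add_diff_cancel_right')
    moreover have "d * norm (coef u n) \<le> norm (\<delta> n) * norm (coef u n)"
      by (rule mult_right_mono[OF \<delta>]) simp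
    ultimately show ?thesis
      using d0 by (simp add: field_simps)
  qed
  then have "norm u \<le> (1 / d) * norm (f - B u)"
    using d0 by (intro norm_le_coef) auto
  also have "norm (f - B u) \<le> norm f + b * norm u"
    using norm_triangle_ineq4[of f "B u"] B_bound[of u] by linarith
  finally show ?thesis
    using d d0 by (simp add: field_simps)
qed

text \<open>Regularity: the equation makes \<open>\<delta> n * coef u n\<close> a coefficient of the
  vector \<open>f - B u\<close>, so a diagonal that grows like \<kappa>^2 puts u into the
  domain.\<close>

lemma solution_in_D:
  assumes "\<And>n. \<delta> n * coef u n + coef (B u) n = coef f n"
    and "\<And>n. (\<kappa> n)\<^sup>2 \<le> C * norm (\<delta> n)"
  shows "u \<in> D"
proof (rule mdomI_le[of _ _ C "f - B u"])
  fix n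
  have "coef (f - B u) n = \<delta> n * coef u n"
    using assms(1)[of n] by (simp add: cinner.diff_left) (metis add_diff_cancel_right')
  then show "norm ((complex_of_real (\<kappa> n))\<^sup>2 * coef u n) \<le> C * norm (coef (f - B u) n)"
    using mult_right_mono[OF assms(2)[of n], of "norm (coef u n)"]
    by (simp add: norm_mult norm_power mult.assoc)
qed

lemma resolvent_eq_iff:
  assumes "u \<in> D"
  shows "T u - z *\<^sub>C u = f \<longleftrightarrow>
    (\<forall>n. ((complex_of_real (\<kappa> n))\<^sup>2 - z) * coef u n + coef (B u) n = coef f n)"
proof -
  have "T u - z *\<^sub>C u = f \<longleftrightarrow> (\<forall>n. coef (T u - z *\<^sub>C u) n = coef f n)"
    using coef_ext by blast
  then show ?thesis
    using assms by (simp add: cinner.diff_left cinner_scaleC_left T_coef algebra_simps)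
qed

lemma far_in_resolvent_set:
  assumes far: "\<And>n. norm ((complex_of_real (\<kappa> n))\<^sup>2 - z) \<ge> d" and d: "d > b"
  shows "z \<in> resolvent_set D T" "norm (resolvent D T z f) \<le> 1 / (d - b) * norm f"
proof -
  have d0: "d > 0" using d b_pos by simp
  \<comment> \<open>The diagonal keeps distance d from z, so \<open>norm z\<close> is at most
    \<open>norm z / d\<close> times that distance; this explains the constant.\<close>
  have C: "(\<kappa> n)\<^sup>2 \<le> (1 + norm z / d) * norm ((complex_of_real (\<kappa> n))\<^sup>2 - z)" for n
  proof -
    have "(\<kappa> n)\<^sup>2 = norm (((complex_of_real (\<kappa> n))\<^sup>2 - z) + z)"
      by (simp add: norm_power)
    also have "\<dots> \<le> norm ((complex_of_real (\<kappa> n))\<^sup>2 - z) + norm z"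
      by (rule norm_triangle_ineq)
    also have "norm z \<le> norm z / d * norm ((complex_of_real (\<kappa> n))\<^sup>2 - z)"
      using mult_left_mono[OF far[of n], of "norm z / d"] d0 by simp
    finally show ?thesis by (simp add: distrib_right)
  qed
  have surj: "\<exists>u\<in>D. T u - z *\<^sub>C u = f" for f
    using solve[of d "\<lambda>n. (complex_of_real (\<kappa> n))\<^sup>2 - z" f, OF far d] solution_in_D[OF _ C] resolvent_eq_iff by blast
  have bd: "norm u \<le> 1 / (d - b) * norm (T u - z *\<^sub>C u)" if "u \<in> D" for u
    by (rule solve_bound[OF far d]) (use resolvent_eq_iff[OF that, of z] in blast)
  show "z \<in> resolvent_set D T" "norm (resolvent D T z f) \<le> 1 / (d - b) * norm f"
    using resolvent_setI[OF clinear_T surj bd] by auto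
qed

text \<open>The diagonal is nonnegative, so its distance from z is at least - Re z.\<close>

lemma left_in_resolvent_set:
  assumes "Re z < - b"
  shows "z \<in> resolvent_set D T" "norm (resolvent D T z f) \<le> 1 / (- Re z - b) * norm f"
proof -
  have "norm ((complex_of_real (\<kappa> n))\<^sup>2 - z) \<ge> - Re z" for n
  proof -
    have "- Re z \<le> Re ((complex_of_real (\<kappa> n))\<^sup>2 - z)"
      by (simp flip: of_real_power)
    then show ?thesis
      using complex_Re_le_cmod order_trans by blast
  qed
  then show "z \<in> resolvent_set D T" "norm (resolvent D T z f) \<le> 1 / (- Re z - b) * norm f"
    using far_in_resolvent_set[of "- Re z" z] assms by auto
qed

text \<open>The shift by b compensates the lower bound - b of the form, and it turns the resolvent
  bound \<open>1 / (- Re z - b)\<close>, taken at the point - z - b, into the required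
  \<open>1 / Re z\<close>.\<close>

lemma quasi_m_accretive_T: "quasi_m_accretive D T"
  unfolding quasi_m_accretive_def m_accretive_def
proof (intro exI[of _ b] conjI ballI allI impI)
  show "clinear_on D (\<lambda>u. T u + b *\<^sub>R u)"
    using clinear_T by (auto simp: clinear_on_def scaleR_scaleC scaleC_add_right scaleC_scaleC mult.commute)
  show "0 \<le> Re (cinner (T u + b *\<^sub>R u) u)" if "u \<in> D" for u
  proof -
    have "u \<in> Q" using that D_subset_Q by auto
    then have "Re (cinner (T u + b *\<^sub>R u) u) = Re (t u u) + b * (norm u)\<^sup>2"
      using that by (simp add: cinner_add_left T_eq_t scaleR_scaleC cinner_scaleC_left cinner_self)
    then show ?thesis
      using t_bounds(1)[of u] zero_le_power2[of "norm (K u)"] by linarith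
  qed
  fix z :: complex assume z: "0 < Re z"
  have eq: "(\<lambda>u. (T u + b *\<^sub>R u) - (- z) *\<^sub>C u) = (\<lambda>u. T u - (- z - complex_of_real b) *\<^sub>C u)"
    by (simp add: scaleR_scaleC scaleC_diff_left scaleC_minus_left fun_eq_iff)
  have r: "resolvent D (\<lambda>u. T u + b *\<^sub>R u) (- z) = resolvent D T (- z - complex_of_real b)"
    unfolding resolvent_def eq ..
  have *: "- z - complex_of_real b \<in> resolvent_set D T"
    "norm (resolvent D T (- z - complex_of_real b) f) \<le> 1 / Re z * norm f" for f
    using left_in_resolvent_set[of "- z - complex_of_real b"] z by auto
  then show "- z \<in> resolvent_set D (\<lambda>u. T u + b *\<^sub>R u)"
    unfolding resolvent_set_def mem_Collect_eq eq r by blast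
  show "onorm (resolvent D (\<lambda>u. T u + b *\<^sub>R u) (- z)) \<le> 1 / Re z"
    unfolding r using * z by (intro onorm_bound) auto
qed

lemma m_sectorial_T: "m_sectorial D T"
  unfolding m_sectorial_def using sectorial_T quasi_m_accretive_T by blast

end

section \<open>Compactness and the spectrum\<close>

lemma finite_span_inj_imp_surj:
  fixes S :: "'a::real_vector \<Rightarrow> 'a"
  assumes "linear S" "finite E" "inj_on S (span E)" "S ` span E \<subseteq> span E"
  shows "S ` span E = span E"
proof -
  obtain F where F: "F \<subseteq> span E" "independent F" "span E \<subseteq> span F"
    using maximal_independent_subset by blast
  have FE: "span F = span E"
    using F by (meson span_minimal subspace_span subset_antisym)
  have "finite F"
    using independent_span_bound[OF assms(2) F(2)] F(1) by blast
  have ind: "independent (S ` F)"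
    using linear_independent_injective_image[OF assms(1) F(2)] assms(3) FE by simp
  have card: "card (S ` F) = card F"
    using assms(3) F(1) by (intro card_image) (rule inj_on_subset)
  have SF: "span (S ` F) = S ` span E"
    unfolding linear_span_image[OF assms(1)] FE ..
  \<comment> \<open>A missed vector y would extend the image of the basis F to an independent subset
    of \<open>span F\<close> with more elements than F.\<close>
  have "y \<in> span (S ` F)" if y: "y \<in> span E" for y
  proof (rule ccontr)
    assume n: "y \<notin> span (S ` F)"
    then have yn: "y \<notin> S ` F"
      using span_superset[of "S ` F"] by blast
    have "independent (insert y (S ` F))"
      using ind n by (rule independent_insertI[rotated])
    moreover have "insert y (S ` F) \<subseteq> span F"
      using y assms(4) F(1) FE by auto
    ultimately have "card (insert y (S ` F)) \<le> card F"
      using independent_span_bound[OF \<open>finite F\<close>] by blast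
    then show False
      using yn \<open>finite F\<close> card by simp
  qed
  then show ?thesis
    using SF assms(4) by auto
qed

text \<open>The span is invariant and S is onto there. As \<open>f - S f\<close> lies in the span,
  it equals \<open>S y\<close> for some y, and then \<open>f + y\<close> is mapped to f.\<close>

lemma finite_rank_perturbation_surj:
  fixes S :: "'a::real_vector \<Rightarrow> 'a"
  assumes "linear S" "finite E" "\<And>x. x - S x \<in> span E" "\<And>x. S x = 0 \<Longrightarrow> x = 0"
  shows "surj S"
proof -
  have inj: "inj S"
    using assms(1,4) linear_injective_0 by blast
  have "S x \<in> span E" if "x \<in> span E" for x
    using span_diff[OF that assms(3)[of x]] by simp
  then have "S ` span E \<subseteq> span E"
    by blast
  then have eq: "S ` span E = span E"
    using assms inj by (intro finite_span_inj_imp_surj) (auto intro: inj_on_subset)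
  have "\<exists>x. S x = f" for f
  proof -
    obtain y where "S y = f - S f"
      using assms(3)[of f] eq by (metis imageE)
    then have "S (f + y) = f"
      using linear_add[OF assms(1)] by simp
    then show ?thesis ..
  qed
  then show ?thesis
    by (metis surj_def)
qed

section \<open>Flags spanned by an orthonormal system\<close>

context orthonormal_system
begin

text \<open>Complex span of the first k vectors, written as the fixed points of the orthogonal
  projection so that membership exposes the coefficients.\<close>

definition initial :: "nat \<Rightarrow> 'a set" where
  "initial k = {v. v = (\<Sum>j<k. coef v j *\<^sub>C e j)}"

lemma csubspace_initial: "csubspace (initial k)"
  unfolding csubspace_def
proof (intro conjI ballI allI)
  show "0 \<in> initial k"
    by (simp add: initial_def)
  fix u v c assume u: "u \<in> initial k"
  have "c *\<^sub>C (\<Sum>j<k. coef u j *\<^sub>C e j) = (\<Sum>j<k. coef (c *\<^sub>C u) j *\<^sub>C e j)"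
    by (simp add: scaleC_sum_right cinner_scaleC_left scaleC_scaleC)
  then show "c *\<^sub>C u \<in> initial k"
    using u by (simp add: initial_def)
  assume v: "v \<in> initial k"
  have "(\<Sum>j<k. coef (u + v) j *\<^sub>C e j) = (\<Sum>j<k. coef u j *\<^sub>C e j) + (\<Sum>j<k. coef v j *\<^sub>C e j)"
    by (simp add: cinner_add_left scaleC_add_left sum.distrib)
  then show "u + v \<in> initial k"
    using u v by (simp add: initial_def)
qed

lemma partial_sum_initial:
  assumes "\<And>i. e i = 0 \<Longrightarrow> a i = 0"
  shows "(\<Sum>j<k. a j *\<^sub>C e j) \<in> initial k"
  unfolding initial_def mem_Collect_eq
  by (intro sum.cong refl) (simp add: coef_partial_sum assms)

lemma initial_coef: "v \<in> initial k \<Longrightarrow> k \<le> n \<Longrightarrow> coef v n = 0"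
proof -
  assume v: "v \<in> initial k" and "k \<le> n"
  have "coef v n = coef (\<Sum>j<k. coef v j *\<^sub>C e j) n"
    using v by (simp add: initial_def)
  also have "\<dots> = 0"
    using \<open>k \<le> n\<close> by (subst coef_partial_sum) auto
  finally show ?thesis .
qed

lemma initial_mono:
  assumes "v \<in> initial k" "k \<le> m"
  shows "v \<in> initial m"
proof -
  have "(\<Sum>j<m. coef v j *\<^sub>C e j) = (\<Sum>j<k. coef v j *\<^sub>C e j)"
    using assms by (intro sum.mono_neutral_right) (auto simp: initial_coef)
  then show ?thesis
    using assms(1) by (simp add: initial_def)
qed

lemma basis_initial: "i < k \<Longrightarrow> e i \<in> initial k"
proof -
  assume "i < k"
  have "(\<Sum>j<k. coef (e i) j *\<^sub>C e j) = (\<Sum>j<k. if j = i then e i else 0)"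
    by (intro sum.cong refl) (auto simp: coef_basis)
  with \<open>i < k\<close> show ?thesis
    by (simp add: initial_def)
qed

lemma initial_Suc_drop: "v \<in> initial (Suc k) \<Longrightarrow> coef v k = 0 \<Longrightarrow> v \<in> initial k"
  by (simp add: initial_def)

end

lemma clinear_on_sum:
  assumes "clinear_on D T" "\<And>j. j < (k::nat) \<Longrightarrow> q j \<in> D"
  shows "(\<Sum>j<k. a j *\<^sub>C q j) \<in> D" "T (\<Sum>j<k. a j *\<^sub>C q j) = (\<Sum>j<k. a j *\<^sub>C T (q j))"
proof -
  have "(\<Sum>j<k. a j *\<^sub>C q j) \<in> D \<and> T (\<Sum>j<k. a j *\<^sub>C q j) = (\<Sum>j<k. a j *\<^sub>C T (q j))"
    using assms(2)
  proof (induction k)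
    case 0
    have "T (0 *\<^sub>C 0) = 0 *\<^sub>C T 0"
      using assms(1) unfolding clinear_on_def csubspace_def by blast
    then show ?case
      using assms(1) by (simp add: clinear_on_def csubspace_def)
  next
    case (Suc k)
    define v where "v = (\<Sum>j<k. a j *\<^sub>C q j)"
    have v: "v \<in> D" "T v = (\<Sum>j<k. a j *\<^sub>C T (q j))"
      using Suc unfolding v_def by auto
    have "q k \<in> D"
      using Suc.prems by simp
    then have "v + a k *\<^sub>C q k \<in> D" "T (v + a k *\<^sub>C q k) = T v + a k *\<^sub>C T (q k)"
      using assms(1) v(1) unfolding clinear_on_def csubspace_def by metis+
    then show ?case
      using v(2) by (simp add: v_def)
  qed
  then show "(\<Sum>j<k. a j *\<^sub>C q j) \<in> D" "T (\<Sum>j<k. a j *\<^sub>C q j) = (\<Sum>j<k. a j *\<^sub>C T (q j))"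
    by blast+
qed

lemma csubspace_sum:
  "csubspace Y \<Longrightarrow> (\<And>j. j \<in> J \<Longrightarrow> f j \<in> Y) \<Longrightarrow> (\<Sum>j\<in>J. f j) \<in> Y"
  unfolding csubspace_def by (induction J rule: infinite_finite_induct) simp_all

text \<open>Gram--Schmidt applied to eigenvectors with distinct eigenvalues brings \<open>T\<close> into upper triangular
  form with the eigenvalues on the diagonal.\<close>

lemma schur_flag:
  assumes lin: "clinear_on D T" and "finite Z" "Z \<subseteq> eigenvalues D T"
  shows "\<exists>q \<zeta>. orthonormal_system q \<and> \<zeta> ` {..<card Z} = Z \<and> (\<forall>i\<ge>card Z. q i = 0) \<and>
    (\<forall>i<card Z. q i \<in> D \<and> norm (q i) = 1 \<and>
       T (q i) - \<zeta> i *\<^sub>C q i \<in> orthonormal_system.initial q i)"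
  using assms(2,3)
proof (induction Z rule: finite_induct)
  case empty
  have "orthonormal_system (\<lambda>_. 0::'a)"
    by unfold_locales auto
  then show ?case
    by (intro exI[of _ "\<lambda>_. 0"]) auto
next
  case (insert z Z)
  define m where "m = card Z"
  have "Z \<subseteq> eigenvalues D T"
    using insert.prems by simp
  from insert.IH[OF this, folded m_def] obtain q \<zeta>
    where *: "orthonormal_system q \<and> \<zeta> ` {..<m} = Z \<and> (\<forall>i\<ge>m. q i = 0) \<and>
      (\<forall>i<m. q i \<in> D \<and> norm (q i) = 1 \<and>
        T (q i) - \<zeta> i *\<^sub>C q i \<in> orthonormal_system.initial q i)"
    by (elim exE)
  from * have q: "orthonormal_system q" and \<zeta>: "\<zeta> ` {..<m} = Z" and q0: "\<And>i. i \<ge> m \<Longrightarrow> q i = 0"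
    and qD: "\<And>i. i < m \<Longrightarrow> q i \<in> D" and q1: "\<And>i. i < m \<Longrightarrow> norm (q i) = 1"
    and flag: "\<And>i. i < m \<Longrightarrow> T (q i) - \<zeta> i *\<^sub>C q i \<in> orthonormal_system.initial q i"
    by simp_all
  interpret q: orthonormal_system q by (rule q)
  have sub: "csubspace (q.initial k)" for k
    by (rule q.csubspace_initial)
  have sub_add: "u + v \<in> q.initial k" and sub_scale: "c *\<^sub>C u \<in> q.initial k"
    if "u \<in> q.initial k" "v \<in> q.initial k" for u v c k
    using sub[of k] that by (auto simp: csubspace_def)
  obtain x where x: "x \<in> D" "x \<noteq> 0" "T x = z *\<^sub>C x"
    using insert.prems by (auto simp: eigenvalues_def)
  have T_add: "T (u + v) = T u + T v" and T_scale: "T (c *\<^sub>C u) = c *\<^sub>C T u"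
    and D_add: "u + v \<in> D" and D_scale: "c *\<^sub>C u \<in> D" if "u \<in> D" "v \<in> D" for u v c
    using lin that by (auto simp: clinear_on_def csubspace_def)
  have sub_diff: "u - v \<in> q.initial k" if "u \<in> q.initial k" "v \<in> q.initial k" for u v k
    using sub_add[OF that(1) sub_scale[OF that(2,2)], of "-1"] by (simp add: scaleC_minus_left)
  have Tq: "T (q j) \<in> q.initial (Suc j)" if "j < m" for j
  proof -
    have "(T (q j) - \<zeta> j *\<^sub>C q j) + \<zeta> j *\<^sub>C q j \<in> q.initial (Suc j)"
      using q.initial_mono[OF flag[OF that], of "Suc j"] q.basis_initial[of j "Suc j"]
      by (intro sub_add sub_scale) auto
    then show ?thesis by simp
  qed
  have Tqc: "cinner (T (q k)) (q k) = \<zeta> k" if "k < m" for k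
  proof -
    have "cinner (T (q k) - \<zeta> k *\<^sub>C q k) (q k) = 0"
      by (rule q.initial_coef[OF flag[OF that]]) simp
    then show ?thesis
      using q1[OF that] by (simp add: cinner.diff_left cinner_scaleC_left cinner_self)
  qed
  \<comment> \<open>On the flag space T is triangular with diagonal \<zeta>. Since z differs from
    every \<zeta>, comparing the top coefficients of T x and z x makes the top coefficient of x
    vanish; descending through the flag would leave x = 0.\<close>
  have notin: "x \<notin> q.initial m"
  proof
    assume "x \<in> q.initial m"
    have "x \<in> q.initial (m - i)" if "i \<le> m" for i
      using that
    proof (induction i)
      case 0
      then show ?case using \<open>x \<in> q.initial m\<close> by simp
    next
      case (Suc i)
      define k where "k = m - Suc i"
      have k: "m - i = Suc k" "k < m" using Suc.prems by (auto simp: k_def)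
      then have xk: "x \<in> q.initial (Suc k)" using Suc by simp
      then have "x = (\<Sum>j<Suc k. cinner x (q j) *\<^sub>C q j)"
        by (simp only: q.initial_def mem_Collect_eq)
      then have "T x = (\<Sum>j<Suc k. cinner x (q j) *\<^sub>C T (q j))"
        using clinear_on_sum(2)[OF lin, of "Suc k" q "\<lambda>j. cinner x (q j)"] k qD by simp
      then have "cinner (T x) (q k) = (\<Sum>j<Suc k. cinner x (q j) * cinner (T (q j)) (q k))"
        by (simp only: cinner.sum_left cinner_scaleC_left)
      also have "\<dots> = cinner x (q k) * \<zeta> k"
      proof -
        have "cinner (T (q j)) (q k) = 0" if "j < k" for j
          using that k by (intro q.initial_coef[OF Tq]) auto
        then show ?thesis
          using Tqc[OF k(2)] by simp
      qed
      finally have "(z - \<zeta> k) * cinner x (q k) = 0"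
        by (simp add: x(3) cinner_scaleC_left algebra_simps)
      moreover have "\<zeta> k \<noteq> z"
        using \<zeta> insert.hyps(2) k(2) by auto
      ultimately show ?case
        using q.initial_Suc_drop[OF xk] k by (simp add: k_def)
    qed
    from this[of m] show False
      using x(2) by (simp add: q.initial_def)
  qed
  define p where "p = (\<Sum>j<m. cinner x (q j) *\<^sub>C q j)"
  define y where "y = x + (-1) *\<^sub>C p"
  have pD: "p \<in> D"
    unfolding p_def by (rule clinear_on_sum(1)[OF lin]) (rule qD)
  have pI: "p \<in> q.initial m"
    unfolding p_def by (rule q.partial_sum_initial) simp
  have TpI: "T p \<in> q.initial m"
  proof -
    have Tp: "T p = (\<Sum>j<m. cinner x (q j) *\<^sub>C T (q j))"
      unfolding p_def by (rule clinear_on_sum(2)[OF lin]) (rule qD)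
    show ?thesis
      unfolding Tp
    proof (rule csubspace_sum[OF sub])
      fix j assume "j \<in> {..<m}"
      then have "T (q j) \<in> q.initial m"
        using Tq[of j] q.initial_mono by (metis Suc_leI lessThan_iff)
      then show "cinner x (q j) *\<^sub>C T (q j) \<in> q.initial m"
        by (intro sub_scale)
    qed
  qed
  have yD: "y \<in> D"
    unfolding y_def using x(1) pD D_add D_scale by blast
  have y0: "y \<noteq> 0"
    using notin pI by (auto simp: y_def scaleC_minus_left)
  have yq: "cinner y (q j) = 0" if "j < m" for j
    using that unfolding y_def p_def
    by (simp add: cinner_add_left cinner_scaleC_left q.coef_partial_sum)
  \<comment> \<open>x is an exact eigenvector and both p and T p lie in the flag space, so y is an
    eigenvector modulo that space.\<close>
  have Ty: "T y - z *\<^sub>C y \<in> q.initial m"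
  proof -
    have "T y - z *\<^sub>C y = z *\<^sub>C p - T p"
      unfolding y_def T_add[OF x(1) D_scale[OF pD pD]] T_scale[OF pD pD] x(3)
      by (simp add: scaleC_diff_right scaleC_minus_left scaleC_minus_right)
    then show ?thesis
      using sub_diff[OF sub_scale[OF pI pI] TpI] by simp
  qed
  define c where "c = complex_of_real (1 / norm y)"
  define q' where "q' = q(m := c *\<^sub>C y)"
  have c: "norm c * norm y = 1"
    using y0 by (simp add: c_def norm_divide)
  have q'_sys: "orthonormal_system q'"
  proof
    fix i j :: nat assume ij: "i \<noteq> j"
    have *: "cinner y (q k) = 0" for k
      using yq[of k] q0[of k] by (cases "k < m") auto
    moreover have "cinner (q k) y = 0" for k
      using * cinner_commute[of "q k" y] by simp
    ultimately show "cinner (q' i) (q' j) = 0"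
      using ij q.ortho by (auto simp: q'_def cinner_scaleC_left cinner_scaleC_right)
  next
    fix i assume "q' i \<noteq> 0"
    then show "norm (q' i) = 1"
      using q.unit[of i] c by (auto simp: q'_def norm_scaleC split: if_splits)
  qed
  interpret q': orthonormal_system q' by (rule q'_sys)
  have init: "q'.initial i = q.initial i" if "i \<le> m" for i
  proof -
    have "(\<Sum>j<i. cinner v (q' j) *\<^sub>C q' j) = (\<Sum>j<i. cinner v (q j) *\<^sub>C q j)" for v
      using that by (intro sum.cong) (auto simp: q'_def)
    then show ?thesis
      by (simp add: q.initial_def q'.initial_def)
  qed
  have card: "card (insert z Z) = Suc m"
    using insert.hyps by (simp add: m_def)
  show ?case
    unfolding card
  proof (intro exI conjI allI impI)
    show "orthonormal_system q'" by (rule q'_sys)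
    have "\<zeta> ` {..<m} = (\<zeta>(m := z)) ` {..<m}"
      by (intro image_cong) auto
    then show "(\<zeta>(m := z)) ` {..<Suc m} = insert z Z"
      by (simp add: lessThan_Suc \<zeta> del: fun_upd_apply) simp
    show "q' i = 0" if "Suc m \<le> i" for i
      using that q0 by (simp add: q'_def)
    fix i assume i: "i < Suc m"
    show "q' i \<in> D"
      using i qD yD D_scale by (auto simp: q'_def less_Suc_eq)
    show "norm (q' i) = 1"
      using i q1 c by (auto simp: q'_def less_Suc_eq norm_scaleC)
    show "T (q' i) - (\<zeta>(m := z)) i *\<^sub>C q' i \<in> q'.initial i"
    proof (cases "i = m")
      case True
      have "T (c *\<^sub>C y) - z *\<^sub>C c *\<^sub>C y = c *\<^sub>C (T y - z *\<^sub>C y)"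
        using T_scale[OF yD yD] by (simp add: scaleC_diff_right scaleC_scaleC mult.commute)
      then show ?thesis
        using True sub_scale[OF Ty Ty] init by (simp add: q'_def)
    next
      case False
      then show ?thesis
        using i flag[of i] init[of i] by (simp add: q'_def)
    qed
  qed
qed

text \<open>The compact set must not depend on c: it is a Minkowski sum of N images of the disc of
  radius C.\<close>

lemma compact_finite_combinations:
  fixes e :: "nat \<Rightarrow> 'a::complex_inner"
  shows "\<exists>S. compact S \<and> (\<forall>c. (\<forall>n. norm (c n) \<le> C) \<longrightarrow> (\<Sum>n<N. c n *\<^sub>C e n) \<in> S)"
proof (induction N)
  case 0
  show ?case
    by (intro exI[of _ "{0}"]) simp
next
  case (Suc N)
  then obtain S where S: "compact S" "\<And>c. (\<forall>n. norm (c n) \<le> C) \<Longrightarrow> (\<Sum>n<N. c n *\<^sub>C e n) \<in> S"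
    by blast
  let ?L = "(\<lambda>c. c *\<^sub>C e N) ` cball 0 C"
  have "compact ?L"
    by (intro compact_continuous_image compact_cball linear_continuous_on
        scaleC.bounded_linear_left)
  then have "compact {x + y | x y. x \<in> S \<and> y \<in> ?L}"
    using S(1) by (rule compact_sums[rotated])
  moreover have "(\<Sum>n<Suc N. c n *\<^sub>C e n) \<in> {x + y | x y. x \<in> S \<and> y \<in> ?L}"
    if "\<forall>n. norm (c n) \<le> C" for c
  proof -
    have "c N *\<^sub>C e N \<in> ?L"
      using that by auto
    then show ?thesis
      using S(2)[OF that] by auto
  qed
  ultimately show ?case by blast
qed

section \<open>Compact resolvent and the Fredholm alternative\<close>

context perturbed_multiplication
begin

lemma bounded_linear_B: "bounded_linear B"
  by (rule bounded_linear_intro[where K = b])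
    (simp_all add: B_add B_scaleC scaleR_scaleC B_bound mult.commute[of _ b])

lemma B_zero: "B 0 = 0"
  using B_bound[of 0] by simp

lemma \<kappa>_sq_large: "\<exists>N. \<forall>n\<ge>N. (\<kappa> n)\<^sup>2 \<ge> M"
proof -
  obtain N where N: "\<And>n. n \<ge> N \<Longrightarrow> \<kappa> n \<ge> max 1 M"
    using \<kappa>_lim unfolding filterlim_at_top eventually_sequentially by blast
  have "(\<kappa> n)\<^sup>2 \<ge> M" if "n \<ge> N" for n
  proof -
    have "\<kappa> n * 1 \<le> \<kappa> n * \<kappa> n"
      using N[OF that] by (intro mult_left_mono) auto
    then show ?thesis
      using N[OF that] unfolding power2_eq_square by linarith
  qed
  then show ?thesis by blast
qed

text \<open>Far out, the coefficients of u are a small multiple of those of \<open>A u\<close>,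
  because the \<kappa>^2 tend to infinity. Up to a uniformly small tail, the set thus lies in a
  compact set of finite combinations.\<close>

lemma compact_closure_graph_bounded:
  assumes "\<And>u. u \<in> S \<Longrightarrow> u \<in> D \<and> norm u \<le> C \<and> norm (A u) \<le> C"
  shows "compact (closure S)"
  unfolding compact_eq_totally_bounded
proof (intro conjI allI impI)
  show "complete (closure S)"
    by (simp add: complete_eq_closed)
  fix r :: real assume r: "r > 0"
  \<comment> \<open>A strictly positive bound, as it appears in denominators.\<close>
  define C' where "C' = \<bar>C\<bar> + 1"
  have C': "C' > 0" "C \<le> C'" by (auto simp: C'_def)
  obtain N where N: "\<And>n. n \<ge> N \<Longrightarrow> (\<kappa> n)\<^sup>2 \<ge> 3 * C' / r"
    using \<kappa>_sq_large by blast
  obtain P where P: "compact P" "\<And>c. (\<forall>n. norm (c n) \<le> C') \<Longrightarrow> (\<Sum>n<N. c n *\<^sub>C e n) \<in> P"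
    using compact_finite_combinations[where C = C' and N = N and e = e] by blast
  obtain F where F: "finite F" "P \<subseteq> (\<Union>x\<in>F. ball x (r / 3))"
    using P(1) r unfolding compact_eq_totally_bounded by (meson divide_pos_pos zero_less_numeral)
  \<comment> \<open>Net error r / 3 plus tail error r / 3. Closed balls let the inclusion pass to
    the closure, and 2r / 3 < r leaves room for open balls.\<close>
  have "S \<subseteq> (\<Union>x\<in>F. cball x (2 * r / 3))"
  proof
    fix u assume "u \<in> S"
    then have u: "u \<in> D" "norm u \<le> C'" "norm (A u) \<le> C'"
      using assms C'(2) by (auto intro: order_trans)
    define p where "p = (\<Sum>n<N. coef u n *\<^sub>C e n)"
    have "norm (coef u n) \<le> C'" for n
    proof -
      have "(norm (coef u n))\<^sup>2 \<le> (norm u)\<^sup>2"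
        using bessel[of "{n}" u] by simp
      then show ?thesis
        using u(2) by (meson abs_le_square_iff abs_norm_cancel order_trans power2_le_imp_le norm_ge_zero)
    qed
    then have "p \<in> P"
      unfolding p_def by (intro P(2)) auto
    then obtain x where x: "x \<in> F" "dist x p < r / 3"
      using F(2) by auto
    have "norm (u - p) \<le> (r / (3 * C')) * norm (A u)"
    proof (rule norm_le_coef)
      fix n
      have pn: "coef p n = (if n < N then coef u n else 0)"
        unfolding p_def by (simp add: coef_partial_sum)
      show "norm (coef (u - p) n) \<le> (r / (3 * C')) * norm (coef (A u) n)"
      proof (cases "n < N")
        case True
        then show ?thesis using r C' by (simp add: cinner.diff_left pn)
      next
        case False
        then have "1 \<le> (r / (3 * C')) * (\<kappa> n)\<^sup>2"
          using N[of n] r C' by (simp add: field_simps)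
        from mult_right_mono[OF this norm_ge_zero[of "coef u n"]] False show ?thesis
          by (simp add: cinner.diff_left pn mop_coef[OF u(1)] norm_mult norm_power mult.assoc)
      qed
    qed (use r C' in simp)
    also have "\<dots> \<le> (r / (3 * C')) * C'"
      using r C' u(3) by (intro mult_left_mono) auto
    finally have "norm (u - p) \<le> r / 3"
      using C' by simp
    then have "dist x u \<le> 2 * r / 3"
      using x(2) dist_triangle[of x u p] by (simp add: dist_norm norm_minus_commute)
    then show "u \<in> (\<Union>x\<in>F. cball x (2 * r / 3))"
      using x(1) by auto
  qed
  then have "closure S \<subseteq> (\<Union>x\<in>F. cball x (2 * r / 3))"
    using F(1) by (intro closure_minimal) auto
  also have "\<dots> \<subseteq> (\<Union>x\<in>F. ball x r)"
    using r by (auto intro!: UN_mono)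
  finally show "\<exists>F. finite F \<and> closure S \<subseteq> (\<Union>x\<in>F. ball x r)"
    using F(1) by blast
qed

text \<open>Provides the graph bound that compactness asks for, both for resolvents and for
  approximate eigenvectors.\<close>

lemma A_bound:
  assumes "norm u \<le> C" "norm (T u - z *\<^sub>C u) \<le> C'"
  shows "norm (A u) \<le> C' + (norm z + b) * C"
proof -
  have "A u = (T u - z *\<^sub>C u) + (z *\<^sub>C u - B u)"
    by (simp add: T_def)
  then have "norm (A u) \<le> norm (T u - z *\<^sub>C u) + (norm (z *\<^sub>C u) + norm (B u))"
    by (metis norm_triangle_ineq norm_triangle_ineq4 add_left_mono order_trans)
  moreover have "norm (z *\<^sub>C u) + norm (B u) \<le> (norm z + b) * norm u"
    using B_bound[of u] by (simp add: norm_scaleC distrib_right)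
  moreover have "(norm z + b) * norm u \<le> (norm z + b) * C"
    using assms(1) b_pos by (intro mult_left_mono) auto
  ultimately show ?thesis
    using assms(2) by linarith
qed

lemma compact_resolvent_T: "has_compact_resolvent D T"
  unfolding has_compact_resolvent_def compact_operator_def
proof (intro conjI ballI allI impI)
  have "complex_of_real (- b - 1) \<in> resolvent_set D T"
    by (intro left_in_resolvent_set) simp
  then show "resolvent_set D T \<noteq> {}" by blast
  fix z assume z: "z \<in> resolvent_set D T"
  then show bl: "bounded_linear (resolvent D T z)"
    by (simp add: resolvent_set_def)
  fix S :: "'a set" assume "bounded S"
  then obtain M where M: "\<And>f. f \<in> S \<Longrightarrow> norm f \<le> M"
    by (auto simp: bounded_iff)
  define L where "L = onorm (resolvent D T z) * M"
  show "compact (closure (resolvent D T z ` S))"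
  proof (rule compact_closure_graph_bounded[where C = "max L (M + (norm z + b) * L)"])
    fix u assume "u \<in> resolvent D T z ` S"
    then obtain f where f: "f \<in> S" "u = resolvent D T z f" by blast
    have 1: "u \<in> D" "T u - z *\<^sub>C u = f"
      unfolding f(2) using resolvent_works[OF z] by auto
    have 2: "norm u \<le> L"
      using onorm[OF bl, of f] mult_left_mono[OF M[OF f(1)] onorm_pos_le[OF bl]]
      unfolding f(2) L_def by linarith
    have "norm (A u) \<le> M + (norm z + b) * L"
      using 2 M[OF f(1)] 1(2) by (intro A_bound) auto
    then show "u \<in> D \<and> norm u \<le> max L (M + (norm z + b) * L)
        \<and> norm (A u) \<le> max L (M + (norm z + b) * L)"
      using 1 2 by auto
  qed
qed

text \<open>If no such bound holds, there are unit vectors with residuals tending to 0. They are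
  bounded in the graph norm, so a subsequence converges, and its limit is an eigenvector of norm
  1.\<close>

lemma bounded_below:
  assumes "z \<notin> eigenvalues D T"
  shows "\<exists>C. \<forall>u\<in>D. norm u \<le> C * norm (T u - z *\<^sub>C u)"
proof (rule ccontr)
  assume "\<not> ?thesis"
  then have "\<forall>n. \<exists>u\<in>D. norm u > real (Suc n) * norm (T u - z *\<^sub>C u)"
    by (meson not_le)
  then obtain u where u: "\<And>n. u n \<in> D" "\<And>n. norm (u n) > real (Suc n) * norm (T (u n) - z *\<^sub>C u n)"
    by metis
  have u0: "norm (u n) > 0" for n
    using u(2)[of n] by (rule le_less_trans[rotated]) simp
  define v where "v n = complex_of_real (1 / norm (u n)) *\<^sub>C u n" for n
  have vD: "v n \<in> D" for n
    unfolding v_def by (intro mdom_scaleC u)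
  have v1: "norm (v n) = 1" for n
    using u0[of n] by (simp add: v_def norm_scaleC norm_divide)
  have "T (v n) - z *\<^sub>C v n = complex_of_real (1 / norm (u n)) *\<^sub>C (T (u n) - z *\<^sub>C u n)" for n
    using clinear_T u(1) by (simp add: clinear_on_def v_def scaleC_diff_right scaleC_scaleC mult.commute)
  then have "norm (T (v n) - z *\<^sub>C v n) = norm (T (u n) - z *\<^sub>C u n) / norm (u n)" for n
    by (simp add: norm_scaleC norm_divide)
  then have w: "norm (T (v n) - z *\<^sub>C v n) \<le> inverse (real (Suc n))" for n
    using u(2)[of n] u0[of n] by (simp add: field_simps)
  have "norm (A (v n)) \<le> 1 + (norm z + b) * 1" for n
    using v1[of n] w[of n] by (intro A_bound) (auto simp: inverse_eq_divide elim!: order_trans)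
  then have "compact (closure (range v))"
    using vD v1 b_pos by (intro compact_closure_graph_bounded[where C = "1 + (norm z + b) * 1"]) auto
  then have "seq_compact (closure (range v))"
    by (rule compact_imp_seq_compact)
  moreover have "\<forall>n. v n \<in> closure (range v)"
    by (intro allI subsetD[OF closure_subset] rangeI)
  ultimately obtain l r where l: "strict_mono (r :: nat \<Rightarrow> nat)" "(v \<circ> r) \<longlonglongrightarrow> l"
    by (rule seq_compactE)
  have "(\<lambda>n. norm ((v \<circ> r) n)) \<longlonglongrightarrow> norm l"
    using l(2) by (rule tendsto_norm)
  then have "norm l = 1"
    by (simp add: v1 LIMSEQ_const_iff)
  \<comment> \<open>The limit is taken coefficient by coefficient because \<open>A\<close> need not
    be continuous; the resulting identity also shows that l belongs to the domain.\<close>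
  have c: "coef (z *\<^sub>C l - B l) i = (complex_of_real (\<kappa> i))\<^sup>2 * coef l i" for i
  proof -
    have "(\<lambda>n. T (v n) - z *\<^sub>C v n) \<longlonglongrightarrow> 0"
      by (rule Lim_null_comparison[OF _ LIMSEQ_inverse_real_of_nat]) (simp add: w del: of_nat_Suc)
    then have "(\<lambda>n. T ((v \<circ> r) n) - z *\<^sub>C (v \<circ> r) n) \<longlonglongrightarrow> 0"
      using LIMSEQ_subseq_LIMSEQ[OF _ l(1)] by (force simp: o_def)
    then have "(\<lambda>n. coef (T ((v \<circ> r) n) - z *\<^sub>C (v \<circ> r) n) i) \<longlonglongrightarrow> coef 0 i"
      by (intro cinner.tendsto tendsto_const)
    moreover have "coef (T ((v \<circ> r) n) - z *\<^sub>C (v \<circ> r) n) i = (complex_of_real (\<kappa> i))\<^sup>2 * coef ((v \<circ> r) n) i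
        + coef (B ((v \<circ> r) n)) i - z * coef ((v \<circ> r) n) i" for n
      using vD by (simp add: cinner.diff_left T_coef cinner_scaleC_left)
    moreover have "(\<lambda>n. (complex_of_real (\<kappa> i))\<^sup>2 * coef ((v \<circ> r) n) i
        + coef (B ((v \<circ> r) n)) i - z * coef ((v \<circ> r) n) i) \<longlonglongrightarrow>
        (complex_of_real (\<kappa> i))\<^sup>2 * coef l i + coef (B l) i - z * coef l i"
      by (intro tendsto_intros cinner.tendsto l(2) bounded_linear.tendsto[OF bounded_linear_B])
    ultimately have "(complex_of_real (\<kappa> i))\<^sup>2 * coef l i + coef (B l) i - z * coef l i = 0"
      using LIMSEQ_unique by fastforce
    then show ?thesis
      by (simp add: cinner.diff_left cinner_scaleC_left algebra_simps)
  qed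
  have "l \<in> D" by (rule mdomI[OF c])
  moreover have "T l = z *\<^sub>C l"
    by (simp add: T_def mop_eqI[OF c])
  ultimately have "z \<in> eigenvalues D T"
    using \<open>norm l = 1\<close> unfolding eigenvalues_def by force
  with assms show False ..
qed

text \<open>Adding a large \<open>M\<close> to the first \<open>N\<close> diagonal entries makes the operator invertible; removing it again
  is a perturbation of finite rank, for which injectivity implies surjectivity.\<close>

lemma surj_if_not_eigenvalue:
  assumes z: "z \<notin> eigenvalues D T"
  shows "\<exists>u\<in>D. T u - z *\<^sub>C u = f"
proof -
  define d where "d = b + 1"
  have d: "d > b" "d > 0" using b_pos by (auto simp: d_def)
  obtain N where N: "\<And>n. n \<ge> N \<Longrightarrow> (\<kappa> n)\<^sup>2 \<ge> d + norm z"
    using \<kappa>_sq_large by blast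
  \<comment> \<open>Large enough to lift the real part of each of the first N entries to at least d,
    whatever the position of z; the later entries satisfy this by the choice of N.\<close>
  define M where "M = d + norm z"
  define \<delta> where "\<delta> n = (complex_of_real (\<kappa> n))\<^sup>2 - z + (if n < N then complex_of_real M else 0)" for n
  have Re: "Re (\<delta> n) \<ge> d \<and> norm (\<delta> n) \<ge> (\<kappa> n)\<^sup>2 - norm z" for n
  proof -
    have "Re (\<delta> n) \<ge> (\<kappa> n)\<^sup>2 - norm z + (if n < N then M else 0)"
      using complex_Re_le_cmod[of z] by (simp add: \<delta>_def flip: of_real_power)
    moreover have "(\<kappa> n)\<^sup>2 - norm z + (if n < N then M else 0) \<ge> d"
      using N[of n] by (auto simp: M_def)
    moreover have "M \<ge> 0"
      using d by (simp add: M_def)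
    ultimately show ?thesis
      using complex_Re_le_cmod[of "\<delta> n"] by (auto split: if_splits)
  qed
  have \<delta>: "norm (\<delta> n) \<ge> d" for n
    using Re[of n] complex_Re_le_cmod[of "\<delta> n"] by linarith
  have C: "(\<kappa> n)\<^sup>2 \<le> (1 + norm z / d) * norm (\<delta> n)" for n
  proof -
    have "norm z \<le> norm z / d * norm (\<delta> n)"
      using mult_left_mono[OF \<delta>[of n], of "norm z / d"] d by simp
    then show ?thesis
      using Re[of n] by (simp add: distrib_right)
  qed
  \<comment> \<open>The inverse of the modified operator; single-valued by
    \<open>solve_bound\<close>, which is what makes it linear.\<close>
  define G where "G f = (SOME u. \<forall>n. \<delta> n * coef u n + coef (B u) n = coef f n)" for f
  have G: "\<delta> n * coef (G f) n + coef (B (G f)) n = coef f n" for f n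
    using someI_ex[OF solve[of d \<delta> f, OF \<delta> d(1)]] unfolding G_def by blast
  have GD: "G f \<in> D" for f
    by (rule solution_in_D[OF G C])
  have G_eq: "G f = u" if "\<And>n. \<delta> n * coef u n + coef (B u) n = coef f n" for f u
  proof -
    have "\<delta> n * coef (G f - u) n + coef (B (G f - u)) n = coef 0 n" for n
      using that[of n] G[of n f] by (simp add: B_diff cinner.diff_left algebra_simps)
    from solve_bound[OF \<delta> d(1) this] show ?thesis by simp
  qed
  \<comment> \<open>Undoing the shift costs exactly this term, with range spanned by N basis
    vectors. Solving for T thus amounts to inverting the identity minus F.\<close>
  define F where "F f = (\<Sum>n<N. (complex_of_real M * coef (G f) n) *\<^sub>C e n)" for f
  have TG: "T (G f) - z *\<^sub>C G f = f - F f" for f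
  proof (rule coef_ext)
    fix n
    have "coef (F f) n = (if n < N then complex_of_real M * coef (G f) n else 0)"
      unfolding F_def by (subst coef_partial_sum) auto
    then show "coef (T (G f) - z *\<^sub>C G f) n = coef (f - F f) n"
      using G[of n f] by (simp add: cinner.diff_left T_coef[OF GD] cinner_scaleC_left \<delta>_def algebra_simps
          split: if_splits)
  qed
  have G_add: "G (x + y) = G x + G y" for x y
  proof (rule G_eq)
    fix n
    show "\<delta> n * coef (G x + G y) n + coef (B (G x + G y)) n = coef (x + y) n"
      by (simp add: B_add cinner_add_left distrib_left G[of n x, symmetric] G[of n y, symmetric])
  qed
  have G_scale: "G (c *\<^sub>C x) = c *\<^sub>C G x" for c x
  proof (rule G_eq)
    fix n
    show "\<delta> n * coef (c *\<^sub>C G x) n + coef (B (c *\<^sub>C G x)) n = coef (c *\<^sub>C x) n"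
      by (simp add: B_scaleC cinner_scaleC_left distrib_left G[of n x, symmetric])
  qed
  have "surj (\<lambda>f. f - F f)"
  \<comment> \<open>\<open>span\<close> is the real span, so each basis vector is accompanied by its
    multiple by the imaginary unit.\<close>
  proof (rule finite_rank_perturbation_surj[where E = "e ` {..<N} \<union> (\<lambda>n. \<i> *\<^sub>C e n) ` {..<N}"])
    have "F (x + y) = F x + F y" for x y
      by (simp add: F_def G_add cinner_add_left distrib_left scaleC_add_left sum.distrib)
    moreover have "F (r *\<^sub>R x) = r *\<^sub>R F x" for x r
      by (simp add: F_def G_scale scaleR_scaleC cinner_scaleC_left scaleC_sum_right scaleC_scaleC mult_ac)
    ultimately show "linear (\<lambda>f. f - F f)"
      by (intro linearI) (auto simp: algebra_simps scaleR_diff_right)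
    show "finite (e ` {..<N} \<union> (\<lambda>n. \<i> *\<^sub>C e n) ` {..<N})"
      by simp
    fix x
    have "c *\<^sub>C e n \<in> span (e ` {..<N} \<union> (\<lambda>n. \<i> *\<^sub>C e n) ` {..<N})" if "n < N" for c n
    proof -
      have "c *\<^sub>C e n = Re c *\<^sub>R e n + Im c *\<^sub>R (\<i> *\<^sub>C e n)"
        by (subst complex_eq[of c]) (simp add: scaleR_scaleC scaleC_scaleC scaleC_add_left mult.commute)
      also have "\<dots> \<in> span (e ` {..<N} \<union> (\<lambda>n. \<i> *\<^sub>C e n) ` {..<N})"
        by (intro span_add span_scale span_base) (use that in auto)
      finally show ?thesis .
    qed
    then show "x - (x - F x) \<in> span (e ` {..<N} \<union> (\<lambda>n. \<i> *\<^sub>C e n) ` {..<N})"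
      by (auto simp: F_def intro!: span_sum)
    \<comment> \<open>A kernel vector x would make \<open>G x\<close> an eigenvector for z, unless
      \<open>G x\<close> is 0.\<close>
    assume "x - F x = 0"
    then have "T (G x) = z *\<^sub>C G x"
      using TG[of x] by simp
    then have "G x = 0"
      using z GD[of x] by (auto simp: eigenvalues_def)
    then show "x = 0"
      using G[of _ x] B_zero by (intro total) simp
  qed
  then obtain y where "f = y - F y"
    by (meson surjD)
  then show ?thesis
    using TG[of y] GD[of y] by auto
qed

lemma spectrum_eq_eigenvalues: "spectrum D T = eigenvalues D T"
proof
  have "T 0 = 0"
    using B_zero mop_scaleC[OF basis_mdom, of _ 0]
    by (simp add: T_def)
  then show "eigenvalues D T \<subseteq> spectrum D T"
    using csubspace_mdom by (intro eigenvalues_subset_spectrum) (auto simp: csubspace_def)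
  show "spectrum D T \<subseteq> eigenvalues D T"
  proof
    fix z assume "z \<in> spectrum D T"
    show "z \<in> eigenvalues D T"
    proof (rule ccontr)
      assume z: "z \<notin> eigenvalues D T"
      then obtain C where "\<And>u. u \<in> D \<Longrightarrow> norm u \<le> C * norm (T u - z *\<^sub>C u)"
        using bounded_below by blast
      from resolvent_setI(1)[OF clinear_T surj_if_not_eigenvalue[OF z] this]
      show False
        using \<open>z \<in> spectrum D T\<close> by (simp add: spectrum_def)
    qed
  qed
qed

end

section \<open>Counting and locating eigenvalues\<close>

context perturbed_multiplication
begin

text \<open>The diagonal of a Schur flag is controlled by the form: each flag vector has at least half of its
  mass on the first \<open>N\<close> basis vectors, and Bessel's inequality then bounds the length of the flag.\<close>

lemma card_eigenvalues_le:
  assumes "finite Z" "Z \<subseteq> eigenvalues D T" "\<And>z. z \<in> Z \<Longrightarrow> Re z \<le> R"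
    and N: "\<And>n. n \<ge> N \<Longrightarrow> (\<kappa> n)\<^sup>2 \<ge> 2 * (R + b)" and "R + b > 0"
  shows "card Z \<le> 2 * N"
proof -
  define m where "m = card Z"
  obtain q \<zeta> where *: "orthonormal_system q \<and> \<zeta> ` {..<m} = Z \<and> (\<forall>i\<ge>m. q i = 0) \<and>
      (\<forall>i<m. q i \<in> D \<and> norm (q i) = 1 \<and>
        T (q i) - \<zeta> i *\<^sub>C q i \<in> orthonormal_system.initial q i)"
    using schur_flag[OF clinear_T assms(1,2), folded m_def] by (elim exE)
  then have q_sys: "orthonormal_system q"
    by simp
  from * have \<zeta>: "\<zeta> i \<in> Z" and qD: "q i \<in> D" and q1: "norm (q i) = 1"
    and flag: "T (q i) - \<zeta> i *\<^sub>C q i \<in> orthonormal_system.initial q i" if "i < m" for i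
    using that by auto
  interpret q: orthonormal_system q by (rule q_sys)
  have half: "1 / 2 \<le> (\<Sum>n<N. (norm (coef (q i) n))\<^sup>2)" if i: "i < m" for i
  proof -
    have "cinner (T (q i) - \<zeta> i *\<^sub>C q i) (q i) = 0"
      by (rule q.initial_coef[OF flag[OF i]]) simp
    then have "cinner (T (q i)) (q i) = \<zeta> i"
      using q1[OF i] by (simp add: cinner.diff_left cinner_scaleC_left cinner_self)
    then have "t (q i) (q i) = \<zeta> i"
      using T_eq_t[OF qD[OF i], of "q i"] qD[OF i] D_subset_Q by auto
    \<comment> \<open>The diagonal entry of the flag is a value of the form, so a bound on its real
      part bounds the energy of the unit vector \<open>q i\<close>.\<close>
    then have K: "(norm (K (q i)))\<^sup>2 \<le> R + b"
      using t_bounds(1)[of "q i"] q1[OF i] assms(3)[OF \<zeta>[OF i]] by simp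
    define p where "p = (\<Sum>n<N. coef (q i) n *\<^sub>C e n)"
    have pn: "coef p n = (if n < N then coef (q i) n else 0)" for n
      unfolding p_def by (simp add: coef_partial_sum)
    \<comment> \<open>From index N on, \<kappa> is at least \<open>sqrt (2 * (R + b))\<close>; with
      energy at most R + b, the tail has squared norm at most 1 / 2.\<close>
    have "norm (q i - p) \<le> (1 / sqrt (2 * (R + b))) * norm (K (q i))"
    proof (rule norm_le_coef)
      fix n
      show "norm (coef (q i - p) n) \<le> (1 / sqrt (2 * (R + b))) * norm (coef (K (q i)) n)"
      proof (cases "n < N")
        case True
        then show ?thesis using assms(5) by (simp add: cinner.diff_left pn)
      next
        case False
        then have "sqrt (2 * (R + b)) \<le> \<kappa> n"
          using N[of n] \<kappa>_nonneg[of n] by (simp add: real_le_lsqrt)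
        then have "1 \<le> (1 / sqrt (2 * (R + b))) * \<kappa> n"
          using assms(5) by (simp add: field_simps)
        from mult_right_mono[OF this norm_ge_zero[of "coef (q i) n"]] False show ?thesis
          using qD[OF i] D_subset_Q \<kappa>_nonneg[of n]
          by (auto simp: cinner.diff_left pn mop_coef subset_iff norm_mult)
      qed
    qed (use assms(5) in simp)
    then have "(norm (q i - p))\<^sup>2 \<le> ((1 / sqrt (2 * (R + b))) * norm (K (q i)))\<^sup>2"
      by (rule power_mono) simp
    also have "\<dots> = (norm (K (q i)))\<^sup>2 / (2 * (R + b))"
      using assms(5) by (simp add: power_mult_distrib power_divide)
    also have "\<dots> \<le> (R + b) / (2 * (R + b))"
      using K assms(5) by (intro divide_right_mono) auto
    also have "\<dots> = 1 / 2"
      using assms(5) by (simp add: field_simps)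
    finally show ?thesis
      using bessel_eq[of "{..<N}" "q i"] q1[OF i] by (simp add: p_def)
  qed
  have "real m / 2 = (\<Sum>i<m. 1 / 2)"
    by simp
  also have "\<dots> \<le> (\<Sum>i<m. \<Sum>n<N. (norm (coef (q i) n))\<^sup>2)"
    by (intro sum_mono half) simp
  also have "\<dots> = (\<Sum>n<N. \<Sum>i<m. (norm (coef (q i) n))\<^sup>2)"
    by (rule sum.swap)
  \<comment> \<open>The roles are exchanged here: Bessel's inequality is applied to
    \<open>e n\<close> with respect to the flag.\<close>
  also have "\<dots> \<le> (\<Sum>n<N. 1)"
  proof (rule sum_mono)
    fix n
    have "norm (coef (q i) n) = norm (cinner (e n) (q i))" for i
      by (subst cinner_commute) simp
    then have "(\<Sum>i<m. (norm (coef (q i) n))\<^sup>2) \<le> (norm (e n))\<^sup>2"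
      using q.bessel[of "{..<m}" "e n"] by simp
    also have "\<dots> \<le> 1"
      using unit[of n] by (cases "e n = 0") auto
    finally show "(\<Sum>i<m. (norm (coef (q i) n))\<^sup>2) \<le> 1" .
  qed
  finally show ?thesis
    by (simp add: m_def)
qed

lemma finite_eigenvalues_half_plane: "finite {z \<in> eigenvalues D T. Re z \<le> R}"
proof -
  \<comment> \<open>Enlarging R makes R + b positive, as the counting lemma requires.\<close>
  define R' where "R' = \<bar>R\<bar>"
  have R': "R' + b > 0" "R \<le> R'" using b_pos by (auto simp: R'_def)
  obtain N where N: "\<And>n. n \<ge> N \<Longrightarrow> (\<kappa> n)\<^sup>2 \<ge> 2 * (R' + b)"
    using \<kappa>_sq_large by blast
  have *: "card Z \<le> 2 * N" if "finite Z" "Z \<subseteq> {z \<in> eigenvalues D T. Re z \<le> R}" for Z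
    using that R' by (intro card_eigenvalues_le[OF _ _ _ N]) (auto intro: order_trans)
  show ?thesis
    by (rule finite_if_finite_subsets_card_bdd[THEN conjunct1]) (rule *)
qed

lemma countable_eigenvalues: "countable (eigenvalues D T)"
proof -
  have "eigenvalues D T = (\<Union>n::nat. {z \<in> eigenvalues D T. Re z \<le> real n})"
    using real_arch_simple by auto
  moreover have "countable (\<Union>n::nat. {z \<in> eigenvalues D T. Re z \<le> real n})"
    using finite_eigenvalues_half_plane by (intro countable_UN) (auto intro: countable_finite)
  ultimately show ?thesis by simp
qed

text \<open>The unit ball around z lies in a half-plane that contains only finitely many
  eigenvalues.\<close>

lemma eigenvalues_no_islimpt: "\<not> z islimpt eigenvalues D T"
proof
  assume "z islimpt eigenvalues D T"
  then have "infinite (eigenvalues D T \<inter> ball z 1)"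
    by (simp add: islimpt_eq_infinite_ball)
  moreover have "eigenvalues D T \<inter> ball z 1 \<subseteq> {w \<in> eigenvalues D T. Re w \<le> Re z + 1}"
  proof
    fix w assume w: "w \<in> eigenvalues D T \<inter> ball z 1"
    then have "Re (w - z) \<le> 1"
      using complex_Re_le_cmod[of "w - z"] by (simp add: dist_norm norm_minus_commute)
    then show "w \<in> {w \<in> eigenvalues D T. Re w \<le> Re z + 1}"
      using w by simp
  qed
  ultimately show False
    using finite_eigenvalues_half_plane finite_subset by blast
qed

text \<open>Near an isolated \<open>\<kappa> n\<^sup>2\<close> an eigenvector \<open>e n + w\<close> with \<open>w\<close> orthogonal to \<open>e n\<close> is the
  fixed point of a contraction: the component along \<open>e n\<close> determines the eigenvalue \<open>z w\<close>, the
  other components determine \<open>w\<close>.\<close>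

lemma eigenvalue_near:
  assumes en: "e n \<noteq> 0" and gap: "\<And>m. m \<noteq> n \<Longrightarrow> \<bar>(\<kappa> m)\<^sup>2 - (\<kappa> n)\<^sup>2\<bar> \<ge> 6 * b"
  shows "\<exists>z\<in>eigenvalues D T. norm (z - complex_of_real ((\<kappa> n)\<^sup>2)) \<le> 2 * b"
proof -
  define z where "z w = (complex_of_real (\<kappa> n))\<^sup>2 + coef (B (e n + w)) n" for w
  \<comment> \<open>The reduced resolvent of the diagonal: the entry 0 at n keeps the iterates
    orthogonal to \<open>e n\<close>, so the eigenvector stays normalized by
    \<open>coef u n = 1\<close>.\<close>
  define \<nu> where "\<nu> w m = (if m = n then 0 else 1 / ((complex_of_real (\<kappa> m))\<^sup>2 - z w))" for w m
  define x where "x w = - B (e n + w)" for w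
  define \<Phi> where "\<Phi> w = mop (\<nu> w) (x w)" for w
  let ?S = "cball (0::'a) 1"
  have e1: "norm (e n) = 1" using unit[OF en] .
  have B2: "norm (B (e n + w)) \<le> 2 * b" if "w \<in> ?S" for w
  proof -
    have "norm (e n + w) \<le> 2"
      using norm_triangle_ineq[of "e n" w] e1 that by simp
    from mult_left_mono[OF this, of b] show ?thesis
      using B_bound[of "e n + w"] b_pos by linarith
  qed
  have z_near: "norm (z w - (complex_of_real (\<kappa> n))\<^sup>2) \<le> 2 * b" if "w \<in> ?S" for w
    using norm_cinner_le[of "B (e n + w)" "e n"] B2[OF that] e1 by (simp add: z_def)
  \<comment> \<open>The gap 6b, minus the distance 2b that \<open>z w\<close> can move away from the
    diagonal entry.\<close>
  have far: "4 * b \<le> norm ((complex_of_real (\<kappa> m))\<^sup>2 - z w)" if "w \<in> ?S" "m \<noteq> n" for w m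
  proof -
    have "6 * b \<le> norm ((complex_of_real (\<kappa> m))\<^sup>2 - (complex_of_real (\<kappa> n))\<^sup>2)"
      using gap[OF that(2)] by (simp flip: of_real_power of_real_diff)
    also have "\<dots> \<le> norm ((complex_of_real (\<kappa> m))\<^sup>2 - z w) + norm (z w - (complex_of_real (\<kappa> n))\<^sup>2)"
      using norm_triangle_ineq[of "(complex_of_real (\<kappa> m))\<^sup>2 - z w" "z w - (complex_of_real (\<kappa> n))\<^sup>2"]
      by simp
    finally show ?thesis
      using z_near[OF that(1)] by simp
  qed
  have \<nu>: "norm (\<nu> w m) \<le> 1 / (4 * b)" if "w \<in> ?S" for w m
    using far[OF that, of m] b_pos by (auto simp: \<nu>_def norm_divide intro: frac_le)
  have c0: "1 / (4 * b) \<ge> 0" using b_pos by simp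
  \<comment> \<open>The image even has norm at most 2b / (4b) = 1 / 2.\<close>
  have \<Phi>_S: "\<Phi> w \<in> ?S" if "w \<in> ?S" for w
  proof -
    have "norm (\<Phi> w) \<le> 1 / (4 * b) * norm (x w)"
      unfolding \<Phi>_def by (rule mop_bounded(2)[OF \<nu>[OF that] c0])
    also have "\<dots> \<le> 1 / (4 * b) * (2 * b)"
      using B2[OF that] c0 by (intro mult_left_mono) (auto simp: x_def)
    finally show ?thesis
      using b_pos by simp
  qed
  \<comment> \<open>Both the vector and the multiplier depend on w. Changing the vector contributes
    b / (4b) = 1 / 4; changing the multiplier contributes b / (4b)^2 times 2b, that is 1 /
    8.\<close>
  have contr: "dist (\<Phi> w) (\<Phi> w') \<le> (3 / 8) * dist w w'" if w: "w \<in> ?S" "w' \<in> ?S" for w w'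
  proof -
    define \<eta> where "\<eta> m = \<nu> w m - \<nu> w' m" for m
    have xd: "norm (x w - x w') \<le> b * norm (w - w')"
      using B_bound[of "w' - w"] by (simp add: x_def B_add B_diff norm_minus_commute)
    have zd: "norm (z w - z w') \<le> b * norm (w - w')"
    proof -
      have "z w - z w' = coef (x w' - x w) n"
        by (simp add: z_def x_def cinner.diff_left cinner.minus_left)
      then show ?thesis
        using norm_cinner_le[of "x w' - x w" "e n"] xd e1 by (simp add: norm_minus_commute)
    qed
    have \<eta>: "norm (\<eta> m) \<le> b * norm (w - w') / (4 * b)\<^sup>2" for m
    proof (cases "m = n")
      case True
      then show ?thesis using b_pos by (simp add: \<eta>_def \<nu>_def)
    next
      case False
      define p where "p = (complex_of_real (\<kappa> m))\<^sup>2 - z w"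
      define p' where "p' = (complex_of_real (\<kappa> m))\<^sup>2 - z w'"
      have p: "4 * b \<le> norm p" "4 * b \<le> norm p'"
        using far[OF w(1) False] far[OF w(2) False] by (auto simp: p_def p'_def)
      then have "p \<noteq> 0" "p' \<noteq> 0" using b_pos by auto
      then have "\<eta> m = (p' - p) / (p * p')"
        using False by (simp add: \<eta>_def \<nu>_def p_def[symmetric] p'_def[symmetric] field_simps)
      also have "p' - p = z w - z w'"
        by (simp add: p_def p'_def)
      finally have "norm (\<eta> m) = norm (z w - z w') / (norm p * norm p')"
        by (simp add: norm_divide norm_mult)
      also have "\<dots> \<le> (b * norm (w - w')) / (4 * b)\<^sup>2"
        unfolding power2_eq_square using p b_pos
        by (intro frac_le zd mult_mono) auto
      finally show ?thesis .
    qed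
    have \<eta>0: "b * norm (w - w') / (4 * b)\<^sup>2 \<ge> 0" using b_pos by simp
    have "\<Phi> w - \<Phi> w' = mop (\<nu> w) (x w - x w') + mop \<eta> (x w')"
      by (rule coef_ext)
        (simp add: \<Phi>_def cinner.diff_left cinner_add_left mop_coef mop_bounded(1)[OF \<nu>[OF w(1)] c0]
          mop_bounded(1)[OF \<nu>[OF w(2)] c0] mop_bounded(1)[OF \<eta> \<eta>0] \<eta>_def algebra_simps)
    then have "norm (\<Phi> w - \<Phi> w') \<le> norm (mop (\<nu> w) (x w - x w')) + norm (mop \<eta> (x w'))"
      by (simp add: norm_triangle_ineq)
    also have "norm (mop (\<nu> w) (x w - x w')) \<le> 1 / (4 * b) * norm (x w - x w')"
      by (rule mop_bounded(2)[OF \<nu>[OF w(1)] c0])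
    also have "\<dots> \<le> 1 / (4 * b) * (b * norm (w - w'))"
      by (rule mult_left_mono[OF xd c0])
    also have "norm (mop \<eta> (x w')) \<le> b * norm (w - w') / (4 * b)\<^sup>2 * norm (x w')"
      by (rule mop_bounded(2)[OF \<eta> \<eta>0])
    also have "\<dots> \<le> b * norm (w - w') / (4 * b)\<^sup>2 * (2 * b)"
      using B2[OF w(2)] \<eta>0 by (intro mult_left_mono) (auto simp: x_def)
    finally show ?thesis
      using b_pos by (simp add: dist_norm power2_eq_square)
  qed
  have "\<exists>!w\<in>?S. \<Phi> w = w"
    by (rule Banach_fix[of _ "3 / 8"]) (use \<Phi>_S contr in \<open>auto simp: complete_eq_closed\<close>)
  then obtain w where w: "w \<in> ?S" "\<Phi> w = w" by blast
  have xD: "x w \<in> mdom (\<nu> w)"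
    by (rule mop_bounded(1)[OF \<nu>[OF w(1)] c0])
  have wm: "coef w m = \<nu> w m * coef (x w) m" for m
    using mop_coef[OF xD, of m] w(2) by (simp add: \<Phi>_def)
  define u where "u = e n + w"
  have un: "coef u n = 1"
    using en wm[of n] by (simp add: u_def cinner_add_left coef_basis \<nu>_def)
  have c: "coef (z w *\<^sub>C u - B u) m = (complex_of_real (\<kappa> m))\<^sup>2 * coef u m" for m
  proof (cases "m = n")
    case True
    then show ?thesis
      using un by (simp add: cinner.diff_left cinner_scaleC_left z_def u_def)
  next
    case False
    have "(complex_of_real (\<kappa> m))\<^sup>2 - z w \<noteq> 0"
      using far[OF w(1) False] b_pos by auto
    moreover have "coef u m = coef (x w) m / ((complex_of_real (\<kappa> m))\<^sup>2 - z w)"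
      using False wm[of m] by (simp add: u_def cinner_add_left coef_basis \<nu>_def)
    ultimately have "((complex_of_real (\<kappa> m))\<^sup>2 - z w) * coef u m = coef (x w) m"
      by simp
    moreover have "x w = - B u"
      by (simp add: x_def u_def)
    ultimately show ?thesis
      by (simp add: cinner.diff_left cinner.minus_left cinner_scaleC_left algebra_simps)
  qed
  have "u \<in> D" by (rule mdomI[OF c])
  moreover have "T u = z w *\<^sub>C u"
    by (simp add: T_def mop_eqI[OF c])
  moreover have "u \<noteq> 0"
    using un by auto
  ultimately have "z w \<in> eigenvalues D T"
    by (auto simp: eigenvalues_def)
  then show ?thesis
    using z_near[OF w(1)] by (auto simp: of_real_power)
qed

lemma eigenvalues_unbounded:
  assumes "\<And>g. \<exists>n. e n \<noteq> 0 \<and> (\<kappa> n)\<^sup>2 \<ge> g \<and> (\<forall>m. m \<noteq> n \<longrightarrow> \<bar>(\<kappa> m)\<^sup>2 - (\<kappa> n)\<^sup>2\<bar> \<ge> g)"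
  shows "\<not> bounded (eigenvalues D T)"
proof
  assume "bounded (eigenvalues D T)"
  then obtain M where M: "\<And>z. z \<in> eigenvalues D T \<Longrightarrow> norm z \<le> M"
    by (auto simp: bounded_iff)
  obtain n where n: "e n \<noteq> 0" "(\<kappa> n)\<^sup>2 \<ge> \<bar>M\<bar> + 6 * b"
    "\<And>m. m \<noteq> n \<Longrightarrow> \<bar>(\<kappa> m)\<^sup>2 - (\<kappa> n)\<^sup>2\<bar> \<ge> \<bar>M\<bar> + 6 * b"
    using assms by blast
  have "\<bar>(\<kappa> m)\<^sup>2 - (\<kappa> n)\<^sup>2\<bar> \<ge> 6 * b" if "m \<noteq> n" for m
    using n(3)[OF that] by linarith
  then obtain z where z: "z \<in> eigenvalues D T" "norm (z - complex_of_real ((\<kappa> n)\<^sup>2)) \<le> 2 * b"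
    using eigenvalue_near[OF n(1)] by blast
  have "(\<kappa> n)\<^sup>2 = norm (complex_of_real ((\<kappa> n)\<^sup>2))"
    by (simp add: norm_power)
  also have "\<dots> \<le> norm z + norm (z - complex_of_real ((\<kappa> n)\<^sup>2))"
    using norm_triangle_ineq4[of z "z - complex_of_real ((\<kappa> n)\<^sup>2)"] by simp
  finally show False
    using z(2) M[OF z(1)] n(2) b_pos by linarith
qed

end

section \<open>Completeness of \<open>L2\<close>\<close>

lemma square_integrable_fun_of: "square_integrable (fun_of u)"
  using Quotient3_rep_reflp[OF Quotient3_L2, of u] by (simp add: L2_rel_def)

lemma L2_of_fun_of: "L2_of (fun_of u) = u"
  by (rule Quotient3_abs_rep[OF Quotient3_L2])

lemma fun_of_L2_of: "square_integrable f \<Longrightarrow> AE x in unit_leb. fun_of (L2_of f) x = f x"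
  using rep_abs_rsp_left[OF Quotient3_L2, of f f] by (simp add: L2_rel_def)

lemma L2_eqI: "AE x in unit_leb. fun_of u x = fun_of v x \<Longrightarrow> u = v"
  using Quotient3_rel_rep[OF Quotient3_L2, of u v] by (simp add: L2_rel_def square_integrable_fun_of)

lemma L2_of_eqI:
  assumes "square_integrable f" "AE x in unit_leb. fun_of u x = f x"
  shows "L2_of f = u"
  using fun_of_L2_of[OF assms(1)] assms(2) by (intro L2_eqI) (auto elim: eventually_elim2)

lemma fun_of_plus: "AE x in unit_leb. fun_of (u + v) x = fun_of u x + fun_of v x"
proof -
  have "u + v = L2_of (\<lambda>x. fun_of u x + fun_of v x)"
    by (simp add: plus_L2_def)
  then show ?thesis
    by (simp add: fun_of_L2_of square_integrable_add square_integrable_fun_of)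
qed

lemma fun_of_scaleC: "AE x in unit_leb. fun_of (c *\<^sub>C u) x = c * fun_of u x"
proof -
  have "c *\<^sub>C u = L2_of (\<lambda>x. c * fun_of u x)"
    by (simp add: scaleC_L2_def)
  then show ?thesis
    by (simp add: fun_of_L2_of square_integrable_scale square_integrable_fun_of)
qed

lemma fun_of_diff: "AE x in unit_leb. fun_of (u - v) x = fun_of u x - fun_of v x"
  using fun_of_plus[of u "(-1) *\<^sub>C v"] fun_of_scaleC[of "-1" v]
  by (auto simp: minus_L2_def elim: eventually_elim2)

lemma fun_of_zero: "AE x in unit_leb. fun_of 0 x = 0"
  using fun_of_scaleC[of 0 0] by simp

lemma cinner_fun_of: "cinner u v = (LINT x|unit_leb. fun_of u x * cnj (fun_of v x))"
  by (simp add: cinner_L2_def)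

lemma cinner_cong_AE:
  assumes f: "square_integrable f" "AE x in unit_leb. fun_of u x = f x"
    and g: "square_integrable g" "AE x in unit_leb. fun_of v x = g x"
  shows "cinner u v = (LINT x|unit_leb. f x * cnj (g x))"
  unfolding cinner_fun_of
  using f(2) g(2)
  by (intro integral_cong_AE borel_measurable_integrable[OF square_integrable_mult] f(1) g(1)
      square_integrable_fun_of) (auto elim: eventually_elim2)

lemma cinner_L2_of:
  assumes "square_integrable f" "square_integrable g"
  shows "cinner (L2_of f) (L2_of g) = (LINT x|unit_leb. f x * cnj (g x))"
  using assms by (intro cinner_cong_AE fun_of_L2_of)

lemma norm_fun_of: "(norm u)\<^sup>2 = (LINT x|unit_leb. (norm (fun_of u x))\<^sup>2)"
proof -
  have "complex_of_real ((norm u)\<^sup>2) = complex_of_real (LINT x|unit_leb. (norm (fun_of u x))\<^sup>2)"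
    unfolding cinner_self[symmetric] cinner_fun_of
    by (simp only: complex_norm_square[symmetric] integral_complex_of_real)
  then show ?thesis
    by (simp only: of_real_eq_iff)
qed

lemma square_integrable_measurable: "square_integrable f \<Longrightarrow> f \<in> borel_measurable unit_leb"
  by (simp add: square_integrable_def)

lemma measurable_fun_of [measurable]: "fun_of u \<in> borel_measurable unit_leb"
  using square_integrable_fun_of by (rule square_integrable_measurable)

lemma nn_integral_fun_of:
  "(\<integral>\<^sup>+ x. ennreal ((norm (fun_of u x))\<^sup>2) \<partial>unit_leb) = ennreal ((norm u)\<^sup>2)"
  using square_integrable_fun_of[of u] unfolding norm_fun_of square_integrable_def
  by (intro nn_integral_eq_integral) auto

lemma finite_measure_unit_leb: "finite_measure unit_leb"
  by (rule finite_measureI) (simp add: emeasure_restrict_space)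

lemma measure_unit_leb: "measure unit_leb (space unit_leb) = 1"
  by (simp add: measure_restrict_space)

lemma square_integrable_const: "square_integrable (\<lambda>x. c)"
  using finite_measure.integrable_const[OF finite_measure_unit_leb]
  by (simp add: square_integrable_def)

text \<open>Cauchy-Schwarz against the constant 1, on an interval of length 1.\<close>

lemma L1_le_norm:
  shows "integrable unit_leb (\<lambda>x. norm (fun_of u x))"
    and "(LINT x|unit_leb. norm (fun_of u x)) \<le> norm u"
proof -
  define v where "v = L2_of (\<lambda>x. complex_of_real (norm (fun_of u x)))"
  define one where "one = L2_of (\<lambda>x. 1)"
  have sv: "square_integrable (\<lambda>x. complex_of_real (norm (fun_of u x)))"
    using square_integrable_fun_of[of u] by (simp add: square_integrable_def)
  have so: "square_integrable (\<lambda>x. 1)"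
    by (rule square_integrable_const)
  have c: "cinner v one = (LINT x|unit_leb. complex_of_real (norm (fun_of u x)))"
    unfolding v_def one_def by (simp add: cinner_L2_of[OF sv so])
  have "integrable unit_leb (\<lambda>x. complex_of_real (norm (fun_of u x)))"
    using square_integrable_mult[OF sv so] by simp
  then show i: "integrable unit_leb (\<lambda>x. norm (fun_of u x))"
    by (simp add: complex_of_real_integrable_eq)
  have "complex_of_real ((norm v)\<^sup>2) = complex_of_real ((norm u)\<^sup>2)"
    unfolding cinner_self[symmetric] v_def cinner_L2_of[OF sv sv] unfolding cinner_fun_of
    by (simp only: complex_norm_square[symmetric] norm_of_real abs_norm_cancel)
  then have nv: "norm v = norm u"
    by (simp only: of_real_eq_iff power2_eq_iff_nonneg norm_ge_zero)
  have "complex_of_real ((norm one)\<^sup>2) = 1"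
    unfolding cinner_self[symmetric] one_def cinner_L2_of[OF so so]
    by (simp add: measure_unit_leb[simplified])
  then have "(norm one)\<^sup>2 = 1\<^sup>2"
    by (metis of_real_eq_1_iff power_one)
  then have n1: "norm one = 1"
    by (simp only: power2_eq_iff_nonneg norm_ge_zero zero_le_one)
  have "(LINT x|unit_leb. norm (fun_of u x)) = norm (cinner v one)"
    unfolding c integral_complex_of_real by simp
  also have "\<dots> \<le> norm u"
    using norm_cinner_le[of v one] by (simp add: nv n1)
  finally show "(LINT x|unit_leb. norm (fun_of u x)) \<le> norm u" .
qed

text \<open>The increments are summable in the L1 norm, hence the sequence converges almost
  everywhere. Fatou's lemma and the Cauchy property then upgrade the pointwise limit to a limit in
  norm.\<close>

lemma L2_limit_of_fast_sequence:
  fixes X :: "nat \<Rightarrow> L2"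
  assumes fast: "\<And>n. norm (X (Suc n) - X n) \<le> (1/2) ^ n" and "Cauchy X"
  shows "\<exists>L. X \<longlonglongrightarrow> L"
proof -
  define f where "f n = fun_of (X (Suc n) - X n)" for n
  have fm [measurable]: "f n \<in> borel_measurable unit_leb" for n
    by (simp add: f_def)
  have "(\<integral>\<^sup>+ x. (\<Sum>n. ennreal (norm (f n x))) \<partial>unit_leb) = (\<Sum>n. \<integral>\<^sup>+ x. ennreal (norm (f n x)) \<partial>unit_leb)"
    by (rule nn_integral_suminf) measurable
  also have "\<dots> \<le> (\<Sum>n. ennreal ((1/2) ^ n))"
  proof (rule suminf_le)
    show "(\<integral>\<^sup>+ x. ennreal (norm (f n x)) \<partial>unit_leb) \<le> ennreal ((1/2) ^ n)" for n
      using L1_le_norm[of "X (Suc n) - X n"] fast[of n]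
      by (subst nn_integral_eq_integral) (auto simp: f_def intro!: ennreal_leI)
  qed auto
  also have "\<dots> < \<infinity>"
  proof -
    have "(\<Sum>n. ennreal ((1/2) ^ n)) = ennreal (\<Sum>n. (1/2::real) ^ n)"
      by (rule suminf_ennreal2) (auto intro: summable_geometric)
    then show ?thesis by simp
  qed
  finally have fin: "(\<integral>\<^sup>+ x. (\<Sum>n. ennreal (norm (f n x))) \<partial>unit_leb) \<noteq> \<infinity>"
    by simp
  have "AE x in unit_leb. (\<Sum>n. ennreal (norm (f n x))) \<noteq> \<infinity>"
    by (rule nn_integral_PInf_AE[OF _ fin]) measurable
  then have sm: "AE x in unit_leb. summable (\<lambda>n. f n x)"
    by eventually_elim (rule summable_norm_cancel, rule summable_suminf_not_top, auto)
  define h where "h x = fun_of (X 0) x + (\<Sum>n. f n x)" for x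
  have [measurable]: "h \<in> borel_measurable unit_leb"
    unfolding h_def by measurable
  have "AE x in unit_leb. \<forall>n. f n x = fun_of (X (Suc n)) x - fun_of (X n) x"
    unfolding AE_all_countable f_def using fun_of_diff by blast
  with sm have lim: "AE x in unit_leb. (\<lambda>n. fun_of (X n) x) \<longlonglongrightarrow> h x"
  proof eventually_elim
    case (elim x)
    have "fun_of (X n) x = fun_of (X 0) x + (\<Sum>i<n. f i x)" for n
      using elim(2) by (induction n) auto
    then have eq: "(\<lambda>n. fun_of (X n) x) = (\<lambda>n. fun_of (X 0) x + (\<Sum>i<n. f i x))"
      by (rule ext)
    show ?case
      unfolding h_def by (subst eq) (intro tendsto_intros summable_LIMSEQ elim(1))
  qed
  \<comment> \<open>With n fixed and m tending to infinity, the pointwise limit of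
    \<open>X n - X m\<close> is \<open>X n - h\<close>, so the Cauchy bound passes to it.\<close>
  have fatou: "(\<integral>\<^sup>+ x. ennreal ((norm (fun_of (X n) x - h x))\<^sup>2) \<partial>unit_leb) \<le> ennreal (r\<^sup>2)"
    if r: "r > 0" "\<And>m. m \<ge> N \<Longrightarrow> norm (X n - X m) \<le> r" for n N r
  proof -
    have "AE x in unit_leb. ennreal ((norm (fun_of (X n) x - h x))\<^sup>2) =
        liminf (\<lambda>m. ennreal ((norm (fun_of (X n) x - fun_of (X m) x))\<^sup>2))"
      using lim
    proof eventually_elim
      case (elim x)
      then have "(\<lambda>m. ennreal ((norm (fun_of (X n) x - fun_of (X m) x))\<^sup>2)) \<longlonglongrightarrow>
          ennreal ((norm (fun_of (X n) x - h x))\<^sup>2)"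
        by (intro tendsto_intros)
      then show ?case
        by (intro lim_imp_Liminf[symmetric]) auto
    qed
    then have "(\<integral>\<^sup>+ x. ennreal ((norm (fun_of (X n) x - h x))\<^sup>2) \<partial>unit_leb) =
        (\<integral>\<^sup>+ x. liminf (\<lambda>m. ennreal ((norm (fun_of (X n) x - fun_of (X m) x))\<^sup>2)) \<partial>unit_leb)"
      by (rule nn_integral_cong_AE)
    also have "\<dots> \<le> liminf (\<lambda>m. \<integral>\<^sup>+ x. ennreal ((norm (fun_of (X n) x - fun_of (X m) x))\<^sup>2) \<partial>unit_leb)"
      by (rule nn_integral_liminf) measurable
    also have "\<dots> \<le> ennreal (r\<^sup>2)"
    proof (rule Liminf_le)
      show "\<forall>\<^sub>F m in sequentially.
          (\<integral>\<^sup>+ x. ennreal ((norm (fun_of (X n) x - fun_of (X m) x))\<^sup>2) \<partial>unit_leb) \<le> ennreal (r\<^sup>2)"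
        unfolding eventually_sequentially
      proof (intro exI allI impI)
        fix m assume "N \<le> m"
        have "(\<integral>\<^sup>+ x. ennreal ((norm (fun_of (X n) x - fun_of (X m) x))\<^sup>2) \<partial>unit_leb) =
            (\<integral>\<^sup>+ x. ennreal ((norm (fun_of (X n - X m) x))\<^sup>2) \<partial>unit_leb)"
          using fun_of_diff[of "X n" "X m"] by (intro nn_integral_cong_AE) (auto elim: eventually_mono)
        also have "\<dots> \<le> ennreal (r\<^sup>2)"
          unfolding nn_integral_fun_of using r(2)[OF \<open>N \<le> m\<close>] by (intro ennreal_leI power_mono) auto
        finally show "(\<integral>\<^sup>+ x. ennreal ((norm (fun_of (X n) x - fun_of (X m) x))\<^sup>2) \<partial>unit_leb) \<le> ennreal (r\<^sup>2)" .
      qed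
    qed simp
    finally show ?thesis .
  qed
  have Cau: "\<exists>N. \<forall>n\<ge>N. \<forall>m\<ge>N. norm (X n - X m) \<le> r" if "r > 0" for r
    using \<open>Cauchy X\<close> that unfolding Cauchy_def dist_norm by (meson less_imp_le)
  have sq_diff: "square_integrable (\<lambda>x. fun_of (X n) x - h x)"
    if "\<And>m. m \<ge> N \<Longrightarrow> norm (X n - X m) \<le> r" "r > 0" for n N r
    unfolding square_integrable_def
  proof
    show "integrable unit_leb (\<lambda>x. (norm (fun_of (X n) x - h x))\<^sup>2)"
      by (rule integrableI_bounded)
        (use order_le_less_trans[OF fatou[OF that(2,1)] ennreal_less_top] in auto)
  qed measurable
  have sqh: "square_integrable h"
  proof -
    obtain N where N: "\<And>n m. n \<ge> N \<Longrightarrow> m \<ge> N \<Longrightarrow> norm (X n - X m) \<le> 1"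
      using Cau[of 1] by auto
    have "square_integrable (\<lambda>x. fun_of (X N) x + (-1) * (fun_of (X N) x - h x))"
      by (intro square_integrable_add square_integrable_scale square_integrable_fun_of
          sq_diff[where N = N and r = 1] N) auto
    then show ?thesis by simp
  qed
  have "X \<longlonglongrightarrow> L2_of h"
  proof (rule LIMSEQ_I)
    fix r :: real assume "r > 0"
    then obtain N where N: "\<And>n m. n \<ge> N \<Longrightarrow> m \<ge> N \<Longrightarrow> norm (X n - X m) \<le> r / 2"
      using Cau[of "r / 2"] by auto
    have "norm (X n - L2_of h) < r" if "n \<ge> N" for n
    proof -
      have "AE x in unit_leb. fun_of (X n - L2_of h) x = fun_of (X n) x - h x"
        using fun_of_diff[of "X n" "L2_of h"] fun_of_L2_of[OF sqh] by eventually_elim simp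
      then have "ennreal ((norm (X n - L2_of h))\<^sup>2) =
          (\<integral>\<^sup>+ x. ennreal ((norm (fun_of (X n) x - h x))\<^sup>2) \<partial>unit_leb)"
        unfolding nn_integral_fun_of[symmetric] by (intro nn_integral_cong_AE) (auto elim: eventually_mono)
      also have "\<dots> \<le> ennreal ((r / 2)\<^sup>2)"
        using N[OF that] \<open>r > 0\<close> by (intro fatou[where N = N]) auto
      finally have "(norm (X n - L2_of h))\<^sup>2 \<le> (r / 2)\<^sup>2"
        by (simp add: ennreal_le_iff)
      then have "norm (X n - L2_of h) \<le> r / 2"
        by (rule power2_le_imp_le) (use \<open>r > 0\<close> in simp)
      then show ?thesis using \<open>r > 0\<close> by simp
    qed
    then show "\<exists>N. \<forall>n\<ge>N. norm (X n - L2_of h) < r"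
      by blast
  qed
  then show ?thesis ..
qed

lemma fast_subsequence:
  fixes X :: "nat \<Rightarrow> 'a::real_normed_vector"
  assumes "Cauchy X"
  shows "\<exists>r. strict_mono r \<and> (\<forall>n. norm (X (r (Suc n)) - X (r n)) \<le> (1/2) ^ n)"
proof -
  have "\<exists>N. \<forall>i\<ge>N. \<forall>j\<ge>N. norm (X i - X j) \<le> (1/2) ^ n" for n
    using assms unfolding Cauchy_def dist_norm by (meson less_imp_le half_gt_zero_iff zero_less_power zero_less_one)
  then obtain N where N: "\<And>n i j. i \<ge> N n \<Longrightarrow> j \<ge> N n \<Longrightarrow> norm (X i - X j) \<le> (1/2) ^ n"
    by metis
  \<comment> \<open>The maximum secures strict growth and the threshold \<open>N (Suc n)\<close> at
    the same time.\<close>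
  define r where "r = rec_nat (N 0) (\<lambda>n m. max (Suc m) (N (Suc n)))"
  have r: "r 0 = N 0" "r (Suc n) = max (Suc (r n)) (N (Suc n))" for n
    by (simp_all add: r_def)
  have rN: "r n \<ge> N n" for n
    by (cases n) (auto simp: r)
  have "strict_mono r"
    unfolding strict_mono_Suc_iff by (auto simp: r)
  moreover have "norm (X (r (Suc n)) - X (r n)) \<le> (1/2) ^ n" for n
    using rN[of n] by (intro N) (auto simp: r)
  ultimately show ?thesis by blast
qed

instance L2 :: banach
proof
  fix X :: "nat \<Rightarrow> L2" assume X: "Cauchy X"
  obtain r where r: "strict_mono r" "\<And>n. norm (X (r (Suc n)) - X (r n)) \<le> (1/2) ^ n"
    using fast_subsequence[OF X] by blast
  then obtain L where "(X \<circ> r) \<longlonglongrightarrow> L"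
    using L2_limit_of_fast_sequence[of "X \<circ> r"] Cauchy_subseq_Cauchy[OF X r(1)] by auto
  then have "X \<longlonglongrightarrow> L"
    by (rule Cauchy_converges_subseq[OF X r(1)])
  then show "convergent X"
    by (rule convergentI)
qed

section \<open>Test functions\<close>

text \<open>The classical smooth function exp(-\<epsilon> / x), extended by 0. Polynomial factors in
  1 / x close the family under differentiation, and small \<epsilon> brings the exponential close to
  1 away from 0.\<close>

definition flat :: "real \<Rightarrow> real poly \<Rightarrow> real \<Rightarrow> real" where
  "flat \<epsilon> p x = (if x > 0 then poly p (1 / x) * exp (- \<epsilon> / x) else 0)"

text \<open>Chain rule in the variable y = 1 / x: d/dx is - y^2 d/dy, and d/dy acts on p(y)
  exp(-\<epsilon> y).\<close>

definition flat_deriv :: "real \<Rightarrow> real poly \<Rightarrow> real poly" where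
  "flat_deriv \<epsilon> p = [:0, 0, 1:] * (smult \<epsilon> p - pderiv p)"

lemma poly_exp_tendsto_0:
  assumes "\<epsilon> > 0"
  shows "((\<lambda>y::real. poly p y * exp (- \<epsilon> * y)) \<longlongrightarrow> 0) at_top"
proof -
  have mono: "((\<lambda>y::real. y ^ i * exp (- \<epsilon> * y)) \<longlongrightarrow> 0) at_top" for i
  proof -
    have "filterlim (\<lambda>y. \<epsilon> * y) at_top at_top"
      using assms by (intro filterlim_tendsto_pos_mult_at_top[OF tendsto_const _ filterlim_ident])
    from filterlim_compose[OF tendsto_power_div_exp_0 this]
    have "((\<lambda>y. (1 / \<epsilon> ^ i) * ((\<epsilon> * y) ^ i / exp (\<epsilon> * y))) \<longlongrightarrow> (1 / \<epsilon> ^ i) * 0) at_top"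
      by (intro tendsto_mult tendsto_const)
    then show ?thesis
      using assms by (simp add: power_mult_distrib exp_minus field_simps)
  qed
  have "((\<lambda>y. \<Sum>i\<le>degree p. coeff p i * (y ^ i * exp (- \<epsilon> * y))) \<longlongrightarrow> (\<Sum>i\<le>degree p. coeff p i * 0)) at_top"
    by (intro tendsto_intros mono)
  then show ?thesis
    by (simp add: poly_altdef sum_distrib_right mult.assoc)
qed

lemma flat_has_derivative:
  assumes "\<epsilon> > 0"
  shows "(flat \<epsilon> p has_real_derivative flat \<epsilon> (flat_deriv \<epsilon> p) x) (at x)"
proof -
  consider "x > 0" | "x < 0" | "x = 0" by linarith
  then show ?thesis
  proof cases
    case 1
    have "((\<lambda>x. poly p (1 / x) * exp (- \<epsilon> / x)) has_real_derivative flat \<epsilon> (flat_deriv \<epsilon> p) x) (at x)"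
      using 1 by (auto intro!: derivative_eq_intros simp: flat_def flat_deriv_def field_simps power2_eq_square)
    then show ?thesis
      by (rule has_field_derivative_transform_within_open[where S = "{0<..}"])
        (use 1 in \<open>auto simp: flat_def\<close>)
  next
    case 2
    have "((\<lambda>x. 0) has_real_derivative flat \<epsilon> (flat_deriv \<epsilon> p) x) (at x)"
      using 2 by (auto simp: flat_def)
    then show ?thesis
      by (rule has_field_derivative_transform_within_open[where S = "{..<0}"])
        (use 2 in \<open>auto simp: flat_def\<close>)
  next
    case 3
    \<comment> \<open>The right difference quotient at 0, in the variable 1 / h: dividing by h only
      raises the degree of the polynomial by one, and the exponential still wins.\<close>
    have "((\<lambda>h. poly ([:0, 1:] * p) (inverse h) * exp (- \<epsilon> * inverse h)) \<longlongrightarrow> 0) (at_right 0)"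
      using filterlim_compose[OF poly_exp_tendsto_0[OF assms] filterlim_inverse_at_top_right] .
    moreover have "\<forall>\<^sub>F h in at_right 0. poly ([:0, 1:] * p) (inverse h) * exp (- \<epsilon> * inverse h) = flat \<epsilon> p h / h"
      by (auto simp: eventually_at_right_field flat_def field_simps intro!: exI[of _ 1])
    ultimately have "((\<lambda>h. flat \<epsilon> p h / h) \<longlongrightarrow> 0) (at_right 0)"
      using tendsto_cong by force
    moreover have "((\<lambda>h. flat \<epsilon> p h / h) \<longlongrightarrow> 0) (at_left 0)"
    proof (rule tendsto_eventually)
      show "\<forall>\<^sub>F h in at_left 0. flat \<epsilon> p h / h = 0"
        by (auto simp: eventually_at_left_field flat_def intro!: exI[of _ "-1"])
    qed
    ultimately have "((\<lambda>h. flat \<epsilon> p h / h) \<longlongrightarrow> 0) (at 0)"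
      by (simp add: filterlim_split_at)
    then show ?thesis
      using 3 by (simp add: has_field_derivative_iff flat_def)
  qed
qed

definition bump :: "real \<Rightarrow> real \<Rightarrow> real \<Rightarrow> real \<Rightarrow> real" where
  "bump \<epsilon> a b x = flat \<epsilon> 1 (x - a) * flat \<epsilon> 1 (b - x)"

text \<open>A class that contains the bumps and is closed under differentiation, so smoothness is an
  induction on the order; the Leibniz rule makes the sums necessary.\<close>

inductive flat_product :: "real \<Rightarrow> real \<Rightarrow> real \<Rightarrow> (real \<Rightarrow> real) \<Rightarrow> bool" for \<epsilon> a b where
  product: "flat_product \<epsilon> a b (\<lambda>x. flat \<epsilon> p (x - a) * flat \<epsilon> q (b - x))"
| plus: "flat_product \<epsilon> a b f \<Longrightarrow> flat_product \<epsilon> a b g \<Longrightarrow> flat_product \<epsilon> a b (\<lambda>x. f x + g x)"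

lemma flat_minus: "flat \<epsilon> (- p) x = - flat \<epsilon> p x"
  by (simp add: flat_def)

lemma flat_product_derivative:
  assumes "flat_product \<epsilon> a b f" "\<epsilon> > 0"
  shows "\<exists>g. flat_product \<epsilon> a b g \<and> (\<forall>x. (f has_real_derivative g x) (at x))"
  using assms(1)
proof induction
  case (product p q)
  have d: "((\<lambda>x. flat \<epsilon> p (x - a) * flat \<epsilon> q (b - x)) has_real_derivative
      flat \<epsilon> (flat_deriv \<epsilon> p) (x - a) * flat \<epsilon> q (b - x) + flat \<epsilon> p (x - a) * flat \<epsilon> (- flat_deriv \<epsilon> q) (b - x)) (at x)"
    for x
  proof -
    have "((\<lambda>x. flat \<epsilon> p (x - a)) has_real_derivative flat \<epsilon> (flat_deriv \<epsilon> p) (x - a) * 1) (at x)"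
      by (rule DERIV_chain2[OF flat_has_derivative[OF assms(2)]]) (auto intro!: derivative_eq_intros)
    moreover have "((\<lambda>x. flat \<epsilon> q (b - x)) has_real_derivative flat \<epsilon> (flat_deriv \<epsilon> q) (b - x) * (-1)) (at x)"
      by (rule DERIV_chain2[OF flat_has_derivative[OF assms(2)]]) (auto intro!: derivative_eq_intros)
    ultimately show ?thesis
      by (rule DERIV_cong[OF DERIV_mult]) (simp add: flat_minus)
  qed
  show ?case
    by (rule exI, rule conjI, rule flat_product.plus, rule flat_product.product,
        rule flat_product.product, rule allI, rule d)
next
  case (plus f g)
  then obtain f' g' where "flat_product \<epsilon> a b f'" "flat_product \<epsilon> a b g'"
    and "\<And>x. (f has_real_derivative f' x) (at x)" "\<And>x. (g has_real_derivative g' x) (at x)"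
    by blast
  then show ?case
    by (intro exI[of _ "\<lambda>x. f' x + g' x"] conjI allI flat_product.plus DERIV_add)
qed

lemma flat_product_deriv: "flat_product \<epsilon> a b f \<Longrightarrow> \<epsilon> > 0 \<Longrightarrow> flat_product \<epsilon> a b (deriv f)"
proof -
  assume "flat_product \<epsilon> a b f" "\<epsilon> > 0"
  then obtain g where g: "flat_product \<epsilon> a b g" "\<And>x. (f has_real_derivative g x) (at x)"
    using flat_product_derivative by blast
  then have "deriv f = g"
    by (intro ext DERIV_imp_deriv)
  with g(1) show ?thesis by simp
qed

lemma flat_product_outside: "flat_product \<epsilon> a b f \<Longrightarrow> x \<notin> {a..b} \<Longrightarrow> f x = 0"
  by (induction rule: flat_product.induct) (auto simp: flat_def)

lemma bump_test_function:
  assumes "\<epsilon> > 0" "0 < a" "b < 1"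
  shows "test_function (bump \<epsilon> a b)"
proof -
  have fp: "flat_product \<epsilon> a b (bump \<epsilon> a b)"
    unfolding bump_def[abs_def] by (rule flat_product.product)
  have n: "flat_product \<epsilon> a b ((deriv ^^ n) (bump \<epsilon> a b))" for n
    by (induction n) (auto simp: fp intro: flat_product_deriv assms)
  have "(deriv ^^ n) (bump \<epsilon> a b) differentiable_on UNIV" for n
    using flat_product_derivative[OF n[of n] assms(1)] unfolding differentiable_on_def
    by (auto simp: real_differentiable_def)
  then show ?thesis
    unfolding test_function_def using flat_product_outside[OF fp] assms by blast
qed

lemma bump_bounds: "\<epsilon> \<ge> 0 \<Longrightarrow> 0 \<le> bump \<epsilon> a b x" "\<epsilon> \<ge> 0 \<Longrightarrow> bump \<epsilon> a b x \<le> 1"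
  by (auto simp: bump_def flat_def intro!: mult_le_one)

lemma bump_pos: "a < x \<Longrightarrow> x < b \<Longrightarrow> bump \<epsilon> a b x > 0"
  by (simp add: bump_def flat_def)

lemma bump_continuous: "\<epsilon> > 0 \<Longrightarrow> continuous_on S (bump \<epsilon> a b)"
proof -
  assume "\<epsilon> > 0"
  then have "isCont (flat \<epsilon> 1) x" for x
    using DERIV_isCont flat_has_derivative by blast
  then have "continuous_on UNIV (flat \<epsilon> 1)"
    by (simp add: continuous_at_imp_continuous_on)
  then have *: "continuous_on S (\<lambda>x. flat \<epsilon> 1 (g x))" if "continuous_on S g" for g
    by (rule continuous_on_compose2[OF _ that]) simp
  show ?thesis
    unfolding bump_def[abs_def]
    by (intro continuous_on_mult * continuous_on_diff continuous_on_id continuous_on_const)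
qed

text \<open>Letting \<epsilon> tend to 0 lifts the bump to 1 inside the interval. The end points
  move inwards so that, for an interval inside (0,1), each approximant is a test function.\<close>

lemma bump_tendsto_indicator:
  "(\<lambda>n. bump (1 / real (Suc n)) (a + 1 / real (Suc n)) (b - 1 / real (Suc n)) x)
    \<longlonglongrightarrow> indicator {a<..<b} x"
proof (cases "x \<in> {a<..<b}")
  case True
  let ?r = "\<lambda>n. 1 / real (Suc n)"
  have r: "?r \<longlonglongrightarrow> 0"
    using LIMSEQ_inverse_real_of_nat by (simp add: inverse_eq_divide)
  have "\<forall>\<^sub>F n in sequentially. ?r n < x - a" "\<forall>\<^sub>F n in sequentially. ?r n < b - x"
    using True order_tendstoD(2)[OF r, of "x - a"] order_tendstoD(2)[OF r, of "b - x"] by auto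
  then have "\<forall>\<^sub>F n in sequentially. exp (- ?r n / (x - (a + ?r n))) * exp (- ?r n / (b - ?r n - x)) =
      bump (?r n) (a + ?r n) (b - ?r n) x"
    by eventually_elim (simp add: bump_def flat_def)
  moreover have "(\<lambda>n. exp (- ?r n / (x - (a + ?r n))) * exp (- ?r n / (b - ?r n - x))) \<longlonglongrightarrow>
      exp (- 0 / (x - (a + 0))) * exp (- 0 / (b - 0 - x))"
    using True by (intro tendsto_intros r) auto
  ultimately show ?thesis
    using True by (simp add: tendsto_cong)
next
  case False
  have "bump (1 / real (Suc n)) (a + 1 / real (Suc n)) (b - 1 / real (Suc n)) x = 0" for n
  proof -
    have "x \<le> a + 1 / real (Suc n) \<or> b - 1 / real (Suc n) \<le> x"
      using False by (auto intro: add_increasing2 order_trans[of _ b] simp: not_less)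
    then show ?thesis by (auto simp: bump_def flat_def)
  qed
  then show ?thesis using False by simp
qed

section \<open>The fundamental lemma of the calculus of variations\<close>

lemma integral_indicator_Ioo_zero:
  fixes f :: "real \<Rightarrow> real"
  assumes f: "integrable unit_leb f"
    and bumps: "\<And>\<epsilon> a b. \<epsilon> > 0 \<Longrightarrow> 0 < a \<Longrightarrow> b < 1 \<Longrightarrow> (LINT x|unit_leb. f x * bump \<epsilon> a b x) = 0"
  shows "(LINT x|unit_leb. indicator {a<..<b} x * f x) = 0"
proof -
  \<comment> \<open>Clipping to [0,1] changes nothing under the integral and makes the shrunken
    bumps admissible in \<open>bumps\<close>.\<close>
  define a' b' where "a' = max 0 a" and "b' = min 1 b"
  let ?\<beta> = "\<lambda>n x. bump (1 / real (Suc n)) (a' + 1 / real (Suc n)) (b' - 1 / real (Suc n)) x"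
  have cm: "?\<beta> n \<in> borel_measurable unit_leb" for n
    by (intro continuous_imp_measurable_on_sets_lebesgue bump_continuous) auto
  have "(\<lambda>n. LINT x|unit_leb. f x * ?\<beta> n x) \<longlonglongrightarrow> (LINT x|unit_leb. f x * indicator {a'<..<b'} x)"
  proof (rule integral_dominated_convergence[where w = "\<lambda>x. norm (f x)"])
    show "(\<lambda>x. f x * ?\<beta> n x) \<in> borel_measurable unit_leb" for n
      using f cm by (intro borel_measurable_times) auto
    show "AE x in unit_leb. norm (f x * ?\<beta> n x) \<le> norm (f x)" for n
      using bump_bounds[of "1 / real (Suc n)"] by (auto simp: abs_mult mult_left_le)
    show "AE x in unit_leb. (\<lambda>n. f x * ?\<beta> n x) \<longlonglongrightarrow> f x * indicator {a'<..<b'} x"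
      by (intro AE_I2 tendsto_mult tendsto_const bump_tendsto_indicator)
    show "(\<lambda>x. f x * indicator {a'<..<b'} x) \<in> borel_measurable unit_leb"
    proof -
      have "{a'<..<b'} \<in> sets unit_leb"
        by (subst sets_restrict_space_iff) (auto simp: a'_def b'_def)
      then show ?thesis
        using f by (intro borel_measurable_times borel_measurable_indicator) auto
    qed
  qed (use f in auto)
  moreover have "(LINT x|unit_leb. f x * ?\<beta> n x) = 0" for n
  proof (rule bumps)
    have "0 \<le> a'" "b' \<le> 1" by (auto simp: a'_def b'_def)
    moreover have "1 / real (Suc n) > 0" by simp
    ultimately show "0 < a' + 1 / real (Suc n)" "b' - 1 / real (Suc n) < 1" by linarith+
  qed simp
  ultimately have "(LINT x|unit_leb. f x * indicator {a'<..<b'} x) = 0"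
    by (simp add: LIMSEQ_const_iff)
  moreover have "(LINT x|unit_leb. indicator {a<..<b} x * f x) = (LINT x|unit_leb. f x * indicator {a'<..<b'} x)"
    by (rule Bochner_Integration.integral_cong) (auto simp: a'_def b'_def indicator_def)
  ultimately show ?thesis by simp
qed

text \<open>Dynkin's argument: open intervals are closed under intersection and generate the Borel
  sets.\<close>

lemma integral_indicator_borel_zero:
  fixes f :: "real \<Rightarrow> real"
  assumes f: "integrable unit_leb f"
    and I: "\<And>a b. (LINT x|unit_leb. indicator {a<..<b} x * f x) = 0"
    and A: "A \<in> sets borel"
  shows "(LINT x|unit_leb. indicator A x * f x) = 0"
proof -
  let ?G = "range (\<lambda>(a, b). {a<..<b::real})"
  have i: "integrable unit_leb (\<lambda>x. indicator A x * f x)" if "A \<in> sets borel" for A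
    using integrable_mult_indicator[of A unit_leb f] that f
  proof -
    have "A \<inter> space unit_leb \<in> sets unit_leb"
      using that by (subst sets_restrict_space_iff) auto
    then have "integrable unit_leb (\<lambda>x. indicator (A \<inter> space unit_leb) x *\<^sub>R f x)"
      using f by (rule integrable_mult_indicator)
    then show ?thesis
      by (rule Bochner_Integration.integrable_cong[THEN iffD1, rotated -1]) (auto simp: indicator_def)
  qed
  have eq: "sets borel = sigma_sets UNIV ?G"
  proof -
    have *: "(\<lambda>(a, b). box a b) = (\<lambda>(a, b). {a<..<b::real})"
      by (auto simp: fun_eq_iff box_real)
    show ?thesis
      by (subst borel_eq_box, subst sets_measure_of, simp, simp only: *)
  qed
  have A': "A \<in> sigma_sets UNIV ?G"
    using A by (simp only: eq)
  have stable: "Int_stable ?G"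
  proof (rule Int_stableI)
    fix X Y assume "X \<in> ?G" "Y \<in> ?G"
    then obtain a b c d where "X = {a<..<b}" "Y = {c<..<d}" by auto
    then have "X \<inter> Y = {max a c<..<min b d}" by auto
    then show "X \<inter> Y \<in> ?G" by auto
  qed
  from stable subset_Pow_Union[of ?G, THEN subset_trans[OF _ Pow_mono[OF subset_UNIV]]] A'
  show ?thesis
  proof (induction rule: sigma_sets_induct_disjoint)
    case (basic A)
    then show ?case using I by auto
  next
    case empty
    show ?case by simp
  next
    case (compl A)
    then have A: "A \<in> sets borel" by (simp only: eq)
    \<comment> \<open>Complements require the total integral to vanish; (0,1) is itself one of the
      generating intervals.\<close>
    have "(LINT x|unit_leb. f x) = (LINT x|unit_leb. indicator {0<..<1} x * f x)"
      by (rule Bochner_Integration.integral_cong) auto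
    then have "(LINT x|unit_leb. f x) = 0"
      by (simp add: I)
    moreover have "(LINT x|unit_leb. indicator (UNIV - A) x * f x) =
        (LINT x|unit_leb. f x - indicator A x * f x)"
      by (rule Bochner_Integration.integral_cong) (auto simp: indicator_def)
    ultimately show ?case
      using compl f i[OF A] by simp
  next
    case (union A)
    then have A: "A n \<in> sets borel" for n by (auto simp: eq)
    have U: "(\<Union>n. A n) \<in> sets borel" using A by auto
    have "(\<lambda>n. LINT x|unit_leb. (\<Sum>i<n. indicator (A i) x) * f x) \<longlonglongrightarrow>
        (LINT x|unit_leb. indicator (\<Union>n. A n) x * f x)"
    proof (rule integral_dominated_convergence[where w = "\<lambda>x. norm (f x)"])
      show "(\<lambda>x. indicator (\<Union>n. A n) x * f x) \<in> borel_measurable unit_leb"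
        using i[OF U] by auto
      have "integrable unit_leb (\<lambda>x. \<Sum>i<n. indicator (A i) x * f x)" for n
        using i[OF A] by (intro Bochner_Integration.integrable_sum)
      then show "(\<lambda>x. (\<Sum>i<n. indicator (A i) x) * f x) \<in> borel_measurable unit_leb" for n
        by (auto simp: sum_distrib_right)
      have s: "(\<Sum>i<n. indicator (A i) x) = (indicator (\<Union>i<n. A i) x :: real)" for n x
        using union(1) by (intro indicator_UN_disjoint[symmetric]) (auto simp: disjoint_family_on_def)
      show "AE x in unit_leb. norm ((\<Sum>i<n. indicator (A i) x) * f x) \<le> norm (f x)" for n
        unfolding s by (auto simp: indicator_def)
      show "AE x in unit_leb. (\<lambda>n. (\<Sum>i<n. indicator (A i) x) * f x) \<longlonglongrightarrow> indicator (\<Union>n. A n) x * f x"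
        unfolding s by (intro AE_I2 tendsto_mult tendsto_const LIMSEQ_indicator_UN)
    qed (use f in auto)
    moreover have "(LINT x|unit_leb. (\<Sum>i<n. indicator (A i) x) * f x) = 0" for n
      unfolding sum_distrib_right
      by (subst Bochner_Integration.integral_sum) (use union(3) i[OF A] in auto)
    ultimately show ?case
      by (simp add: LIMSEQ_const_iff)
  qed
qed

text \<open>A density is determined by its integrals over measurable sets, and a Lebesgue set
  differs from a Borel set by a null set only.\<close>

lemma AE_zero_if_bump_integrals_zero:
  fixes f :: "real \<Rightarrow> real"
  assumes f: "integrable unit_leb f"
    and bumps: "\<And>\<epsilon> a b. \<epsilon> > 0 \<Longrightarrow> 0 < a \<Longrightarrow> b < 1 \<Longrightarrow> (LINT x|unit_leb. f x * bump \<epsilon> a b x) = 0"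
  shows "AE x in unit_leb. f x = 0"
proof (rule density_unique_real[OF f])
  show "integrable unit_leb (\<lambda>x. 0)" by simp
  fix A assume "A \<in> sets unit_leb"
  then have "A \<in> sets lebesgue" and A01: "A \<subseteq> {0<..<1}"
    by (auto simp: sets_restrict_space_iff)
  then obtain S N N' where S: "A = S \<union> N" "N \<subseteq> N'" "N' \<in> null_sets lborel" "S \<in> sets lborel"
    by (auto elim: sets_completionE)
  have "AE x in lebesgue. x \<notin> N'"
    using S(3) by (intro AE_not_in null_sets_completionI)
  then have "AE x in unit_leb. x \<notin> N'"
    by (simp add: AE_restrict_space_iff) (auto elim: eventually_mono)
  then have "AE x in unit_leb. indicator A x * f x = indicator S x * f x"
    by eventually_elim (use S in \<open>auto simp: indicator_def\<close>)
  moreover have "integrable unit_leb (\<lambda>x. indicator A x *\<^sub>R f x)"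
    using \<open>A \<in> sets unit_leb\<close> f by (rule integrable_mult_indicator)
  moreover have "S \<in> sets unit_leb"
    using S A01 by (auto simp: sets_restrict_space_iff)
  then have "integrable unit_leb (\<lambda>x. indicator S x *\<^sub>R f x)"
    using f by (rule integrable_mult_indicator)
  ultimately have "(LINT x|unit_leb. indicator A x * f x) = (LINT x|unit_leb. indicator S x * f x)"
    by (intro integral_cong_AE) auto
  also have "\<dots> = 0"
    using S(4) by (intro integral_indicator_borel_zero[OF f integral_indicator_Ioo_zero[OF f bumps]]) auto
  finally show "(\<integral>x\<in>A. f x \<partial>unit_leb) = (\<integral>x\<in>A. 0 \<partial>unit_leb)"
    by (simp add: set_lebesgue_integral_def)
qed

section \<open>The sine and cosine bases\<close>

lemma measurable_continuous_unit:
  fixes f :: "real \<Rightarrow> 'a::euclidean_space"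
  assumes "continuous_on {0..1} f"
  shows "f \<in> borel_measurable unit_leb"
  by (rule continuous_imp_measurable_on_sets_lebesgue[OF continuous_on_subset[OF assms]]) auto

lemma continuous_unit_bound:
  fixes f :: "real \<Rightarrow> 'a::real_normed_vector"
  assumes "continuous_on {0..1} f"
  obtains M where "M > 0" "\<And>x. x \<in> {0..1} \<Longrightarrow> norm (f x) \<le> M"
proof -
  have "bounded (f ` {0..1})"
    by (intro compact_imp_bounded compact_continuous_image assms) simp
  then show ?thesis
    using that by (auto simp: bounded_pos)
qed

lemma integrable_continuous_unit:
  fixes f :: "real \<Rightarrow> 'a::euclidean_space"
  assumes "continuous_on {0..1} f"
  shows "integrable unit_leb f"
proof -
  obtain M where "\<And>x. x \<in> {0..1} \<Longrightarrow> norm (f x) \<le> M"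
    using continuous_unit_bound[OF assms] by blast
  then show ?thesis
    by (intro finite_measure.integrable_const_bound[OF finite_measure_unit_leb, of _ M]
        measurable_continuous_unit assms AE_I2) auto
qed

lemma square_integrable_continuous: "continuous_on {0..1} f \<Longrightarrow> square_integrable f"
  by (auto simp: square_integrable_def intro!: measurable_continuous_unit integrable_continuous_unit
      continuous_intros)

lemma integrable_scaleR_continuous:
  fixes h :: "real \<Rightarrow> 'a::euclidean_space" and c :: "real \<Rightarrow> real"
  assumes "integrable unit_leb h" "continuous_on {0..1} c"
  shows "integrable unit_leb (\<lambda>x. c x *\<^sub>R h x)"
proof -
  obtain M where M: "\<And>x. x \<in> {0..1} \<Longrightarrow> norm (c x) \<le> M" "M > 0"
    using continuous_unit_bound[OF assms(2)] by blast
  show ?thesis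
  proof (rule Bochner_Integration.integrable_bound)
    show "integrable unit_leb (\<lambda>x. M *\<^sub>R h x)"
      using assms(1) by simp
    show "(\<lambda>x. c x *\<^sub>R h x) \<in> borel_measurable unit_leb"
      using assms(1) measurable_continuous_unit[OF assms(2)]
      by (intro borel_measurable_scaleR) auto
    show "AE x in unit_leb. norm (c x *\<^sub>R h x) \<le> norm (M *\<^sub>R h x)"
      using M by (intro AE_I2) (auto intro!: mult_right_mono)
  qed
qed

lemma integral_unit_eq:
  fixes f :: "real \<Rightarrow> 'a::euclidean_space"
  assumes "integrable unit_leb f"
  shows "integral\<^sup>L unit_leb f = integral {0..1} f"
  using lebesgue_integral_eq_integral[OF assms] by (simp add: integral_open_interval_real)

lemma integral_unit_FTC:
  fixes f :: "real \<Rightarrow> 'a::euclidean_space"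
  assumes "\<And>x. x \<in> {0..1} \<Longrightarrow> (F has_vector_derivative f x) (at x within {0..1})"
    and "continuous_on {0..1} f"
  shows "integral\<^sup>L unit_leb f = F 1 - F 0"
  using fundamental_theorem_of_calculus[of 0 1 F f] assms
  by (simp add: integral_unit_eq integrable_continuous_unit integral_unique)

lemma integral_unit_FTC_real:
  fixes f :: "real \<Rightarrow> real"
  assumes "\<And>x. (F has_real_derivative f x) (at x)" and "continuous_on {0..1} f"
  shows "integral\<^sup>L unit_leb f = F 1 - F 0"
proof (rule integral_unit_FTC[OF _ assms(2)])
  show "(F has_vector_derivative f x) (at x within {0..1})" for x
    using assms(1)[of x] unfolding has_real_derivative_iff_has_vector_derivative
    by (rule has_vector_derivative_at_within)
qed

text \<open>Differentiation exchanges the sine and cosine systems: \<open>flip\<close> names the new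
  system and \<open>dsign\<close> the sign that appears.\<close>

definition flip :: "boundary_type \<Rightarrow> boundary_type" where
  "flip bc = (case bc of Dirichlet \<Rightarrow> Neumann | Neumann \<Rightarrow> Dirichlet)"

definition dsign :: "boundary_type \<Rightarrow> real" where
  "dsign bc = (case bc of Dirichlet \<Rightarrow> 1 | Neumann \<Rightarrow> - 1)"

text \<open>The index starts at \<open>0\<close> in both cases, so the first sine vanishes.\<close>

definition trig :: "boundary_type \<Rightarrow> nat \<Rightarrow> real \<Rightarrow> real" where
  "trig bc n x = (case bc of Dirichlet \<Rightarrow> sqrt 2 * sin (pi * real n * x)
     | Neumann \<Rightarrow> if n = 0 then 1 else sqrt 2 * cos (pi * real n * x))"

lemma flip_simps [simp]: "flip Dirichlet = Neumann" "flip Neumann = Dirichlet" "flip (flip bc) = bc"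
  by (auto simp: flip_def split: boundary_type.split)

lemma dsign_simps [simp]: "dsign Dirichlet = 1" "dsign Neumann = - 1" "dsign (flip bc) = - dsign bc"
    "dsign bc * dsign bc = 1" "\<bar>dsign bc\<bar> = 1"
  by (auto simp: dsign_def flip_def split: boundary_type.split)

lemma trig_deriv: "(trig bc n has_real_derivative dsign bc * (pi * real n) * trig (flip bc) n x) (at x)"
proof (cases bc)
  case Dirichlet
  then show ?thesis
    unfolding trig_def[abs_def] by (auto intro!: derivative_eq_intros)
next
  case Neumann
  then show ?thesis
    unfolding trig_def[abs_def] by (cases "n = 0") (auto intro!: derivative_eq_intros)
qed

lemma continuous_trig [continuous_intros]: "continuous_on S (trig bc n)"
  by (meson DERIV_isCont continuous_at_imp_continuous_on trig_deriv)

lemma sin_pi_nat: "sin (pi * real n) = 0"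
  by (metis mult.commute sin_npi)

lemma trig_ends [simp]: "trig Dirichlet n 0 = 0" "trig Dirichlet n 1 = 0"
  by (auto simp: trig_def sin_pi_nat)

lemma trig_Dirichlet_0 [simp]: "trig Dirichlet 0 x = 0"
  by (simp add: trig_def)

text \<open>One of the two factors is a sine, which vanishes at both ends; this removes the boundary
  terms in the integrals below.\<close>

lemma trig_flip_product_ends:
  assumes "y = 0 \<or> y = 1"
  shows "trig (flip bc) m y * trig bc n y = 0"
  using assms by (cases bc) auto

text \<open>The Wronskian \<open>?F\<close> vanishes at both ends, and its derivative is
  \<open>?c\<close> times the product of the two functions.\<close>

lemma trig_orthogonal:
  assumes "m \<noteq> n"
  shows "(LINT x|unit_leb. trig bc m x * trig bc n x) = 0"
proof -
  let ?d = "\<lambda>m x. dsign bc * (pi * real m) * trig (flip bc) m x"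
  let ?F = "\<lambda>x. ?d m x * trig bc n x - trig bc m x * ?d n x"
  let ?c = "pi\<^sup>2 * ((real n)\<^sup>2 - (real m)\<^sup>2)"
  have d2: "((\<lambda>x. ?d m x) has_real_derivative - (pi * real m)\<^sup>2 * trig bc m x) (at x)" for m x
  proof -
    have "((\<lambda>x. ?d m x) has_real_derivative
        dsign bc * (pi * real m) * (dsign (flip bc) * (pi * real m) * trig bc m x)) (at x)"
      using trig_deriv[of "flip bc" m x] by (intro DERIV_cmult) simp
    also have "dsign bc * (pi * real m) * (dsign (flip bc) * (pi * real m) * trig bc m x)
        = - (dsign bc * dsign bc) * (pi * real m)\<^sup>2 * trig bc m x"
      by (simp add: power2_eq_square del: dsign_simps(4))
    finally show ?thesis by simp
  qed
  have "(?F has_real_derivative ?c * (trig bc m x * trig bc n x)) (at x)" for x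
  proof -
    have "(?F has_real_derivative (- (pi * real m)\<^sup>2 * trig bc m x) * trig bc n x + ?d n x * ?d m x
        - (?d m x * ?d n x + (- (pi * real n)\<^sup>2 * trig bc n x) * trig bc m x)) (at x)"
      by (intro DERIV_diff DERIV_mult d2 trig_deriv)
    then show ?thesis
      by (rule DERIV_cong) (simp add: algebra_simps power2_eq_square)
  qed
  then have "(LINT x|unit_leb. ?c * (trig bc m x * trig bc n x)) = ?F 1 - ?F 0"
    by (rule integral_unit_FTC_real) (intro continuous_intros)
  also have "\<dots> = 0"
    using trig_flip_product_ends[of 1 bc m n] trig_flip_product_ends[of 0 bc m n]
      trig_flip_product_ends[of 1 bc n m] trig_flip_product_ends[of 0 bc n m]
    by (auto simp: algebra_simps)
  finally have "?c * (LINT x|unit_leb. trig bc m x * trig bc n x) = 0"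
    by simp
  moreover have "?c \<noteq> 0"
    using assms by (simp add: power2_eq_iff)
  ultimately show ?thesis by simp
qed

text \<open>The product of the sine and the cosine has derivative proportional to the difference of
  their squares, so both squares have the same integral; their sum is constantly 2.\<close>

lemma trig_normalized:
  assumes "n \<noteq> 0"
  shows "(LINT x|unit_leb. (trig bc n x)\<^sup>2) = 1"
proof -
  have i: "integrable unit_leb (\<lambda>x. (trig bc n x)\<^sup>2)" for bc
    by (intro integrable_continuous_unit continuous_intros)
  let ?F = "\<lambda>x. trig bc n x * trig (flip bc) n x"
  let ?c = "dsign bc * (pi * real n)"
  have "(?F has_real_derivative ?c * ((trig (flip bc) n x)\<^sup>2 - (trig bc n x)\<^sup>2)) (at x)" for x
  proof -
    have "(?F has_real_derivative (dsign bc * (pi * real n) * trig (flip bc) n x) * trig (flip bc) n x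
        + (dsign (flip bc) * (pi * real n) * trig (flip (flip bc)) n x) * trig bc n x) (at x)"
      by (intro DERIV_mult trig_deriv)
    then show ?thesis
      by (rule DERIV_cong) (simp add: algebra_simps power2_eq_square)
  qed
  then have "(LINT x|unit_leb. ?c * ((trig (flip bc) n x)\<^sup>2 - (trig bc n x)\<^sup>2)) = ?F 1 - ?F 0"
    by (rule integral_unit_FTC_real) (intro continuous_intros)
  also have "\<dots> = 0"
    using trig_flip_product_ends[of 1 bc n n] trig_flip_product_ends[of 0 bc n n]
    by auto
  finally have eq: "(LINT x|unit_leb. (trig (flip bc) n x)\<^sup>2) = (LINT x|unit_leb. (trig bc n x)\<^sup>2)"
    using assms i by (auto simp: dsign_def split: boundary_type.splits)
  have "(trig (flip bc) n x)\<^sup>2 + (trig bc n x)\<^sup>2 = 2" for x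
  proof -
    have "(trig (flip bc) n x)\<^sup>2 + (trig bc n x)\<^sup>2 = 2 * ((sin (pi * real n * x))\<^sup>2 + (cos (pi * real n * x))\<^sup>2)"
      unfolding distrib_left using assms by (cases bc) (simp_all add: trig_def power_mult_distrib)
    then show ?thesis by simp
  qed
  then have "(LINT x|unit_leb. (trig (flip bc) n x)\<^sup>2 + (trig bc n x)\<^sup>2) = 2"
    using measure_unit_leb by simp
  then show ?thesis
    using i eq by simp
qed

text \<open>y = cos(pi x) maps [0,1] homeomorphically onto [-1,1], so a bump is a continuous
  function of y and, by Stone-Weierstrass, a uniform limit of polynomials in y, each of which
  integrates to 0 against h.\<close>

lemma AE_zero_if_cos_power_integrals_zero:
  fixes h :: "real \<Rightarrow> real"
  assumes h: "integrable unit_leb h"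
    and z: "\<And>k. (LINT x|unit_leb. h x * cos (pi * x) ^ k) = 0"
  shows "AE x in unit_leb. h x = 0"
proof (rule AE_zero_if_bump_integrals_zero[OF h])
  fix \<epsilon> a b :: real assume \<epsilon>: "\<epsilon> > 0"
  let ?\<beta> = "bump \<epsilon> a b"
  let ?J = "LINT x|unit_leb. h x * ?\<beta> x"
  let ?C = "LINT x|unit_leb. norm (h x)"
  have cont: "continuous_on {-1..1} (\<lambda>y. ?\<beta> (arccos y / pi))"
    by (rule continuous_on_compose2[OF bump_continuous[OF \<epsilon>, of UNIV]])
      (auto intro!: continuous_intros)
  have bound: "\<bar>?J\<bar> \<le> d * ?C" if d: "d > 0" for d
  proof -
    obtain g where g: "real_polynomial_function g"
      "\<And>y. y \<in> {-1..1} \<Longrightarrow> \<bar>?\<beta> (arccos y / pi) - g y\<bar> < d"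
      using Stone_Weierstrass_real_polynomial_function[OF compact_Icc cont d] by blast
    obtain c n where gc: "g = (\<lambda>y. \<Sum>i\<le>(n::nat). c i * y ^ i)"
      using real_polynomial_function_imp_sum[OF g(1)] by blast
    have gcont: "continuous_on {0..1} (\<lambda>x. g (cos (pi * x)))"
      unfolding gc by (intro continuous_intros)
    have hi: "integrable unit_leb (\<lambda>x. h x * f x)" if "continuous_on {0..1} f" for f :: "real \<Rightarrow> real"
      using integrable_scaleR_continuous[OF h that] by (simp add: mult.commute)
    have "(LINT x|unit_leb. h x * g (cos (pi * x))) = (LINT x|unit_leb. (\<Sum>i\<le>n. c i * (h x * cos (pi * x) ^ i)))"
      by (simp add: gc sum_distrib_left mult_ac)
    also have "\<dots> = (\<Sum>i\<le>n. c i * (LINT x|unit_leb. h x * cos (pi * x) ^ i))"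
      by (subst Bochner_Integration.integral_sum)
        (auto intro!: integrable_mult_right hi continuous_intros)
    also have "\<dots> = 0"
      by (simp add: z)
    finally have "?J = ?J - (LINT x|unit_leb. h x * g (cos (pi * x)))"
      by simp
    also have "\<dots> = (LINT x|unit_leb. h x * ?\<beta> x - h x * g (cos (pi * x)))"
      by (intro Bochner_Integration.integral_diff[symmetric] hi gcont bump_continuous \<epsilon>)
    finally have "\<bar>?J\<bar> = \<bar>LINT x|unit_leb. h x * ?\<beta> x - h x * g (cos (pi * x))\<bar>"
      by simp
    also have "\<dots> \<le> (LINT x|unit_leb. d * norm (h x))"
      unfolding real_norm_def[symmetric]
    proof (rule order_trans[OF integral_norm_bound integral_mono])
      show "integrable unit_leb (\<lambda>x. norm (h x * ?\<beta> x - h x * g (cos (pi * x))))"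
        by (intro integrable_norm Bochner_Integration.integrable_diff hi gcont bump_continuous \<epsilon>)
      show "integrable unit_leb (\<lambda>x. d * norm (h x))"
        using h by simp
      fix x assume "x \<in> space unit_leb"
      then have x: "0 < x" "x < 1" by auto
      then have "0 \<le> pi * x" "pi * x \<le> pi" by auto
      then have "arccos (cos (pi * x)) / pi = x"
        by (simp add: arccos_cos)
      then have "\<bar>?\<beta> x - g (cos (pi * x))\<bar> \<le> d"
        using g(2)[of "cos (pi * x)"] by simp
      then show "norm (h x * ?\<beta> x - h x * g (cos (pi * x))) \<le> d * norm (h x)"
        using mult_right_mono[of "\<bar>?\<beta> x - g (cos (pi * x))\<bar>" d "\<bar>h x\<bar>"]
        by (simp add: abs_mult[symmetric] algebra_simps)
    qed
    finally show ?thesis by simp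
  qed
  have C: "?C \<ge> 0" by simp
  have aux: "r / (c + 1) * c \<le> r" if "r > 0" "c \<ge> 0" for r c :: real
    using that by (simp add: field_simps)
  have "\<bar>?J\<bar> \<le> 0 + r" if "r > 0" for r
  proof -
    \<comment> \<open>The summand 1 keeps the tolerance well defined when the L1 norm of h is
      0.\<close>
    have "\<bar>?J\<bar> \<le> r / (?C + 1) * ?C"
    proof (rule bound)
      show "0 < r / (?C + 1)"
        using that C by (intro divide_pos_pos) linarith+
    qed
    also have "\<dots> \<le> r"
      by (rule aux[OF that C])
    finally show ?thesis by simp
  qed
  then have "\<bar>?J\<bar> \<le> 0"
    by (rule field_le_epsilon)
  then show "?J = 0" by simp
qed

text \<open>The recurrence holds for \<open>cos (\<pi> n x)\<close> and \<open>sin (\<pi> n x)\<close>, \<open>n\<close> an integer.\<close>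

lemma cos_power_integral_zero:
  fixes g :: "real \<Rightarrow> real" and F :: "int \<Rightarrow> real \<Rightarrow> real"
  assumes g: "integrable unit_leb g" and cont: "\<And>n. continuous_on {0..1} (F n)"
    and rec: "\<And>n x. cos (pi * x) * F n x = (1/2) * F (n + 1) x + (1/2) * F (n - 1) x"
    and z: "\<And>n. (LINT x|unit_leb. g x * F n x) = 0"
  shows "(LINT x|unit_leb. g x * (cos (pi * x) ^ k * F n x)) = 0"
proof (induction k arbitrary: n)
  case 0
  then show ?case by (simp add: z)
next
  case (Suc k)
  have i: "integrable unit_leb (\<lambda>x. g x * (cos (pi * x) ^ k * F n x))" for n
    using integrable_scaleR_continuous[OF g, of "\<lambda>x. cos (pi * x) ^ k * F n x"]
    by (simp add: mult.commute cont continuous_intros)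
  have "g x * (cos (pi * x) ^ Suc k * F n x) = (1/2) * (g x * (cos (pi * x) ^ k * F (n + 1) x))
      + (1/2) * (g x * (cos (pi * x) ^ k * F (n - 1) x))" for x
  proof -
    have "g x * (cos (pi * x) ^ Suc k * F n x) = g x * (cos (pi * x) ^ k * (cos (pi * x) * F n x))"
      by simp
    then show ?thesis
      unfolding rec by (simp only: distrib_left mult_ac)
  qed
  then have "(LINT x|unit_leb. g x * (cos (pi * x) ^ Suc k * F n x)) =
      (LINT x|unit_leb. (1/2) * (g x * (cos (pi * x) ^ k * F (n + 1) x))
      + (1/2) * (g x * (cos (pi * x) ^ k * F (n - 1) x)))"
    by presburger
  also have "\<dots> = 0"
    by (subst Bochner_Integration.integral_add)
      (use Suc.IH[of "n + 1"] Suc.IH[of "n - 1"] in \<open>auto intro!: integrable_mult_right i\<close>)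
  finally show ?case .
qed

text \<open>For cosines, frequency 0 directly gives the moments of g in cos(pi x). For sines,
  frequency 1 gives those of g(x) sin(pi x), and sin(pi x) is positive inside the interval. Integer
  frequencies reduce to natural ones by parity.\<close>

lemma trig_total_real:
  fixes g :: "real \<Rightarrow> real"
  assumes g: "integrable unit_leb g" and z: "\<And>n. (LINT x|unit_leb. g x * trig bc n x) = 0"
  shows "AE x in unit_leb. g x = 0"
proof (cases bc)
  case Neumann
  have "(LINT x|unit_leb. g x * (cos (pi * x) ^ k * cos (pi * of_int n * x))) = 0" for k and n :: int
  proof (rule cos_power_integral_zero[OF g])
    fix n :: int
    define m where "m = nat \<bar>n\<bar>"
    have "cos (pi * of_int n * x) = cos (pi * real m * x)" for x
      by (cases "n \<ge> 0") (auto simp: m_def)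
    then have "g x * cos (pi * of_int n * x) = (if m = 0 then 1 else 1 / sqrt 2) * (g x * trig Neumann m x)" for x
      by (simp add: trig_def)
    then show "(LINT x|unit_leb. g x * cos (pi * of_int n * x)) = 0"
      using z[of m] Neumann by (simp only: integral_mult_right_zero mult_zero_right)
  qed (auto intro!: continuous_intros simp: distrib_left right_diff_distrib distrib_right left_diff_distrib
      cos_add cos_diff)
  from this[of _ 0] show ?thesis
    by (intro AE_zero_if_cos_power_integrals_zero g) simp
next
  case Dirichlet
  have "(LINT x|unit_leb. g x * (cos (pi * x) ^ k * sin (pi * of_int n * x))) = 0" for k and n :: int
  proof (rule cos_power_integral_zero[OF g])
    fix n :: int
    define m where "m = nat \<bar>n\<bar>"
    have "sin (pi * of_int n * x) = sgn n * sin (pi * real m * x)" for x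
      by (cases n "0 :: int" rule: linorder_cases) (auto simp: m_def)
    then have "g x * sin (pi * of_int n * x) = (sgn n / sqrt 2) * (g x * trig Dirichlet m x)" for x
      by (simp add: trig_def)
    then show "(LINT x|unit_leb. g x * sin (pi * of_int n * x)) = 0"
      using z[of m] Dirichlet by (simp only: integral_mult_right_zero mult_zero_right)
  qed (auto intro!: continuous_intros simp: distrib_left right_diff_distrib distrib_right left_diff_distrib
      sin_add sin_diff)
  from this[of _ 1] have "(LINT x|unit_leb. (g x * sin (pi * x)) * cos (pi * x) ^ k) = 0" for k
    by (simp add: mult_ac)
  moreover have "integrable unit_leb (\<lambda>x. g x * sin (pi * x))"
    using integrable_scaleR_continuous[OF g, of "\<lambda>x. sin (pi * x)"]
    by (simp add: mult.commute continuous_intros)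
  ultimately have "AE x in unit_leb. g x * sin (pi * x) = 0"
    by (intro AE_zero_if_cos_power_integrals_zero)
  moreover have "AE x in unit_leb. sin (pi * x) \<noteq> 0"
  proof (rule AE_I2)
    fix x assume "x \<in> space unit_leb"
    then have "0 < pi * x" "pi * x < pi" by auto
    then have "sin (pi * x) > 0" by (rule sin_gt_zero)
    then show "sin (pi * x) \<noteq> 0" by simp
  qed
  ultimately show ?thesis
    by eventually_elim simp
qed

definition L2_real :: "(real \<Rightarrow> real) \<Rightarrow> L2" where
  "L2_real \<phi> = L2_of (\<lambda>x. complex_of_real (\<phi> x))"

lemma cinner_L2_real:
  assumes "continuous_on {0..1} \<phi>"
  shows "cinner u (L2_real \<phi>) = (LINT x|unit_leb. \<phi> x *\<^sub>R fun_of u x)"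
proof -
  have s: "square_integrable (\<lambda>x. complex_of_real (\<phi> x))"
    using assms by (intro square_integrable_continuous continuous_intros)
  have "cinner u (L2_real \<phi>) = (LINT x|unit_leb. fun_of u x * cnj (complex_of_real (\<phi> x)))"
    unfolding L2_real_def
    by (rule cinner_cong_AE[OF square_integrable_fun_of _ s fun_of_L2_of[OF s]]) simp
  then show ?thesis
    by (simp add: scaleR_conv_of_real mult.commute)
qed

lemma cinner_L2_of_real:
  assumes "continuous_on {0..1} f" "continuous_on {0..1} \<phi>"
  shows "cinner (L2_of f) (L2_real \<phi>) = (LINT x|unit_leb. \<phi> x *\<^sub>R f x)"
  unfolding L2_real_def using assms
  by (subst cinner_L2_of) (auto intro!: square_integrable_continuous continuous_intros
      simp: scaleR_conv_of_real mult.commute)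

lemma cinner_L2_real_real:
  assumes "continuous_on {0..1} \<psi>" "continuous_on {0..1} \<phi>"
  shows "cinner (L2_real \<psi>) (L2_real \<phi>) = complex_of_real (LINT x|unit_leb. \<phi> x * \<psi> x)"
  unfolding L2_real_def[of \<psi>] using assms
  by (subst cinner_L2_of_real)
    (auto intro!: continuous_intros simp: scaleR_conv_of_real simp flip: integral_complex_of_real)

lemma integrable_fun_of: "integrable unit_leb (fun_of u)"
  using L1_le_norm(1)[of u] by (simp add: integrable_norm_iff)

definition basis :: "boundary_type \<Rightarrow> nat \<Rightarrow> L2" where
  "basis bc n = L2_real (trig bc n)"

lemma basis_Dirichlet_0: "basis Dirichlet 0 = 0"
  by (simp add: basis_def L2_real_def zero_L2_def)

lemma norm_basis: "bc = Neumann \<or> n \<noteq> 0 \<Longrightarrow> norm (basis bc n) = 1"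
proof -
  assume *: "bc = Neumann \<or> n \<noteq> 0"
  have "(LINT x|unit_leb. (trig bc n x)\<^sup>2) = 1"
  proof (cases "n = 0")
    case True
    then show ?thesis using * measure_unit_leb by (simp add: trig_def)
  qed (rule trig_normalized)
  then have "complex_of_real ((norm (basis bc n))\<^sup>2) = 1"
    unfolding cinner_self[symmetric] basis_def
    by (simp add: cinner_L2_real_real continuous_trig power2_eq_square)
  then have "(norm (basis bc n))\<^sup>2 = 1\<^sup>2"
    by (metis of_real_eq_1_iff power_one)
  then show ?thesis
    by (simp only: power2_eq_iff_nonneg norm_ge_zero zero_le_one)
qed

interpretation trig: cbasis "basis bc" for bc
proof
  show "cinner (basis bc m) (basis bc n) = 0" if "m \<noteq> n" for m n
    using trig_orthogonal[of n m] that by (simp add: basis_def cinner_L2_real_real continuous_trig)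
  show "norm (basis bc n) = 1" if "basis bc n \<noteq> 0" for n
    using that basis_Dirichlet_0 by (intro norm_basis) (cases bc; cases n; auto)
next
  fix u assume z: "\<And>n. cinner u (basis bc n) = 0"
  have i: "integrable unit_leb (\<lambda>x. trig bc n x *\<^sub>R fun_of u x)" for n
    by (intro integrable_scaleR_continuous integrable_fun_of continuous_trig)
  have 0: "(LINT x|unit_leb. trig bc n x *\<^sub>R fun_of u x) = 0" for n
    using z[of n] by (simp add: basis_def cinner_L2_real continuous_trig)
  have "(LINT x|unit_leb. Re (fun_of u x) * trig bc n x) = 0" for n
    using integral_bounded_linear[OF bounded_linear_Re i, of n] 0[of n] by (simp add: mult.commute)
  then have "AE x in unit_leb. Re (fun_of u x) = 0"
    by (intro trig_total_real integrable_Re integrable_fun_of)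
  moreover have "(LINT x|unit_leb. Im (fun_of u x) * trig bc n x) = 0" for n
    using integral_bounded_linear[OF bounded_linear_Im i, of n] 0[of n] by (simp add: mult.commute)
  then have "AE x in unit_leb. Im (fun_of u x) = 0"
    by (intro trig_total_real integrable_Im integrable_fun_of)
  ultimately have "AE x in unit_leb. fun_of u x = fun_of 0 x"
    using fun_of_zero by eventually_elim (simp add: complex_eq_iff)
  then show "u = 0"
    by (rule L2_eqI)
qed

section \<open>Weak derivatives\<close>

lemma test_function_deriv:
  assumes "test_function \<phi>"
  shows "(\<phi> has_real_derivative deriv \<phi> x) (at x)"
proof -
  have "(deriv ^^ 0) \<phi> differentiable_on UNIV"
    using assms unfolding test_function_def by blast
  then have "\<phi> differentiable (at x)"
    by (simp add: differentiable_on_def)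
  then show ?thesis
    by (simp add: DERIV_deriv_iff_real_differentiable)
qed

lemma test_function_support:
  assumes "test_function \<phi>"
  shows "\<exists>a b. 0 < a \<and> b < 1 \<and> (\<forall>x. x \<notin> {a..b} \<longrightarrow> \<phi> x = 0)"
  using assms unfolding test_function_def by blast

lemma test_function_step:
  assumes "test_function \<phi>"
  shows "test_function (deriv \<phi>)"
proof -
  obtain a b where ab: "0 < a" "b < 1" "\<And>x. x \<notin> {a..b} \<Longrightarrow> \<phi> x = 0"
    using test_function_support[OF assms] by blast
  have "deriv \<phi> x = 0" if "x \<notin> {a..b}" for x
  proof (rule DERIV_imp_deriv)
    show "(\<phi> has_real_derivative 0) (at x)"
      by (rule has_field_derivative_transform_within_open[of "\<lambda>_. 0" 0 x "- {a..b}"])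
        (use that ab(3) in auto)
  qed
  moreover have "(deriv ^^ n) (deriv \<phi>) differentiable_on UNIV" for n
  proof -
    have "(deriv ^^ Suc n) \<phi> differentiable_on UNIV"
      using assms unfolding test_function_def by blast
    then show ?thesis
      by (simp add: funpow_swap1)
  qed
  ultimately show ?thesis
    unfolding test_function_def using ab(1,2) by blast
qed

lemma test_function_funpow: "test_function \<phi> \<Longrightarrow> test_function ((deriv ^^ n) \<phi>)"
  by (induction n) (auto intro: test_function_step)

lemma test_function_continuous: "test_function \<phi> \<Longrightarrow> continuous_on S \<phi>"
  by (meson DERIV_isCont continuous_at_imp_continuous_on test_function_deriv)

lemma test_function_ends: "test_function \<phi> \<Longrightarrow> \<phi> 0 = 0 \<and> \<phi> 1 = 0"
  using test_function_support[of \<phi>] by force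

lemma test_function_diff_scale:
  assumes f: "test_function f" and g: "test_function g"
  shows "test_function (\<lambda>x. f x - c * g x)"
proof -
  have eq: "(deriv ^^ n) (\<lambda>x. f x - c * g x) = (\<lambda>x. (deriv ^^ n) f x - c * (deriv ^^ n) g x)" for n
  proof (induction n)
    case (Suc n)
    have "deriv (\<lambda>x. (deriv ^^ n) f x - c * (deriv ^^ n) g x) x
        = deriv ((deriv ^^ n) f) x - c * deriv ((deriv ^^ n) g) x" for x
      by (intro DERIV_imp_deriv DERIV_diff DERIV_cmult test_function_deriv test_function_funpow f g)
    then show ?case
      by (simp add: Suc fun_eq_iff)
  qed simp
  obtain a b where ab: "0 < a" "b < 1" "\<And>x. x \<notin> {a..b} \<Longrightarrow> f x = 0"
    using test_function_support[OF f] by blast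
  obtain a' b' where ab': "0 < a'" "b' < 1" "\<And>x. x \<notin> {a'..b'} \<Longrightarrow> g x = 0"
    using test_function_support[OF g] by blast
  have "(deriv ^^ n) (\<lambda>x. f x - c * g x) differentiable_on UNIV" for n
  proof -
    have "((\<lambda>x. (deriv ^^ n) f x - c * (deriv ^^ n) g x) has_real_derivative
        deriv ((deriv ^^ n) f) x - c * deriv ((deriv ^^ n) g) x) (at x)" for x
      by (intro DERIV_diff DERIV_cmult test_function_deriv test_function_funpow f g)
    then show ?thesis
      unfolding eq differentiable_on_def by (auto simp: real_differentiable_def)
  qed
  moreover have "f x - c * g x = 0" if "x \<notin> {min a a'..max b b'}" for x
  proof -
    have "x \<notin> {a..b}" "x \<notin> {a'..b'}"
      using that by auto
    then show ?thesis
      using ab(3) ab'(3) by simp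
  qed
  moreover have "0 < min a a'" "max b b' < 1"
    using ab ab' by auto
  ultimately show ?thesis
    unfolding test_function_def by blast
qed

text \<open>Zero mean is exactly what makes the primitive vanish again to the right of the
  support.\<close>

lemma test_antiderivative:
  assumes \<eta>: "test_function \<eta>" and z: "(LINT x|unit_leb. \<eta> x) = 0"
  shows "\<exists>\<phi>. test_function \<phi> \<and> deriv \<phi> = \<eta>"
proof -
  obtain a b where ab: "0 < a" "b < 1" "\<And>x. x \<notin> {a..b} \<Longrightarrow> \<eta> x = 0"
    using test_function_support[OF \<eta>] by blast
  have cont: "continuous_on {0..1} \<eta>"
    using \<eta> by (rule test_function_continuous)
  have int: "\<eta> integrable_on {c..d}" for c d
    using \<eta> by (intro integrable_continuous_real test_function_continuous)
  define \<phi> where "\<phi> x = (if x \<in> {0..1} then integral {0..x} \<eta> else 0)" for x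
  have out: "\<phi> x = 0" if "x \<notin> {a..b}" for x
  proof (cases "x \<in> {0..1}")
    case True
    have "x < a \<or> x > b" using that by auto
    then show ?thesis
    proof
      assume 1: "x < a"
      have "integral {0..x} \<eta> = integral {0..x} (\<lambda>_. 0)"
        using 1 ab(3) by (intro integral_cong) auto
      then show ?thesis by (simp add: \<phi>_def)
    next
      assume 2: "b < x"
      have "integral {x..1} \<eta> = integral {x..1} (\<lambda>_. 0)"
        using 2 ab(3) by (intro integral_spike[of "{x}"]) (auto intro!: ab(3))
      moreover have "integral {0..x} \<eta> + integral {x..1} \<eta> = integral {0..1} \<eta>"
        using True int by (intro Henstock_Kurzweil_Integration.integral_combine) auto
      moreover have "integral {0..1} \<eta> = 0"
        using z integral_unit_eq[OF integrable_continuous_unit[OF cont]] by simp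
      ultimately show ?thesis by (simp add: \<phi>_def)
    qed
  qed (auto simp: \<phi>_def)
  have der: "(\<phi> has_real_derivative \<eta> x) (at x)" for x
  proof (cases "x \<in> {a..b}")
    case True
    then have x: "x \<in> {0<..<1}" using ab by auto
    have "((\<lambda>x. integral {0..x} \<eta>) has_real_derivative \<eta> x) (at x within {0..1})"
      using x by (intro integral_has_real_derivative cont) auto
    then have "((\<lambda>x. integral {0..x} \<eta>) has_real_derivative \<eta> x) (at x)"
      using x at_within_Icc_at[of 0 x 1] by simp
    then show ?thesis
      by (rule has_field_derivative_transform_within_open[of _ _ _ "{0<..<1}"])
        (use x in \<open>auto simp: \<phi>_def\<close>)
  next
    case False
    have "(\<phi> has_real_derivative 0) (at x)"
      by (rule has_field_derivative_transform_within_open[of "\<lambda>_. 0" 0 x "- {a..b}"])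
        (use False out in auto)
    then show ?thesis using ab(3)[OF False] by simp
  qed
  then have d: "deriv \<phi> = \<eta>"
    by (intro ext DERIV_imp_deriv)
  have "(deriv ^^ n) \<phi> differentiable_on UNIV" for n
  proof (cases n)
    case 0
    then show ?thesis
      using der by (auto simp: differentiable_on_def real_differentiable_def)
  next
    case (Suc m)
    then have "(deriv ^^ n) \<phi> = (deriv ^^ m) \<eta>"
      by (simp add: funpow_swap1 d)
    then show ?thesis
      using \<eta> by (simp add: test_function_def)
  qed
  then have "test_function \<phi>"
    unfolding test_function_def using ab(1,2) out by blast
  with d show ?thesis by blast
qed

section \<open>Uniqueness, linearity and limits of weak derivatives\<close>

lemma is_weak_deriv_iff:
  "is_weak_deriv j u w \<longleftrightarrow> (\<forall>\<phi>. test_function \<phi> \<longrightarrow>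
     cinner u (L2_real ((deriv ^^ j) \<phi>)) = (-1) ^ j * cinner w (L2_real \<phi>))"
  unfolding is_weak_deriv_def
  by (intro all_cong) (simp add: cinner_L2_real test_function_continuous test_function_funpow
      scaleR_conv_of_real mult.commute)

lemma L2_zero_if_bumps:
  assumes "\<And>\<epsilon> a b. \<epsilon> > 0 \<Longrightarrow> 0 < a \<Longrightarrow> b < 1 \<Longrightarrow> cinner u (L2_real (bump \<epsilon> a b)) = 0"
  shows "u = 0"
proof -
  have i: "integrable unit_leb (\<lambda>x. bump \<epsilon> a b x *\<^sub>R fun_of u x)" if "\<epsilon> > 0" for \<epsilon> a b
    by (intro integrable_scaleR_continuous integrable_fun_of bump_continuous that)
  have z: "(LINT x|unit_leb. bump \<epsilon> a b x *\<^sub>R fun_of u x) = 0" if "\<epsilon> > 0" "0 < a" "b < 1" for \<epsilon> a b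
    using assms[OF that] that by (simp add: cinner_L2_real bump_continuous)
  have "AE x in unit_leb. Re (fun_of u x) = 0"
  proof (rule AE_zero_if_bump_integrals_zero)
    show "(LINT x|unit_leb. Re (fun_of u x) * bump \<epsilon> a b x) = 0" if "\<epsilon> > 0" "0 < a" "b < 1" for \<epsilon> a b
      using integral_bounded_linear[OF bounded_linear_Re i[OF that(1)], of a b] z[OF that]
      by (simp add: mult.commute)
  qed (intro integrable_Re integrable_fun_of)
  moreover have "AE x in unit_leb. Im (fun_of u x) = 0"
  proof (rule AE_zero_if_bump_integrals_zero)
    show "(LINT x|unit_leb. Im (fun_of u x) * bump \<epsilon> a b x) = 0" if "\<epsilon> > 0" "0 < a" "b < 1" for \<epsilon> a b
      using integral_bounded_linear[OF bounded_linear_Im i[OF that(1)], of a b] z[OF that]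
      by (simp add: mult.commute)
  qed (intro integrable_Im integrable_fun_of)
  ultimately have "AE x in unit_leb. fun_of u x = fun_of 0 x"
    using fun_of_zero by eventually_elim (simp add: complex_eq_iff)
  then show "u = 0"
    by (rule L2_eqI)
qed

lemma weak_deriv_unique:
  assumes "is_weak_deriv j u w" "is_weak_deriv j u w'"
  shows "w = w'"
proof -
  have "cinner (w - w') (L2_real (bump \<epsilon> a b)) = 0" if "\<epsilon> > 0" "0 < a" "b < 1" for \<epsilon> a b
    using assms bump_test_function[OF that] by (simp add: is_weak_deriv_iff cinner.diff_left)
  then have "w - w' = 0"
    by (rule L2_zero_if_bumps)
  then show ?thesis by simp
qed

lemma wderiv_eq: "is_weak_deriv j u w \<Longrightarrow> wderiv j u = w"
  unfolding wderiv_def by (rule the_equality) (auto intro: weak_deriv_unique)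

lemma is_weak_deriv_0: "is_weak_deriv 0 u w \<longleftrightarrow> w = u"
proof
  have *: "is_weak_deriv 0 u u" by (simp add: is_weak_deriv_iff)
  then show "w = u" if "is_weak_deriv 0 u w" using that weak_deriv_unique by blast
  show "is_weak_deriv 0 u w" if "w = u" using * that by simp
qed

text \<open>The derivative of a test function is a test function, so the relation at order j may be
  tested with \<open>deriv \<phi>\<close>. This reduces all orders to the first.\<close>

lemma is_weak_deriv_Suc:
  assumes "is_weak_deriv j u v"
  shows "is_weak_deriv (Suc j) u w \<longleftrightarrow> is_weak_deriv 1 v w"
proof -
  have "cinner u (L2_real ((deriv ^^ Suc j) \<phi>)) = (-1) ^ Suc j * cinner w (L2_real \<phi>)
      \<longleftrightarrow> cinner v (L2_real (deriv \<phi>)) = - cinner w (L2_real \<phi>)" if "test_function \<phi>" for \<phi>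
  proof -
    have "cinner u (L2_real ((deriv ^^ j) (deriv \<phi>))) = (-1) ^ j * cinner v (L2_real (deriv \<phi>))"
      using assms test_function_step[OF that] unfolding is_weak_deriv_iff by blast
    moreover have "(-1) ^ Suc j * cinner w (L2_real \<phi>) = (-1) ^ j * (- cinner w (L2_real \<phi>))"
      by simp
    moreover have "(-1) ^ j \<noteq> (0::complex)"
      by simp
    ultimately show ?thesis
      unfolding funpow_Suc_right o_apply by (simp only: mult_cancel_left) simp
  qed
  then show ?thesis
    unfolding is_weak_deriv_iff by (intro all_cong) simp
qed

lemma is_weak_deriv_add:
  "is_weak_deriv j u w \<Longrightarrow> is_weak_deriv j u' w' \<Longrightarrow> is_weak_deriv j (u + u') (w + w')"
  by (simp add: is_weak_deriv_iff cinner_add_left distrib_left)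

lemma is_weak_deriv_scaleC: "is_weak_deriv j u w \<Longrightarrow> is_weak_deriv j (c *\<^sub>C u) (c *\<^sub>C w)"
  by (simp add: is_weak_deriv_iff cinner_scaleC_left)

lemma is_weak_deriv_diff:
  "is_weak_deriv j u w \<Longrightarrow> is_weak_deriv j u' w' \<Longrightarrow> is_weak_deriv j (u - u') (w - w')"
  by (simp add: is_weak_deriv_iff cinner.diff_left right_diff_distrib)

lemma is_weak_deriv_zero: "is_weak_deriv j 0 0"
  by (simp add: is_weak_deriv_iff)

lemma is_weak_deriv_limit:
  assumes "\<And>N::nat. is_weak_deriv j (U N) (W N)" "U \<longlonglongrightarrow> u" "W \<longlonglongrightarrow> w"
  shows "is_weak_deriv j u w"
  unfolding is_weak_deriv_iff
proof (intro allI impI)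
  fix \<phi> assume \<phi>: "test_function \<phi>"
  have A: "(\<lambda>N. cinner (U N) (L2_real ((deriv ^^ j) \<phi>))) \<longlonglongrightarrow> cinner u (L2_real ((deriv ^^ j) \<phi>))"
    by (intro cinner.tendsto assms tendsto_const)
  have B: "(\<lambda>N. (-1) ^ j * cinner (W N) (L2_real \<phi>)) \<longlonglongrightarrow> (-1) ^ j * cinner w (L2_real \<phi>)"
    by (intro tendsto_mult cinner.tendsto assms tendsto_const)
  have eq: "cinner (U N) (L2_real ((deriv ^^ j) \<phi>)) = (-1) ^ j * cinner (W N) (L2_real \<phi>)" for N
    using assms(1)[of N] \<phi> unfolding is_weak_deriv_iff by blast
  show "cinner u (L2_real ((deriv ^^ j) \<phi>)) = (-1) ^ j * cinner w (L2_real \<phi>)"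
    using A B unfolding eq by (rule LIMSEQ_unique)
qed

section \<open>Continuous primitives and integration by parts with boundary terms\<close>

lemma L2_of_scaleC_plus:
  assumes "square_integrable f" "square_integrable g"
  shows "L2_of (\<lambda>x. f x + g x) = L2_of f + L2_of g" "L2_of (\<lambda>x. c * f x) = c *\<^sub>C L2_of f"
proof -
  have "AE x in unit_leb. fun_of (L2_of f + L2_of g) x = f x + g x"
    using fun_of_plus[of "L2_of f" "L2_of g"] fun_of_L2_of[OF assms(1)] fun_of_L2_of[OF assms(2)]
    by eventually_elim simp
  then show "L2_of (\<lambda>x. f x + g x) = L2_of f + L2_of g"
    by (intro L2_of_eqI square_integrable_add assms)
  have "AE x in unit_leb. fun_of (c *\<^sub>C L2_of f) x = c * f x"
    using fun_of_scaleC[of c "L2_of f"] fun_of_L2_of[OF assms(1)] by eventually_elim simp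
  then show "L2_of (\<lambda>x. c * f x) = c *\<^sub>C L2_of f"
    by (intro L2_of_eqI square_integrable_scale assms)
qed

lemma norm_L2_of_le:
  assumes "square_integrable f" "\<And>x. x \<in> {0..1} \<Longrightarrow> norm (f x) \<le> C"
  shows "norm (L2_of f) \<le> C"
proof -
  have "C \<ge> 0"
    using order_trans[OF norm_ge_zero assms(2)[of 0]] by simp
  have "(norm (L2_of f))\<^sup>2 = (LINT x|unit_leb. (norm (fun_of (L2_of f) x))\<^sup>2)"
    by (rule norm_fun_of)
  also have "\<dots> \<le> (LINT x|unit_leb. C\<^sup>2)"
  proof (rule integral_mono_AE)
    show "integrable unit_leb (\<lambda>x. (norm (fun_of (L2_of f) x))\<^sup>2)"
      using square_integrable_fun_of by (simp add: square_integrable_def)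
    show "integrable unit_leb (\<lambda>x. C\<^sup>2)"
      by (intro integrable_continuous_unit continuous_intros)
    have "AE x in unit_leb. x \<in> space unit_leb"
      by (rule AE_I2)
    then show "AE x in unit_leb. (norm (fun_of (L2_of f) x))\<^sup>2 \<le> C\<^sup>2"
      using fun_of_L2_of[OF assms(1)]
      by eventually_elim (auto intro!: power_mono assms(2))
  qed
  also have "\<dots> = C\<^sup>2"
    using measure_unit_leb by simp
  finally show ?thesis
    using \<open>C \<ge> 0\<close> by (rule power2_le_imp_le)
qed

text \<open>Unlike the weak derivative, this relation sees the boundary values of the continuous representative.\<close>

definition by_parts :: "(real \<Rightarrow> complex) \<Rightarrow> L2 \<Rightarrow> bool" where
  "by_parts f w \<longleftrightarrow> continuous_on {0..1} f \<and>
     (\<forall>\<psi> \<psi>'. (\<forall>x. (\<psi> has_real_derivative \<psi>' x) (at x)) \<longrightarrow> continuous_on UNIV \<psi>' \<longrightarrow>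
       cinner w (L2_real \<psi>) = f 1 * complex_of_real (\<psi> 1) - f 0 * complex_of_real (\<psi> 0)
         - cinner (L2_of f) (L2_real \<psi>'))"

lemma by_parts_continuous: "by_parts f w \<Longrightarrow> continuous_on {0..1} f"
  by (simp add: by_parts_def)

lemma by_partsD:
  "by_parts f w \<Longrightarrow> (\<And>x. (\<psi> has_real_derivative \<psi>' x) (at x)) \<Longrightarrow> continuous_on UNIV \<psi>' \<Longrightarrow>
    cinner w (L2_real \<psi>) = f 1 * complex_of_real (\<psi> 1) - f 0 * complex_of_real (\<psi> 0)
      - cinner (L2_of f) (L2_real \<psi>')"
  unfolding by_parts_def by blast

lemma by_parts_C1:
  assumes d: "\<And>x. (f has_vector_derivative f' x) (at x)" and c: "continuous_on {0..1} f'"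
  shows "by_parts f (L2_of f')"
proof -
  have cf: "continuous_on {0..1} f"
    using d has_vector_derivative_continuous continuous_at_imp_continuous_on by blast
  have "cinner (L2_of f') (L2_real \<psi>) = f 1 * complex_of_real (\<psi> 1) - f 0 * complex_of_real (\<psi> 0)
      - cinner (L2_of f) (L2_real \<psi>')"
    if \<psi>: "\<And>x. (\<psi> has_real_derivative \<psi>' x) (at x)" and c': "continuous_on UNIV \<psi>'" for \<psi> \<psi>'
  proof -
    have c\<psi>: "continuous_on {0..1} \<psi>"
      using \<psi> DERIV_isCont continuous_at_imp_continuous_on by blast
    have c\<psi>': "continuous_on {0..1} \<psi>'"
      using c' continuous_on_subset by blast
    have "(LINT x|unit_leb. \<psi> x *\<^sub>R f' x + \<psi>' x *\<^sub>R f x) = \<psi> 1 *\<^sub>R f 1 - \<psi> 0 *\<^sub>R f 0"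
    proof (rule integral_unit_FTC)
      show "((\<lambda>x. \<psi> x *\<^sub>R f x) has_vector_derivative \<psi> x *\<^sub>R f' x + \<psi>' x *\<^sub>R f x) (at x within {0..1})" for x
        by (rule has_vector_derivative_at_within, rule has_vector_derivative_scaleR[OF \<psi> d])
      show "continuous_on {0..1} (\<lambda>x. \<psi> x *\<^sub>R f' x + \<psi>' x *\<^sub>R f x)"
        by (intro continuous_on_add continuous_on_scaleR c\<psi> c\<psi>' c cf)
    qed
    moreover have "(LINT x|unit_leb. \<psi> x *\<^sub>R f' x + \<psi>' x *\<^sub>R f x)
        = (LINT x|unit_leb. \<psi> x *\<^sub>R f' x) + (LINT x|unit_leb. \<psi>' x *\<^sub>R f x)"
      by (intro Bochner_Integration.integral_add integrable_continuous_unit continuous_on_scaleR c\<psi> c\<psi>' c cf)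
    ultimately show ?thesis
      by (simp add: cinner_L2_of_real c\<psi> c\<psi>' c cf scaleR_conv_of_real algebra_simps eq_diff_eq)
  qed
  then show ?thesis
    using cf unfolding by_parts_def by blast
qed

lemma by_parts_add:
  assumes "by_parts f w" "by_parts g v"
  shows "by_parts (\<lambda>x. f x + g x) (w + v)"
proof -
  have c: "continuous_on {0..1} f" "continuous_on {0..1} g"
    using assms by (auto simp: by_parts_continuous)
  show ?thesis
    unfolding by_parts_def
  proof (intro conjI allI impI continuous_on_add c)
    fix \<psi> \<psi>' :: "real \<Rightarrow> real"
    assume \<psi>: "\<forall>x. (\<psi> has_real_derivative \<psi>' x) (at x)" "continuous_on UNIV \<psi>'"
    show "cinner (w + v) (L2_real \<psi>) = (f 1 + g 1) * complex_of_real (\<psi> 1)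
        - (f 0 + g 0) * complex_of_real (\<psi> 0) - cinner (L2_of (\<lambda>x. f x + g x)) (L2_real \<psi>')"
      using by_partsD[OF assms(1) \<psi>(1)[rule_format] \<psi>(2)] by_partsD[OF assms(2) \<psi>(1)[rule_format] \<psi>(2)]
      by (simp add: cinner_add_left L2_of_scaleC_plus square_integrable_continuous c distrib_right)
  qed
qed

lemma by_parts_scale:
  assumes "by_parts f w"
  shows "by_parts (\<lambda>x. c * f x) (c *\<^sub>C w)"
proof -
  have cf: "continuous_on {0..1} f"
    using assms by (auto simp: by_parts_continuous)
  show ?thesis
    unfolding by_parts_def
  proof (intro conjI allI impI continuous_on_mult continuous_on_const cf)
    fix \<psi> \<psi>' :: "real \<Rightarrow> real"
    assume \<psi>: "\<forall>x. (\<psi> has_real_derivative \<psi>' x) (at x)" "continuous_on UNIV \<psi>'"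
    show "cinner (c *\<^sub>C w) (L2_real \<psi>) = c * f 1 * complex_of_real (\<psi> 1)
        - c * f 0 * complex_of_real (\<psi> 0) - cinner (L2_of (\<lambda>x. c * f x)) (L2_real \<psi>')"
      using by_partsD[OF assms \<psi>(1)[rule_format] \<psi>(2)]
      by (simp add: cinner_scaleC_left L2_of_scaleC_plus(2)[OF _ square_integrable_zero]
          square_integrable_continuous cf right_diff_distrib)
  qed
qed

lemma by_parts_const: "by_parts (\<lambda>_. c) 0"
proof -
  have "by_parts (\<lambda>_. c) (L2_of (\<lambda>_. 0))"
    by (intro by_parts_C1 has_vector_derivative_const continuous_on_const)
  then show ?thesis by (simp add: zero_L2_def)
qed

text \<open>Uniform convergence carries the boundary values along; for the derivatives, convergence
  in norm is enough.\<close>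

lemma by_parts_limit:
  assumes bp: "\<And>N::nat. by_parts (F N) (W N)" and u: "uniform_limit {0..1} F f sequentially"
    and W: "W \<longlonglongrightarrow> w"
  shows "by_parts f w"
proof -
  have cF: "continuous_on {0..1} (F N)" for N
    using bp by (rule by_parts_continuous)
  have cf: "continuous_on {0..1} f"
    by (rule uniform_limit_theorem[OF _ u]) (auto simp: cF)
  have "(\<lambda>N. L2_of (F N)) \<longlonglongrightarrow> L2_of f"
  proof (rule LIMSEQ_I)
    fix r :: real assume r: "r > 0"
    then have "\<forall>\<^sub>F N in sequentially. \<forall>x\<in>{0..1}. dist (F N x) (f x) < r / 2"
      using uniform_limitD[OF u, of "r / 2"] by simp
    then obtain M where M: "\<And>N x. N \<ge> M \<Longrightarrow> x \<in> {0..1} \<Longrightarrow> dist (F N x) (f x) < r / 2"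
      unfolding eventually_sequentially by blast
    have "norm (L2_of (F N) - L2_of f) < r" if "N \<ge> M" for N
    proof -
      have s: "square_integrable (F N)" "square_integrable (\<lambda>x. (-1) * f x)"
        by (intro square_integrable_scale square_integrable_continuous cF cf)+
      have "L2_of (F N) - L2_of f = L2_of (F N) + (-1) *\<^sub>C L2_of f"
        by (simp add: scaleC_minus_left)
      also have "\<dots> = L2_of (\<lambda>x. F N x + (-1) * f x)"
        using L2_of_scaleC_plus(1)[OF s] L2_of_scaleC_plus(2)[of f "\<lambda>_. 0" "-1"]
          square_integrable_continuous[OF cf] square_integrable_zero by simp
      also have "norm \<dots> \<le> r / 2"
        using M[OF that] by (intro norm_L2_of_le square_integrable_add s) (auto simp: dist_norm less_imp_le)
      finally show ?thesis using r by simp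
    qed
    then show "\<exists>M. \<forall>N\<ge>M. norm (L2_of (F N) - L2_of f) < r" by blast
  qed
  note L = this
  have pt: "(\<lambda>N. F N y) \<longlonglongrightarrow> f y" if "y \<in> {0..1}" for y
    using tendsto_uniform_limitI[OF u that] .
  show ?thesis
    unfolding by_parts_def
  proof (intro conjI allI impI cf)
    fix \<psi> \<psi>' :: "real \<Rightarrow> real"
    assume \<psi>: "\<forall>x. (\<psi> has_real_derivative \<psi>' x) (at x)" "continuous_on UNIV \<psi>'"
    have eq: "cinner (W N) (L2_real \<psi>) = F N 1 * complex_of_real (\<psi> 1) - F N 0 * complex_of_real (\<psi> 0)
        - cinner (L2_of (F N)) (L2_real \<psi>')" for N
      using \<psi> by (intro by_partsD[OF bp]) auto
    have A: "(\<lambda>N. cinner (W N) (L2_real \<psi>)) \<longlonglongrightarrow> cinner w (L2_real \<psi>)"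
      by (intro cinner.tendsto W tendsto_const)
    have B: "(\<lambda>N. F N 1 * complex_of_real (\<psi> 1) - F N 0 * complex_of_real (\<psi> 0)
        - cinner (L2_of (F N)) (L2_real \<psi>')) \<longlonglongrightarrow>
        f 1 * complex_of_real (\<psi> 1) - f 0 * complex_of_real (\<psi> 0) - cinner (L2_of f) (L2_real \<psi>')"
      by (intro tendsto_diff tendsto_mult tendsto_const pt cinner.tendsto L) auto
    show "cinner w (L2_real \<psi>) = f 1 * complex_of_real (\<psi> 1) - f 0 * complex_of_real (\<psi> 0)
        - cinner (L2_of f) (L2_real \<psi>')"
      using A B unfolding eq by (rule LIMSEQ_unique)
  qed
qed

lemma by_parts_weak_deriv: "by_parts f w \<Longrightarrow> is_weak_deriv 1 (L2_of f) w"
  unfolding is_weak_deriv_iff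
proof (intro allI impI)
  fix \<phi> assume "by_parts f w" and \<phi>: "test_function \<phi>"
  then have "cinner w (L2_real \<phi>) = f 1 * complex_of_real (\<phi> 1) - f 0 * complex_of_real (\<phi> 0)
      - cinner (L2_of f) (L2_real (deriv \<phi>))"
    by (intro by_partsD test_function_deriv test_function_continuous test_function_step)
  then show "cinner (L2_of f) (L2_real ((deriv ^^ 1) \<phi>)) = (-1) ^ 1 * cinner w (L2_real \<phi>)"
    using test_function_ends[OF \<phi>] by simp
qed

definition cos_primitive :: "nat \<Rightarrow> real \<Rightarrow> real" where
  "cos_primitive n x = (if n = 0 then x else trig Dirichlet n x / (pi * real n))"

lemma cos_primitive_deriv: "(cos_primitive n has_real_derivative trig Neumann n x) (at x)"
proof (cases "n = 0")
  case True
  then show ?thesis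
    unfolding cos_primitive_def[abs_def] by (simp add: trig_def)
next
  case False
  have "((\<lambda>x. trig Dirichlet n x / (pi * real n)) has_real_derivative
      dsign Dirichlet * (pi * real n) * trig (flip Dirichlet) n x / (pi * real n)) (at x)"
    by (intro DERIV_cdivide trig_deriv)
  then show ?thesis
    using False unfolding cos_primitive_def[abs_def] by simp
qed

text \<open>Shaped as a summable majorant. At n = 0 the term \<open>1 / (real n)\<^sup>2\<close> is
  0 by convention, and the first summand takes over.\<close>

lemma cos_primitive_bound:
  assumes "x \<in> {0..1}"
  shows "(cos_primitive n x)\<^sup>2 \<le> (if n = 0 then 1 else 0) + 1 / (real n)\<^sup>2"
proof (cases "n = 0")
  case True
  then show ?thesis
    using assms by (simp add: cos_primitive_def power_le_one)
next
  case False
  have "(trig Dirichlet n x)\<^sup>2 \<le> 2"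
    using abs_sin_le_one[of "pi * real n * x"] by (simp add: trig_def power_mult_distrib abs_square_le_1)
  moreover have "2 * 1 \<le> pi\<^sup>2"
    using pi_ge_two by (simp add: power2_eq_square mult_mono order_trans[OF _ mult_mono[of 2 pi 1 pi]])
  ultimately have "(trig Dirichlet n x)\<^sup>2 / pi\<^sup>2 \<le> 1"
    by simp
  then have "(trig Dirichlet n x)\<^sup>2 / pi\<^sup>2 / (real n)\<^sup>2 \<le> 1 / (real n)\<^sup>2"
    by (rule divide_right_mono) simp
  then show ?thesis
    using False by (simp add: cos_primitive_def power_divide power_mult_distrib)
qed

text \<open>Integrating the cosine series of \<open>w\<close> termwise gives a uniformly convergent series.\<close>

lemma by_parts_exists: "\<exists>f. by_parts f w"
proof -
  define a where "a n = cinner w (basis Neumann n)" for n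
  \<comment> \<open>By \<open>x * y <= x^2 + y^2\<close> the majorant separates square summable
    coefficients from primitives of size 1 / n.\<close>
  define M where "M n = (norm (a n))\<^sup>2 + ((if n = 0 then 1 else 0) + 1 / (real n)\<^sup>2)" for n
  have "summable (\<lambda>n. (if n = 0 then 1 else 0 :: real))"
    by (rule summable_finite[of "{0}"]) auto
  then have "summable M"
    unfolding M_def using trig.summable_coef[of w Neumann] inverse_power_summable[of 2]
    by (intro summable_add) (auto simp: a_def inverse_eq_divide)
  have bd: "norm (a n * complex_of_real (cos_primitive n x)) \<le> M n" if "x \<in> {0..1}" for n x
  proof -
    let ?p = "\<bar>cos_primitive n x\<bar>"
    have "norm (a n) * ?p \<le> (norm (a n))\<^sup>2 + ?p\<^sup>2"
    proof -
      have "0 \<le> norm (a n) * ?p" by simp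
      then show ?thesis
        using sum_squares_bound[of "norm (a n)" ?p] by linarith
    qed
    then show ?thesis
      using cos_primitive_bound[OF that, of n] by (simp add: M_def norm_mult)
  qed
  define F where "F N x = (\<Sum>n<N. a n * complex_of_real (cos_primitive n x))" for N x
  have u: "uniform_limit {0..1} F (\<lambda>x. \<Sum>n. a n * complex_of_real (cos_primitive n x)) sequentially"
    unfolding F_def[abs_def] by (rule Weierstrass_m_test[OF bd \<open>summable M\<close>])
  have prim: "by_parts (\<lambda>x. complex_of_real (cos_primitive n x)) (basis Neumann n)" for n
    unfolding basis_def L2_real_def
  proof (rule by_parts_C1)
    show "((\<lambda>x. complex_of_real (cos_primitive n x)) has_vector_derivative
        complex_of_real (trig Neumann n x)) (at x)" for x
      using cos_primitive_deriv by (rule has_vector_derivative_of_real)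
    show "continuous_on {0..1} (\<lambda>x. complex_of_real (trig Neumann n x))"
      by (intro continuous_on_of_real continuous_trig)
  qed
  have "by_parts (F N) (\<Sum>n<N. a n *\<^sub>C basis Neumann n)" for N
  proof (induction N)
    case 0
    then show ?case
      using by_parts_const[of 0] by (simp add: F_def[abs_def])
  next
    case (Suc N)
    then show ?case
      using by_parts_add[OF Suc by_parts_scale[OF prim]] by (simp add: F_def[abs_def])
  qed
  from by_parts_limit[OF this u] have "by_parts (\<lambda>x. \<Sum>n. a n * complex_of_real (cos_primitive n x)) w"
    using trig.expansion[of w Neumann] by (simp add: sums_def a_def)
  then show ?thesis by blast
qed

text \<open>Du Bois-Reymond: subtracting from a bump \<psi> the multiple of a fixed bump \<beta>
  with the same mean leaves the derivative of a test function, which v annihilates. So v acts on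
  \<psi> as a constant times its mean.\<close>

lemma weak_deriv_zero_imp_const:
  assumes v: "is_weak_deriv 1 v 0"
  shows "\<exists>c. v = L2_of (\<lambda>_. c)"
proof -
  define \<beta> where "\<beta> = bump 1 (1/4) (3/4)"
  have t\<beta>: "test_function \<beta>"
    unfolding \<beta>_def by (intro bump_test_function) auto
  define I where "I = (LINT x|unit_leb. \<beta> x)"
  have c\<beta>: "continuous_on {0..1} \<beta>"
    by (rule test_function_continuous[OF t\<beta>])
  have "I \<noteq> 0"
  proof
    assume "I = 0"
    then have "integral {0..1} \<beta> = 0"
      using integral_unit_eq[OF integrable_continuous_unit[OF c\<beta>]] by (simp add: I_def)
    then have "\<forall>x\<in>{0..1}. \<beta> x = 0"
      using c\<beta> bump_bounds(1)[of 1] by (subst (asm) integral_eq_0_iff) (auto simp: \<beta>_def)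
    moreover have "\<beta> (1/2) > 0"
      unfolding \<beta>_def by (rule bump_pos) auto
    ultimately show False by force
  qed
  \<comment> \<open>The value forced by testing with \<beta> itself.\<close>
  define c where "c = cinner v (L2_real \<beta>) / complex_of_real I"
  have const: "cinner (L2_of (\<lambda>_. c)) (L2_real \<psi>) = c * complex_of_real (LINT x|unit_leb. \<psi> x)"
    if "continuous_on {0..1} \<psi>" for \<psi>
    using that integral_complex_of_real[of unit_leb \<psi>]
    by (simp add: cinner_L2_of_real continuous_on_const scaleR_conv_of_real)
  have "cinner (v - L2_of (\<lambda>_. c)) (L2_real (bump \<epsilon> a b)) = 0" if \<epsilon>: "\<epsilon> > 0" "0 < a" "b < 1" for \<epsilon> a b
  proof -
    define \<psi> where "\<psi> = bump \<epsilon> a b"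
    have t\<psi>: "test_function \<psi>"
      unfolding \<psi>_def by (rule bump_test_function[OF \<epsilon>])
    have c\<psi>: "continuous_on {0..1} \<psi>"
      by (rule test_function_continuous[OF t\<psi>])
    define J where "J = (LINT x|unit_leb. \<psi> x)"
    define \<eta> where "\<eta> x = \<psi> x - (J / I) * \<beta> x" for x
    have t\<eta>: "test_function \<eta>"
      unfolding \<eta>_def by (rule test_function_diff_scale[OF t\<psi> t\<beta>])
    have i\<psi>: "integrable unit_leb \<psi>" and i\<beta>: "integrable unit_leb \<beta>"
      by (intro integrable_continuous_unit c\<psi> c\<beta>)+
    have "(LINT x|unit_leb. \<eta> x) = 0"
      unfolding \<eta>_def using i\<psi> i\<beta> \<open>I \<noteq> 0\<close> by (simp add: J_def[symmetric] I_def[symmetric])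
    then obtain \<phi> where \<phi>: "test_function \<phi>" "deriv \<phi> = \<eta>"
      using test_antiderivative[OF t\<eta>] by blast
    then have "cinner v (L2_real \<eta>) = 0"
      using v by (auto simp: is_weak_deriv_iff)
    moreover have "cinner v (L2_real \<eta>) = cinner v (L2_real \<psi>) - complex_of_real (J / I) * cinner v (L2_real \<beta>)"
    proof -
      have "cinner v (L2_real \<eta>) = (LINT x|unit_leb. \<psi> x *\<^sub>R fun_of v x - (J / I) *\<^sub>R (\<beta> x *\<^sub>R fun_of v x))"
        by (simp only: cinner_L2_real[OF test_function_continuous[OF t\<eta>]])
          (simp only: \<eta>_def scaleR_diff_left scaleR_scaleR)
      also have "\<dots> = (LINT x|unit_leb. \<psi> x *\<^sub>R fun_of v x) - (J / I) *\<^sub>R (LINT x|unit_leb. \<beta> x *\<^sub>R fun_of v x)"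
        by (simp only: Bochner_Integration.integral_diff integral_scaleR_right integrable_scaleR_right
            integrable_scaleR_continuous[OF integrable_fun_of] c\<psi> c\<beta>)
      finally show ?thesis
        by (simp add: cinner_L2_real c\<psi> c\<beta> scaleR_conv_of_real)
    qed
    ultimately have "cinner v (L2_real \<psi>) = complex_of_real J * c"
      by (simp add: c_def)
    then show ?thesis
      by (simp add: cinner.diff_left const[OF c\<psi>] J_def[symmetric] mult.commute flip: \<psi>_def)
  qed
  then have "v - L2_of (\<lambda>_. c) = 0"
    by (rule L2_zero_if_bumps)
  then show ?thesis by auto
qed

text \<open>A continuous primitive of w has the same weak derivative as u, so they differ by a
  constant, and \<open>by_parts\<close> is stable under adding constants.\<close>

lemma weak_deriv_by_parts:
  assumes "is_weak_deriv 1 u w"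
  shows "\<exists>f. by_parts f w \<and> L2_of f = u"
proof -
  obtain f where f: "by_parts f w" using by_parts_exists by blast
  have "is_weak_deriv 1 (u - L2_of f) (w - w)"
    by (intro is_weak_deriv_diff assms by_parts_weak_deriv f)
  then obtain c where c: "u - L2_of f = L2_of (\<lambda>_. c)"
    using weak_deriv_zero_imp_const by auto
  have "by_parts (\<lambda>x. f x + c) (w + 0)"
    by (intro by_parts_add f by_parts_const)
  moreover have "L2_of (\<lambda>x. f x + c) = u"
    using c L2_of_scaleC_plus(1)[of f "\<lambda>_. c"] square_integrable_const[of c]
      square_integrable_continuous[OF by_parts_continuous[OF f]] by (simp add: algebra_simps)
  ultimately show ?thesis by auto
qed

section \<open>Point values of the continuous representative\<close>

lemma continuous_AE_zero:
  fixes g :: "real \<Rightarrow> complex"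
  assumes c: "continuous_on {0..1} g" and "AE x in unit_leb. g x = 0" and "t \<in> {0..1}"
  shows "g t = 0"
proof -
  have cn: "continuous_on {0..1} (\<lambda>x. norm (g x))"
    using c by (rule continuous_on_norm)
  have "(LINT x|unit_leb. norm (g x)) = (LINT x|unit_leb. 0)"
    using assms(2) measurable_continuous_unit[OF cn] by (intro integral_cong_AE) auto
  then have "integral {0..1} (\<lambda>x. norm (g x)) = 0"
    using integral_unit_eq[OF integrable_continuous_unit[OF cn]] by simp
  then show ?thesis
    using assms(3) cn by (subst (asm) integral_eq_0_iff) auto
qed

lemma point_value_eq:
  assumes f: "continuous_on {0..1} f" and t: "t \<in> {0..1}"
  shows "point_value (L2_of f) t = f t"
  unfolding point_value_def
proof (rule the_equality)
  have AEf: "AE x in unit_leb. fun_of (L2_of f) x = f x"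
    by (intro fun_of_L2_of square_integrable_continuous f)
  then show "\<exists>g. continuous_on {0..1} g \<and> (AE x in unit_leb. fun_of (L2_of f) x = g x) \<and> g t = f t"
    using f by blast
  fix c assume "\<exists>g. continuous_on {0..1} g \<and> (AE x in unit_leb. fun_of (L2_of f) x = g x) \<and> g t = c"
  then obtain g where g: "continuous_on {0..1} g" "AE x in unit_leb. fun_of (L2_of f) x = g x" "g t = c"
    by blast
  have "AE x in unit_leb. g x - f x = 0"
    using AEf g(2) by eventually_elim simp
  then have "g t - f t = 0"
    by (intro continuous_AE_zero continuous_on_diff g f t)
  then show "c = f t" using g(3) by simp
qed

section \<open>Sobolev spaces in terms of Fourier coefficients\<close>

abbreviation freq :: "nat \<Rightarrow> complex" where
  "freq n \<equiv> complex_of_real (pi * real n)"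

lemma L2_real_scale:
  assumes "continuous_on {0..1} \<phi>"
  shows "L2_real (\<lambda>x. c * \<phi> x) = complex_of_real c *\<^sub>C L2_real \<phi>"
  unfolding L2_real_def of_real_mult using assms
  by (intro L2_of_scaleC_plus(2)[OF _ square_integrable_zero] square_integrable_continuous
      continuous_on_of_real)

lemma basis_weak_deriv: "is_weak_deriv 1 (basis bc n) ((complex_of_real (dsign bc) * freq n) *\<^sub>C basis (flip bc) n)"
proof -
  let ?\<phi>' = "\<lambda>x. dsign bc * (pi * real n) * trig (flip bc) n x"
  have "by_parts (\<lambda>x. complex_of_real (trig bc n x)) (L2_of (\<lambda>x. complex_of_real (?\<phi>' x)))"
    by (intro by_parts_C1 has_vector_derivative_of_real trig_deriv continuous_intros)
  then have "is_weak_deriv 1 (basis bc n) (L2_real ?\<phi>')"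
    unfolding basis_def L2_real_def by (rule by_parts_weak_deriv)
  then show ?thesis
    by (simp add: L2_real_scale continuous_trig basis_def)
qed

text \<open>The function tested with comes from the other system, since its derivative is a multiple
  of \<open>trig bc n\<close>; the sign of that derivative cancels the minus of integration by
  parts.\<close>

lemma by_parts_basis:
  assumes "by_parts f w"
  shows "cinner w (basis (flip bc) n) = f 1 * complex_of_real (trig (flip bc) n 1)
    - f 0 * complex_of_real (trig (flip bc) n 0)
    + complex_of_real (dsign bc) * freq n * cinner (L2_of f) (basis bc n)"
proof -
  let ?\<phi>' = "\<lambda>x. (dsign (flip bc) * (pi * real n)) * trig bc n x"
  have d: "(trig (flip bc) n has_real_derivative ?\<phi>' x) (at x)" for x
    using trig_deriv[of "flip bc" n x] by simp
  have "cinner w (L2_real (trig (flip bc) n)) = f 1 * complex_of_real (trig (flip bc) n 1)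
      - f 0 * complex_of_real (trig (flip bc) n 0) - cinner (L2_of f) (L2_real ?\<phi>')"
    by (rule by_partsD[OF assms d]) (intro continuous_intros)
  then show ?thesis
    by (simp only: L2_real_scale continuous_trig cinner_scaleC_right basis_def[symmetric]) simp
qed

text \<open>The boundary terms vanish in either case: for Dirichlet because v does, for Neumann
  because the function tested with is a sine.\<close>

lemma first_order_coef:
  assumes w: "is_weak_deriv 1 v w" and bc: "bc = Dirichlet \<Longrightarrow> vanishes_at_ends v"
  shows "cinner w (basis (flip bc) n) = complex_of_real (dsign bc) * freq n * cinner v (basis bc n)"
proof -
  obtain f where f: "by_parts f w" "L2_of f = v"
    using weak_deriv_by_parts[OF w] by blast
  have "f 0 = 0 \<and> f 1 = 0" if "bc = Dirichlet"
    using bc[OF that] point_value_eq[OF by_parts_continuous[OF f(1)]] f(2)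
    by (auto simp: vanishes_at_ends_def)
  moreover have "trig (flip bc) n 0 = 0 \<and> trig (flip bc) n 1 = 0" if "bc = Neumann"
    using that by simp
  ultimately show ?thesis
    using by_parts_basis[OF f(1), of bc n] f(2) by (cases bc) auto
qed

text \<open>Backwards, the partial sums are differentiated termwise and the weak derivative is
  closed under limits. The Dirichlet condition is then read off from the absence of boundary terms
  in the coefficients of w.\<close>

lemma first_order_iff:
  "((\<exists>w. is_weak_deriv 1 v w) \<and> (bc = Dirichlet \<longrightarrow> vanishes_at_ends v)) \<longleftrightarrow> v \<in> trig.mdom bc freq"
proof
  assume "(\<exists>w. is_weak_deriv 1 v w) \<and> (bc = Dirichlet \<longrightarrow> vanishes_at_ends v)"
  then obtain w where w: "is_weak_deriv 1 v w" and bc: "bc = Dirichlet \<Longrightarrow> vanishes_at_ends v"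
    by blast
  have "summable (\<lambda>n. (norm (cinner w (basis (flip bc) n)))\<^sup>2)"
    by (rule trig.summable_coef)
  then show "v \<in> trig.mdom bc freq"
    by (simp add: first_order_coef[OF w bc] trig.mdom_def norm_mult)
next
  assume v: "v \<in> trig.mdom bc freq"
  define a where "a n = complex_of_real (dsign bc) * freq n * cinner v (basis bc n)" for n
  have "summable (\<lambda>n. (norm (a n))\<^sup>2)"
    using v by (simp add: trig.mdom_def a_def norm_mult)
  \<comment> \<open>The only zero vector is the sine of index 0, and there the frequency is 0
    too.\<close>
  moreover have "a n = 0" if "basis (flip bc) n = 0" for n
    using norm_basis[of "flip bc" n] that by (auto simp: a_def)
  ultimately obtain w where w: "(\<lambda>n. a n *\<^sub>C basis (flip bc) n) sums w"
      "\<And>n. cinner w (basis (flip bc) n) = a n"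
    using trig.riesz_fischer[of a "flip bc"] by blast
  have "is_weak_deriv 1 (\<Sum>n<N. cinner v (basis bc n) *\<^sub>C basis bc n) (\<Sum>n<N. a n *\<^sub>C basis (flip bc) n)" for N
  proof (induction N)
    case 0
    show ?case by (simp add: is_weak_deriv_zero)
  next
    case (Suc N)
    show ?case
      using is_weak_deriv_add[OF Suc is_weak_deriv_scaleC[OF basis_weak_deriv, of "cinner v (basis bc N)"]]
      by (simp add: scaleC_scaleC a_def mult_ac)
  qed
  then have wd: "is_weak_deriv 1 v w"
    using trig.expansion[of v bc] w(1) unfolding sums_def by (rule is_weak_deriv_limit)
  obtain f where f: "by_parts f w" "L2_of f = v"
    using weak_deriv_by_parts[OF wd] by blast
  \<comment> \<open>The boundary terms against \<open>1\<close> and \<open>cos (\<pi> x)\<close> vanish, hence \<open>f 1 = f 0\<close> and \<open>f 1 = - f 0\<close>.\<close>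
  have "vanishes_at_ends v" if "bc = Dirichlet"
  proof -
    have *: "f 1 * complex_of_real (trig Neumann n 1) - f 0 * complex_of_real (trig Neumann n 0) = 0" for n
      using by_parts_basis[OF f(1), of bc n] w(2)[of n] f(2) that by (simp add: a_def)
    have "f 1 = f 0" "f 1 = - f 0"
      using *[of 0] *[of 1] by (auto simp: trig_def eq_neg_iff_add_eq_0 add.commute)
    then have "f 0 = 0" "f 1 = 0" by auto
    then show ?thesis
      using point_value_eq[OF by_parts_continuous[OF f(1)]] f(2) by (auto simp: vanishes_at_ends_def)
  qed
  with wd show "(\<exists>w. is_weak_deriv 1 v w) \<and> (bc = Dirichlet \<longrightarrow> vanishes_at_ends v)"
    by blast
qed

text \<open>One scale for both domains: m = 2k gives the operator domain and m = k the form domain,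
  while the induction proceeds by single derivatives.\<close>

definition bc_space :: "boundary_type \<Rightarrow> nat \<Rightarrow> L2 set" where
  "bc_space bc m = {u \<in> sobolev m. \<forall>j. bc_order bc j < m \<longrightarrow> vanishes_at_ends (wderiv (bc_order bc j) u)}"

lemma funpow_flip: "(flip ^^ m) bc = (if even m then bc else flip bc)"
  by (induction m) auto

text \<open>A condition is imposed at order m exactly when the m-th derivative is expanded in
  sines.\<close>

lemma bc_order_iff: "(\<exists>j. bc_order bc j = m) \<longleftrightarrow> (flip ^^ m) bc = Dirichlet"
proof (cases bc)
  case Dirichlet
  then show ?thesis by (auto simp: funpow_flip elim!: evenE)
next
  case Neumann
  then show ?thesis by (auto simp: funpow_flip elim!: oddE)
qed

lemma sobolev_Suc: "u \<in> sobolev (Suc m) \<longleftrightarrow> u \<in> sobolev m \<and> (\<exists>w. is_weak_deriv (Suc m) u w)"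
  by (auto simp: sobolev_def le_Suc_eq)

lemma bc_space_Suc:
  "u \<in> bc_space bc (Suc m) \<longleftrightarrow> u \<in> bc_space bc m \<and> (\<exists>w. is_weak_deriv (Suc m) u w) \<and>
    ((flip ^^ m) bc = Dirichlet \<longrightarrow> vanishes_at_ends (wderiv m u))"
  unfolding bc_order_iff[symmetric] by (auto simp: bc_space_def sobolev_Suc less_Suc_eq)

text \<open>The sign collected by m differentiations. Each pair contributes -1, which the factor
  \<open>(-1) ^ k\<close> of the operator compensates.\<close>

definition msign :: "boundary_type \<Rightarrow> nat \<Rightarrow> real" where
  "msign bc m = (\<Prod>i<m. dsign ((flip ^^ i) bc))"

lemma msign_double: "msign bc (2 * k) = (-1) ^ k"
proof (induction k)
  case (Suc k)
  have "msign bc (2 * Suc k) = msign bc (2 * k) * (dsign bc * dsign (flip bc))"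
    by (simp add: msign_def funpow_flip mult.assoc)
  then show ?case using Suc by simp
qed (simp add: msign_def)

lemma abs_msign: "\<bar>msign bc m\<bar> = 1"
  by (simp add: msign_def abs_prod)

lemma mdom_power_mono: "u \<in> trig.mdom bc (\<lambda>n. freq n ^ Suc m) \<Longrightarrow> u \<in> trig.mdom bc (\<lambda>n. freq n ^ m)"
proof -
  assume u: "u \<in> trig.mdom bc (\<lambda>n. freq n ^ Suc m)"
  let ?w = "u + trig.mop bc (\<lambda>n. freq n ^ Suc m) u"
  have "norm (freq n ^ m * cinner u (basis bc n)) \<le> 1 * norm (cinner ?w (basis bc n))" for n
  proof -
    let ?x = "pi * real n"
    have "cinner ?w (basis bc n) = complex_of_real (1 + ?x ^ Suc m) * cinner u (basis bc n)"
      using u by (simp add: cinner_add_left trig.mop_coef distrib_right)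
    then have "norm (cinner ?w (basis bc n)) = (1 + ?x ^ Suc m) * norm (cinner u (basis bc n))"
      by (simp only: norm_mult norm_of_real) simp
    moreover have "?x ^ m \<le> 1 + ?x ^ Suc m"
    proof (cases "n = 0")
      case True
      then show ?thesis by (cases m) auto
    next
      case False
      then have "1 * 1 \<le> pi * real n"
        using pi_ge_two by (intro mult_mono) auto
      then have "?x ^ m \<le> ?x ^ Suc m"
        by (intro power_increasing) auto
      then show ?thesis by simp
    qed
    ultimately show ?thesis
      using mult_right_mono[of "?x ^ m" "1 + ?x ^ Suc m" "norm (cinner u (basis bc n))"]
      by (simp add: norm_mult norm_power)
  qed
  then show ?thesis
    by (rule trig.mdomI_le)
qed

text \<open>Induction on m through \<open>first_order_iff\<close>, applied to the m-th derivative
  with the type flipped m times. Domain and coefficients are treated together because each step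
  needs the coefficients of the previous derivative.\<close>

lemma bc_space_fourier:
  "(u \<in> bc_space bc m \<longleftrightarrow> u \<in> trig.mdom bc (\<lambda>n. freq n ^ m)) \<and>
   (u \<in> bc_space bc m \<longrightarrow> is_weak_deriv m u (wderiv m u) \<and>
     (\<forall>n. cinner (wderiv m u) (basis ((flip ^^ m) bc) n) =
        complex_of_real (msign bc m) * freq n ^ m * cinner u (basis bc n)))"
proof (induction m)
  case 0
  have "u \<in> trig.mdom bc (\<lambda>n. freq n ^ 0)"
    by (simp add: trig.mdom_def trig.summable_coef)
  moreover have "wderiv 0 u = u"
    by (intro wderiv_eq) (simp add: is_weak_deriv_0)
  ultimately show ?case
    by (auto simp: bc_space_def sobolev_def is_weak_deriv_0 msign_def)
next
  case (Suc m)
  let ?bc = "(flip ^^ m) bc"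
  show ?case
  proof (cases "u \<in> bc_space bc m")
    case False
    then have "u \<notin> trig.mdom bc (\<lambda>n. freq n ^ Suc m)"
      using Suc mdom_power_mono by blast
    then show ?thesis
      using False by (simp add: bc_space_Suc)
  next
    case True
    define v where "v = wderiv m u"
    have v: "is_weak_deriv m u v"
      and vc: "\<And>n. cinner v (basis ?bc n) = complex_of_real (msign bc m) * freq n ^ m * cinner u (basis bc n)"
      using Suc True by (auto simp: v_def)
    have "u \<in> bc_space bc (Suc m) \<longleftrightarrow> v \<in> trig.mdom ?bc freq"
      unfolding first_order_iff[symmetric] bc_space_Suc is_weak_deriv_Suc[OF v] v_def[symmetric]
      using True by blast
    also have "\<dots> \<longleftrightarrow> u \<in> trig.mdom bc (\<lambda>n. freq n ^ Suc m)"
      by (simp add: trig.mdom_def vc norm_mult norm_power abs_msign mult.assoc)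
    finally have iff: "u \<in> bc_space bc (Suc m) \<longleftrightarrow> u \<in> trig.mdom bc (\<lambda>n. freq n ^ Suc m)" .
    have "is_weak_deriv (Suc m) u (wderiv (Suc m) u) \<and>
        (\<forall>n. cinner (wderiv (Suc m) u) (basis ((flip ^^ Suc m) bc) n) =
          complex_of_real (msign bc (Suc m)) * freq n ^ Suc m * cinner u (basis bc n))"
      if uS: "u \<in> bc_space bc (Suc m)"
    proof -
      obtain w where w: "is_weak_deriv (Suc m) u w" and b: "?bc = Dirichlet \<longrightarrow> vanishes_at_ends v"
        using uS unfolding bc_space_Suc v_def[symmetric] by blast
      have "wderiv (Suc m) u = w" by (rule wderiv_eq[OF w])
      moreover have "cinner w (basis (flip ?bc) n) = complex_of_real (dsign ?bc) * freq n * cinner v (basis ?bc n)" for n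
        using w b is_weak_deriv_Suc[OF v] by (intro first_order_coef) auto
      ultimately show ?thesis
        using w by (simp add: vc msign_def mult_ac)
    qed
    with iff show ?thesis by blast
  qed
qed

lemma operator_domain_fourier: "operator_domain k bc = trig.mdom bc (\<lambda>n. freq n ^ (2 * k))"
proof -
  have "bc_order bc j < 2 * k \<longleftrightarrow> j < k" for j
    by (cases bc) auto
  then have "operator_domain k bc = bc_space bc (2 * k)"
    by (simp add: operator_domain_def bc_space_def)
  then show ?thesis
    using bc_space_fourier by blast
qed

lemma form_domain_fourier: "form_domain k bc = trig.mdom bc (\<lambda>n. freq n ^ k)"
  using bc_space_fourier by (auto simp: form_domain_def bc_space_def)

lemma wderiv_operator_domain:
  assumes "u \<in> operator_domain k bc"
  shows "(-1) ^ k *\<^sub>C wderiv (2 * k) u = trig.mop bc (\<lambda>n. freq n ^ (2 * k)) u"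
proof -
  have "u \<in> bc_space bc (2 * k)"
    using assms bc_space_fourier operator_domain_fourier by blast
  then have "cinner (wderiv (2 * k) u) (basis ((flip ^^ (2 * k)) bc) n) =
      complex_of_real (msign bc (2 * k)) * freq n ^ (2 * k) * cinner u (basis bc n)" for n
    using bc_space_fourier by blast
  then have "cinner ((-1) ^ k *\<^sub>C wderiv (2 * k) u) (basis bc n) = freq n ^ (2 * k) * cinner u (basis bc n)" for n
    by (simp add: funpow_flip msign_double cinner_scaleC_left mult.assoc[symmetric] power_mult_distrib[symmetric])
  then show ?thesis
    by (rule trig.mop_eqI[symmetric])
qed

text \<open>For odd k the derivatives live in the other basis; Parseval's identity in both bases
  compares the inner products, and the sign occurs squared.\<close>

lemma cinner_wderiv_form_domain:
  assumes "u \<in> form_domain k bc" "v \<in> form_domain k bc"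
  shows "cinner (wderiv k u) (wderiv k v) =
    cinner (trig.mop bc (\<lambda>n. freq n ^ k) u) (trig.mop bc (\<lambda>n. freq n ^ k) v)"
proof -
  let ?c = "\<lambda>u n. cinner u (basis bc n)" and ?d = "\<lambda>u n. cinner u (basis ((flip ^^ k) bc) n)"
  have M: "u \<in> trig.mdom bc (\<lambda>n. freq n ^ k)" "v \<in> trig.mdom bc (\<lambda>n. freq n ^ k)"
    using assms by (auto simp: form_domain_fourier)
  have "u \<in> bc_space bc k" "v \<in> bc_space bc k"
    using M bc_space_fourier by blast+
  then have d: "?d (wderiv k u) n = complex_of_real (msign bc k) * freq n ^ k * ?c u n"
    "?d (wderiv k v) n = complex_of_real (msign bc k) * freq n ^ k * ?c v n" for n
    using bc_space_fourier by blast+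
  have s: "complex_of_real (msign bc k) * complex_of_real (msign bc k) = 1"
    using abs_msign[of bc k] by (simp add: abs_if split: if_splits flip: of_real_mult)
  have "?d (wderiv k u) n * cnj (?d (wderiv k v) n) =
      (complex_of_real (msign bc k) * complex_of_real (msign bc k)) *
      (?c (trig.mop bc (\<lambda>n. freq n ^ k) u) n * cnj (?c (trig.mop bc (\<lambda>n. freq n ^ k) v) n))" for n
    unfolding d trig.mop_coef[OF M(1)] trig.mop_coef[OF M(2)] by (simp add: mult_ac)
  then have "?d (wderiv k u) n * cnj (?d (wderiv k v) n) =
      ?c (trig.mop bc (\<lambda>n. freq n ^ k) u) n * cnj (?c (trig.mop bc (\<lambda>n. freq n ^ k) v) n)" for n
    unfolding s by simp
  then show ?thesis
    using trig.parseval[of "wderiv k u" "(flip ^^ k) bc" "wderiv k v"]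
      trig.parseval[of "trig.mop bc (\<lambda>n. freq n ^ k) u" bc "trig.mop bc (\<lambda>n. freq n ^ k) v"]
    by (simp add: sums_unique2)
qed

section \<open>The contraction term\<close>

lemma contraction_term_L2_of:
  assumes "\<alpha> \<in> {0<..<1}" "V \<in> Linf" "square_integrable f"
  shows "square_integrable (\<lambda>x. V x * f (\<alpha> * x))"
    and "mult_op V (contraction \<alpha> (L2_of f)) = L2_of (\<lambda>x. V x * f (\<alpha> * x))"
  using contraction_L2_of[OF assms(1,3)] mult_op_L2_of[OF assms(2)] by auto

lemma contraction_term_add:
  assumes "\<alpha> \<in> {0<..<1}" "V \<in> Linf"
  shows "mult_op V (contraction \<alpha> (u + v)) = mult_op V (contraction \<alpha> u) + mult_op V (contraction \<alpha> v)"
proof -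
  let ?f = "fun_of u" and ?g = "fun_of v"
  note sq = square_integrable_fun_of[of u] square_integrable_fun_of[of v]
  have "mult_op V (contraction \<alpha> (L2_of ?f + L2_of ?g)) =
      L2_of (\<lambda>x. V x * ?f (\<alpha> * x) + V x * ?g (\<alpha> * x))"
    using contraction_term_L2_of(2)[OF assms square_integrable_add[OF sq]] L2_of_scaleC_plus(1)[OF sq]
    by (simp add: distrib_left)
  also have "\<dots> = mult_op V (contraction \<alpha> (L2_of ?f)) + mult_op V (contraction \<alpha> (L2_of ?g))"
    by (simp add: contraction_term_L2_of[OF assms] sq L2_of_scaleC_plus(1))
  finally show ?thesis by (simp add: L2_of_fun_of)
qed

lemma contraction_term_scaleC:
  assumes "\<alpha> \<in> {0<..<1}" "V \<in> Linf"
  shows "mult_op V (contraction \<alpha> (c *\<^sub>C u)) = c *\<^sub>C mult_op V (contraction \<alpha> u)"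
proof -
  let ?f = "fun_of u"
  note sq = square_integrable_fun_of[of u]
  have "mult_op V (contraction \<alpha> (c *\<^sub>C L2_of ?f)) = L2_of (\<lambda>x. c * (V x * ?f (\<alpha> * x)))"
    using contraction_term_L2_of(2)[OF assms square_integrable_scale[OF sq, of c]] L2_of_scaleC_plus(2)[OF sq sq, of c]
    by (simp add: mult_ac)
  also have "\<dots> = c *\<^sub>C mult_op V (contraction \<alpha> (L2_of ?f))"
    by (simp add: contraction_term_L2_of[OF assms] sq L2_of_scaleC_plus(2)[OF _ square_integrable_zero])
  finally show ?thesis by (simp add: L2_of_fun_of)
qed

text \<open>The substitution \<open>y = \<alpha> x\<close> costs a factor \<open>1 / \<alpha>\<close> in the square of the norm, which the bound on \<open>V\<close>
  compensates.\<close>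

lemma norm_contraction_term:
  assumes \<alpha>: "\<alpha> \<in> {0<..<1}" and V: "V \<in> Linf" "Linf_norm V \<le> ereal (c * sqrt \<alpha>)" and "c > 0"
  shows "norm (mult_op V (contraction \<alpha> u)) \<le> c * norm u"
proof -
  let ?f = "fun_of u"
  define g where "g x = V x * ?f (\<alpha> * x)" for x
  have f: "square_integrable ?f" by (rule square_integrable_fun_of)
  have sg: "square_integrable g"
    unfolding g_def by (rule contraction_term_L2_of(1)[OF \<alpha> V(1) f])
  have sf: "square_integrable (\<lambda>x. ?f (\<alpha> * x))"
    by (rule contraction_L2_of(1)[OF \<alpha> f])
  have u: "mult_op V (contraction \<alpha> u) = L2_of g"
    using contraction_term_L2_of(2)[OF \<alpha> V(1) f] by (simp add: L2_of_fun_of g_def[abs_def])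
  have Vb: "AE x in unit_leb. norm (V x) \<le> c * sqrt \<alpha>"
    using esssup_AE[of "\<lambda>x. ereal (norm (V x))" unit_leb] V(2)
    unfolding Linf_norm_def by (auto elim!: eventually_mono dest: order_trans)
  have ig: "integrable unit_leb (\<lambda>x. (norm (g x))\<^sup>2)"
    and i\<alpha>: "integrable unit_leb (\<lambda>x. (norm (?f (\<alpha> * x)))\<^sup>2)"
    and if': "integrable unit_leb (\<lambda>x. (norm (?f x))\<^sup>2)"
    using sg sf f by (auto simp: square_integrable_def)
  have "(norm (L2_of g))\<^sup>2 = (LINT x|unit_leb. (norm (g x))\<^sup>2)"
    unfolding norm_fun_of using fun_of_L2_of[OF sg] square_integrable_fun_of[of "L2_of g"]
    by (intro integral_cong_AE borel_measurable_integrable ig) (auto simp: square_integrable_def elim: eventually_mono)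
  also have "\<dots> \<le> (LINT x|unit_leb. (c\<^sup>2 * \<alpha>) * (norm (?f (\<alpha> * x)))\<^sup>2)"
  proof (rule integral_mono_AE[OF ig])
    show "AE x in unit_leb. (norm (g x))\<^sup>2 \<le> (c\<^sup>2 * \<alpha>) * (norm (?f (\<alpha> * x)))\<^sup>2"
      using Vb
    proof eventually_elim
      case (elim x)
      have "(norm (V x))\<^sup>2 \<le> (c * sqrt \<alpha>)\<^sup>2"
        using elim by (intro power_mono) auto
      then show ?case
        using \<alpha> by (auto simp: g_def norm_mult power_mult_distrib intro!: mult_right_mono)
    qed
  qed (use i\<alpha> in simp)
  also have "\<dots> = (c\<^sup>2 * \<alpha>) * (LINT x|unit_leb. (norm (?f (\<alpha> * x)))\<^sup>2)"
    by simp
  also have "(LINT x|unit_leb. (norm (?f (\<alpha> * x)))\<^sup>2) \<le> (1 / \<alpha>) * (LINT x|unit_leb. (norm (?f x))\<^sup>2)"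
  proof -
    define F where "F x = indicator {0<..<1} x *\<^sub>R (norm (?f x))\<^sup>2" for x
    have iF: "integrable lebesgue F"
      using if' by (simp add: integrable_restrict_space F_def[abs_def])
    have "(LINT x|unit_leb. (norm (?f (\<alpha> * x)))\<^sup>2)
        = (LINT x|lebesgue. indicator {0<..<1} x *\<^sub>R (norm (?f (\<alpha> * x)))\<^sup>2)"
      by (simp add: integral_restrict_space)
    \<comment> \<open>The integrand on the right lives on (0, 1/\<alpha>); enlarging (0,1) to that
      interval is where equality is lost.\<close>
    also have "\<dots> \<le> (LINT x|lebesgue. F (0 + \<alpha> * x))"
    proof (rule integral_mono)
      show "integrable lebesgue (\<lambda>x. indicator {0<..<1} x *\<^sub>R (norm (?f (\<alpha> * x)))\<^sup>2)"
        using i\<alpha> by (simp add: integrable_restrict_space)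
      show "integrable lebesgue (\<lambda>x. F (0 + \<alpha> * x))"
        using lebesgue_integrable_real_affine[OF iF, of \<alpha> 0] \<alpha> by simp
      have "\<alpha> * x < 1" if "0 < x" "x < 1" for x
        using \<alpha> that mult_strict_mono[of \<alpha> 1 x 1] by auto
      then show "indicator {0<..<1} x *\<^sub>R (norm (?f (\<alpha> * x)))\<^sup>2 \<le> F (0 + \<alpha> * x)" for x
        using \<alpha> by (auto simp: F_def indicator_def)
    qed
    also have "\<dots> = (1 / \<alpha>) * (LINT x|lebesgue. F x)"
      using lebesgue_integral_real_affine[of \<alpha> F 0] \<alpha> by simp
    also have "(LINT x|lebesgue. F x) = (LINT x|unit_leb. (norm (?f x))\<^sup>2)"
      by (simp add: integral_restrict_space F_def)
    finally show ?thesis .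
  qed
  finally have "(norm (L2_of g))\<^sup>2 \<le> (c\<^sup>2 * \<alpha>) * ((1 / \<alpha>) * (LINT x|unit_leb. (norm (?f x))\<^sup>2))"
    using \<alpha> by (simp add: mult_left_mono)
  also have "\<dots> = (c * norm u)\<^sup>2"
    using \<alpha> by (simp add: norm_fun_of power_mult_distrib)
  finally have "(norm (L2_of g))\<^sup>2 \<le> (c * norm u)\<^sup>2" .
  then show ?thesis
    unfolding u by (rule power2_le_imp_le) (use \<open>c > 0\<close> in simp)
qed

section \<open>The operator with contraction\<close>

lemma resolvent_cong: "(\<And>u. u \<in> D \<Longrightarrow> T u = T' u) \<Longrightarrow> resolvent D T z = resolvent D T' z"
  by (auto simp: resolvent_def inv_into_def fun_eq_iff cong: conj_cong)

lemma resolvent_set_cong: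
  assumes "\<And>u. u \<in> D \<Longrightarrow> T u = T' u"
  shows "resolvent_set D T = resolvent_set D T'"
proof -
  have "bij_betw (\<lambda>u. T u - z *\<^sub>C u) D UNIV \<longleftrightarrow> bij_betw (\<lambda>u. T' u - z *\<^sub>C u) D UNIV" for z
    using assms by (intro bij_betw_cong) simp
  then show ?thesis
    by (simp add: resolvent_set_def resolvent_cong[OF assms])
qed

lemma eigenvalues_cong:
  assumes "\<And>u. u \<in> D \<Longrightarrow> T u = T' u"
  shows "eigenvalues D T = eigenvalues D T'"
  unfolding eigenvalues_def using assms by auto

lemma clinear_on_cong:
  assumes "\<And>u. u \<in> D \<Longrightarrow> T u = T' u"
  shows "clinear_on D T \<longleftrightarrow> clinear_on D T'"
  unfolding clinear_on_def using assms by (auto simp: csubspace_def)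

lemma m_sectorial_cong:
  assumes eq: "\<And>u. u \<in> D \<Longrightarrow> T u = T' u"
  shows "m_sectorial D T \<longleftrightarrow> m_sectorial D T'"
proof -
  have "{cinner (T u) u | u. u \<in> D \<and> norm u = 1} = {cinner (T' u) u | u. u \<in> D \<and> norm u = 1}"
    using eq by force
  then have "sectorial_operator D T \<longleftrightarrow> sectorial_operator D T'"
    by (simp add: sectorial_operator_def clinear_on_cong[OF eq])
  moreover have "m_accretive D (\<lambda>u. T u + c *\<^sub>R u) \<longleftrightarrow> m_accretive D (\<lambda>u. T' u + c *\<^sub>R u)" for c
  proof -
    have eq': "T u + c *\<^sub>R u = T' u + c *\<^sub>R u" if "u \<in> D" for u
      using eq[OF that] by simp
    let ?S = "\<lambda>u. T u + c *\<^sub>R u" and ?S' = "\<lambda>u. T' u + c *\<^sub>R u"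
    have "clinear_on D ?S \<longleftrightarrow> clinear_on D ?S'" "resolvent D ?S z = resolvent D ?S' z"
      "resolvent_set D ?S = resolvent_set D ?S'" for z
      using clinear_on_cong[of D ?S ?S', OF eq'] resolvent_cong[of D ?S ?S', OF eq']
        resolvent_set_cong[of D ?S ?S', OF eq'] by auto
    then show ?thesis
      unfolding m_accretive_def using eq by simp
  qed
  ultimately show ?thesis
    by (simp add: m_sectorial_def quasi_m_accretive_def)
qed

lemma sectorial_form_cong:
  assumes eq: "\<And>u v. u \<in> D \<Longrightarrow> v \<in> D \<Longrightarrow> t u v = t' u v"
  shows "sectorial_form D t \<longleftrightarrow> sectorial_form D t'"
proof -
  have "{t u u | u. u \<in> D \<and> norm u = 1} = {t' u u | u. u \<in> D \<and> norm u = 1}"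
    using eq by force
  moreover have "sesquilinear_on D t \<longleftrightarrow> sesquilinear_on D t'"
    unfolding sesquilinear_on_def using eq by (auto simp: csubspace_def)
  ultimately show ?thesis
    by (simp add: sectorial_form_def)
qed

text \<open>Closedness evaluates the form at differences of domain elements, hence the condition
  \<open>diff\<close>.\<close>

lemma closed_form_cong:
  assumes eq: "\<And>u v. u \<in> D \<Longrightarrow> v \<in> D \<Longrightarrow> t u v = t' u v"
    and diff: "\<And>u v. u \<in> D \<Longrightarrow> v \<in> D \<Longrightarrow> u - v \<in> D" and t': "closed_form D t'"
  shows "closed_form D t"
  unfolding closed_form_def
proof (intro allI impI)
  fix u x
  assume u: "\<forall>n. u n \<in> D" "u \<longlonglongrightarrow> x"
    "\<forall>e>0. \<exists>N. \<forall>m\<ge>N. \<forall>n\<ge>N. norm (t (u m - u n) (u m - u n)) < e"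
  have "t (u m - u n) (u m - u n) = t' (u m - u n) (u m - u n)" for m n
    using u(1) by (intro eq diff) auto
  then have x: "x \<in> D" "(\<lambda>n. t' (u n - x) (u n - x)) \<longlonglongrightarrow> 0"
    using t' u unfolding closed_form_def by auto
  moreover have "t (u n - x) (u n - x) = t' (u n - x) (u n - x)" for n
    using u(1) x(1) by (intro eq diff) auto
  ultimately show "x \<in> D \<and> (\<lambda>n. t (u n - x) (u n - x)) \<longlonglongrightarrow> 0"
    by simp
qed

lemma associated_operator_cong:
  assumes "\<And>u v. u \<in> Dt \<Longrightarrow> v \<in> Dt \<Longrightarrow> t u v = t' u v" "\<And>u. u \<in> D \<Longrightarrow> T u = T' u"
  shows "associated_operator Dt t D T \<longleftrightarrow> associated_operator Dt t' D T'"
  unfolding associated_operator_def using assms by (simp cong: conj_cong ball_cong)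

section \<open>Growth and gaps of the unperturbed eigenvalues\<close>

lemma power_difference_ge:
  fixes x y :: real
  assumes "x \<ge> 0" "y \<ge> 0" "K \<ge> 1"
  shows "\<bar>x - y\<bar> * y ^ (K - 1) \<le> \<bar>x ^ K - y ^ K\<bar>"
proof -
  \<comment> \<open>Of the cofactor of x - y in x^K - y^K only the term with i = 0 is kept; all
    others are nonnegative.\<close>
  have "y ^ (K - 1) = (\<Sum>i\<in>{0}. y ^ (K - Suc i) * x ^ i)"
    by simp
  also have "\<dots> \<le> (\<Sum>i<K. y ^ (K - Suc i) * x ^ i)"
    using assms by (intro sum_mono2) auto
  finally have "\<bar>x - y\<bar> * y ^ (K - 1) \<le> \<bar>x - y\<bar> * (\<Sum>i<K. y ^ (K - Suc i) * x ^ i)"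
    by (intro mult_left_mono) auto
  also have "\<dots> = \<bar>x - y\<bar> * \<bar>\<Sum>i<K. y ^ (K - Suc i) * x ^ i\<bar>"
    using assms by (simp add: sum_nonneg)
  also have "\<dots> = \<bar>x ^ K - y ^ K\<bar>"
    by (simp add: power_diff_sumr2 abs_mult)
  finally show ?thesis .
qed

text \<open>Distinct frequencies differ by at least 1, and the remaining factor (pi n)^(2k-1) is at
  least n since 2k - 1 is at least 1; so n only has to exceed g.\<close>

lemma frequency_gap:
  assumes "k \<ge> 1"
  shows "\<exists>n. n \<noteq> 0 \<and> ((pi * real n) ^ k)\<^sup>2 \<ge> g \<and>
    (\<forall>m. m \<noteq> n \<longrightarrow> \<bar>((pi * real m) ^ k)\<^sup>2 - ((pi * real n) ^ k)\<^sup>2\<bar> \<ge> g)"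
proof -
  define n where "n = nat \<lceil>\<bar>g\<bar>\<rceil> + 1"
  have n: "n \<noteq> 0" "g \<le> real n"
    unfolding n_def by linarith+
  have "1 * real n \<le> pi * real n"
    using pi_ge_two by (intro mult_right_mono) auto
  then have pn: "real n \<le> pi * real n" "1 \<le> pi * real n"
    using n(1) by linarith+
  have pow: "real n \<le> (pi * real n) ^ K" if "K \<ge> 1" for K
    using pn power_increasing[of 1 K "pi * real n"] that by simp
  have gap: "g \<le> \<bar>(pi * real m) ^ (2 * k) - (pi * real n) ^ (2 * k)\<bar>" if "m \<noteq> n" for m
  proof -
    have "1 * 1 \<le> pi * \<bar>real m - real n\<bar>"
      using that pi_ge_two by (intro mult_mono) auto
    also have "\<dots> = \<bar>pi * real m - pi * real n\<bar>"
      by (simp add: abs_mult flip: right_diff_distrib)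
    finally have "1 * real n \<le> \<bar>pi * real m - pi * real n\<bar> * (pi * real n) ^ (2 * k - 1)"
      using assms by (intro mult_mono pow) auto
    also have "\<dots> \<le> \<bar>(pi * real m) ^ (2 * k) - (pi * real n) ^ (2 * k)\<bar>"
      using assms by (intro power_difference_ge) auto
    finally show ?thesis
      using n(2) by simp
  qed
  have "g \<le> (pi * real n) ^ (2 * k)"
    using pow[of "2 * k"] assms n(2) by simp
  with gap n(1) show ?thesis
    by (intro exI[of _ n]) (auto simp: power_mult[symmetric] mult.commute)
qed

lemma frequency_tendsto:
  assumes "k \<ge> 1"
  shows "filterlim (\<lambda>n. (pi * real n) ^ k) at_top sequentially"
proof -
  have "filterlim (\<lambda>n. pi * real n) at_top sequentially"
    using pi_gt_zero by (intro filterlim_tendsto_pos_mult_at_top[OF tendsto_const _ filterlim_real_sequentially])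
  then show ?thesis
    using assms by (intro filterlim_pow_at_top) auto
qed

theorem theorem1:
  fixes k :: nat and bc :: boundary_type and c\<^sub>0 :: real and V :: "real \<Rightarrow> real \<Rightarrow> complex"
  assumes "k \<ge> 1" and "c\<^sub>0 > 0"
    and "\<And>\<alpha>. \<alpha> \<in> {0<..<1} \<Longrightarrow> V \<alpha> \<in> Linf"
    and "\<And>\<alpha>. \<alpha> \<in> {0<..<1} \<Longrightarrow> Linf_norm (V \<alpha>) \<le> ereal (c\<^sub>0 * sqrt \<alpha>)"
  shows
    "(\<forall>\<alpha>\<in>{0<..<1}.
        m_sectorial (operator_domain k bc) (H_op k \<alpha> (V \<alpha>)) \<and>
        sectorial_form (form_domain k bc) (h_form k \<alpha> (V \<alpha>)) \<and>
        closed_form (form_domain k bc) (h_form k \<alpha> (V \<alpha>)) \<and>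
        associated_operator (form_domain k bc) (h_form k \<alpha> (V \<alpha>))
          (operator_domain k bc) (H_op k \<alpha> (V \<alpha>))) \<and>
     (\<exists>\<Lambda>::real. \<forall>\<alpha>\<in>{0<..<1}.
        {z. Re z \<le> \<Lambda>} \<subseteq> resolvent_set (operator_domain k bc) (H_op k \<alpha> (V \<alpha>))) \<and>
     (\<forall>\<alpha>\<in>{0<..<1}.
        has_compact_resolvent (operator_domain k bc) (H_op k \<alpha> (V \<alpha>)) \<and>
        spectrum (operator_domain k bc) (H_op k \<alpha> (V \<alpha>)) =
          eigenvalues (operator_domain k bc) (H_op k \<alpha> (V \<alpha>)) \<and>
        countable (spectrum (operator_domain k bc) (H_op k \<alpha> (V \<alpha>))) \<and>
        (\<forall>z. \<not> z islimpt spectrum (operator_domain k bc) (H_op k \<alpha> (V \<alpha>))) \<and>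
        \<not> bounded (spectrum (operator_domain k bc) (H_op k \<alpha> (V \<alpha>))))"
proof -
  let ?D = "operator_domain k bc" and ?Q = "form_domain k bc"
  let ?H = "\<lambda>\<alpha>. H_op k \<alpha> (V \<alpha>)" and ?h = "\<lambda>\<alpha>. h_form k \<alpha> (V \<alpha>)"
  \<comment> \<open>Everything is shown for one \<alpha>, with the explicit bound
    \<open>- c\<^sub>0 - 1\<close>, strictly left of \<open>- c\<^sub>0\<close> and the same for all
    \<alpha>.\<close>
  have main: "m_sectorial ?D (?H \<alpha>) \<and> sectorial_form ?Q (?h \<alpha>) \<and> closed_form ?Q (?h \<alpha>) \<and>
      associated_operator ?Q (?h \<alpha>) ?D (?H \<alpha>) \<and>
      {z. Re z \<le> - c\<^sub>0 - 1} \<subseteq> resolvent_set ?D (?H \<alpha>) \<and> has_compact_resolvent ?D (?H \<alpha>) \<and>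
      spectrum ?D (?H \<alpha>) = eigenvalues ?D (?H \<alpha>) \<and> countable (spectrum ?D (?H \<alpha>)) \<and>
      (\<forall>z. \<not> z islimpt spectrum ?D (?H \<alpha>)) \<and> \<not> bounded (spectrum ?D (?H \<alpha>))"
    if \<alpha>: "\<alpha> \<in> {0<..<1}" for \<alpha>
  proof -
    let ?Ha = "H_op k \<alpha> (V \<alpha>)" and ?ha = "h_form k \<alpha> (V \<alpha>)"
    let ?B = "\<lambda>u. mult_op (V \<alpha>) (contraction \<alpha> u)"
    note V = assms(3)[OF \<alpha>] assms(4)[OF \<alpha>]
    \<comment> \<open>The entries (pi n)^k are those of the square root, and b is
      \<open>c\<^sub>0\<close>, which is what makes every bound uniform in \<alpha>.\<close>
    interpret P: perturbed_multiplication "basis bc" "\<lambda>n. (pi * real n) ^ k" ?B c\<^sub>0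
    proof
      show "filterlim (\<lambda>n. (pi * real n) ^ k) at_top sequentially"
        by (rule frequency_tendsto[OF assms(1)])
      show "norm (?B u) \<le> c\<^sub>0 * norm u" for u
        by (rule norm_contraction_term[OF \<alpha> V assms(2)])
    qed (use \<alpha> V assms(2) in \<open>simp_all add: contraction_term_add contraction_term_scaleC\<close>)
    have sq: "(\<lambda>n. (complex_of_real ((pi * real n) ^ k))\<^sup>2) = (\<lambda>n. freq n ^ (2 * k))"
      and pw: "(\<lambda>n. complex_of_real ((pi * real n) ^ k)) = (\<lambda>n. freq n ^ k)"
      by (simp_all add: power_mult[symmetric] mult.commute)
    have D: "?D = P.D" and Q: "?Q = P.Q"
      unfolding sq pw by (rule operator_domain_fourier form_domain_fourier)+
    have H: "?Ha u = P.T u" if "u \<in> P.D" for u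
      using wderiv_operator_domain[of u k bc] that
      unfolding H_op_def P.T_def D[symmetric] by (simp only: sq)
    have h: "?ha u v = P.t u v" if "u \<in> P.Q" "v \<in> P.Q" for u v
      using cinner_wderiv_form_domain[of u k bc v] that
      unfolding h_form_def P.t_def Q[symmetric] by (simp only: pw)
    have diff: "u - v \<in> P.Q" if "u \<in> P.Q" "v \<in> P.Q" for u v
      using that by (rule trig.mdom_diff)
    have R: "resolvent_set P.D ?Ha = resolvent_set P.D P.T"
      and Rz: "resolvent P.D ?Ha z = resolvent P.D P.T z" for z
      using resolvent_set_cong[of P.D ?Ha P.T] resolvent_cong[of P.D ?Ha P.T] H by blast+
    have S: "spectrum P.D ?Ha = eigenvalues P.D P.T" "eigenvalues P.D ?Ha = eigenvalues P.D P.T"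
      unfolding spectrum_def R
      by (rule P.spectrum_eq_eigenvalues[unfolded spectrum_def], rule eigenvalues_cong, rule H)
    have "m_sectorial P.D ?Ha"
      using P.m_sectorial_T by (subst m_sectorial_cong[OF H])
    moreover have "sectorial_form P.Q ?ha"
      using P.sectorial_t by (subst sectorial_form_cong[OF h])
    moreover have "closed_form P.Q ?ha"
      by (rule closed_form_cong[OF h diff P.closed_t])
    moreover have "associated_operator P.Q ?ha P.D ?Ha"
      using P.associated_T by (subst associated_operator_cong[OF h H])
    moreover have "{z. Re z \<le> - c\<^sub>0 - 1} \<subseteq> resolvent_set P.D (?Ha)"
      unfolding R using P.left_in_resolvent_set(1) by auto
    moreover have "has_compact_resolvent P.D (?Ha)"
      using P.compact_resolvent_T unfolding has_compact_resolvent_def R Rz .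
    moreover have "\<not> bounded (eigenvalues P.D P.T)"
    proof (rule P.eigenvalues_unbounded)
      fix g
      obtain n where n: "n \<noteq> 0" "((pi * real n) ^ k)\<^sup>2 \<ge> g"
        "\<forall>m. m \<noteq> n \<longrightarrow> \<bar>((pi * real m) ^ k)\<^sup>2 - ((pi * real n) ^ k)\<^sup>2\<bar> \<ge> g"
        using frequency_gap[OF assms(1)] by blast
      moreover have "basis bc n \<noteq> 0"
        using norm_basis[of bc n] n(1) by auto
      ultimately show "\<exists>n. basis bc n \<noteq> 0 \<and> ((pi * real n) ^ k)\<^sup>2 \<ge> g \<and>
          (\<forall>m. m \<noteq> n \<longrightarrow> \<bar>((pi * real m) ^ k)\<^sup>2 - ((pi * real n) ^ k)\<^sup>2\<bar> \<ge> g)"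
        by blast
    qed
    ultimately show ?thesis
      unfolding D Q S using P.countable_eigenvalues P.eigenvalues_no_islimpt by blast
  qed
  then show ?thesis
    by blast
qed

end
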